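(* For any causal DAG $G$, $\mathcal{GPT}(G)\subseteq\mathcal{VVS}(G)$.
   Context: **Causal DAGs.** A causal DAG $G(V,W,\mathcal E)$ is a finite directed acyclic graph with vertex set $V\sqcup W$ and edge set $\mathcal E$. Each $v\in V$ carries an observed variable $X_v$ with a fixed finite alphabet $\mathcal X_v$; vertices in $W$ are latent (they may have parents). $\mathrm{pa}$ denotes parents; $X_S=(X_v)_{v\in S}$. A (probability) kernel $q(x_A|x_B)$ is a non-negative function with $\sum_{x_A}q(x_A|x_B)=1$ for every $x_B$. **GPTs.** A GPT (generalized probabilistic theory) $\mathcal G$ consists of system types, closed under an associative, symmetric composition $(A,B)\mapsto AB$ with trivial system $I$, subject to: (1) each state of a system $A$ is determined by the kernel of outcome probabilities of a complete set of fiducial measurements, so states are vectors in a real vector space $V_A$ (with $V_I=\mathbb R$ and normalized state $1$). (2) The state set $\mathcal S_A\subset V_A$ is the convex hull of a convex set $\Omega_A$ of normalized states and the zero vector; a linear functional $u_A$ equals $1$ on $\Omega_A$. (3) Transformations from $A$ to $B$ are linear maps; they can be applied to part of a composite system (giving maps $V_{AC}\to V_{BC}$ for every $C$) and compose sequentially and in parallel according to the usual rules of a symmetric monoidal category; all linear maps taking states to states (also when applied to part of a composite) are allowed. States are transformations $I\to A$, effects are transformations $A\to I$. (4) If $\omega_A\in\mathcal S_A$, $\omega_B\in\mathcal S_B$ then $\omega_A\otimes\omega_B\in\mathcal S_{AB}$. (5) No-signalling: for $\omega\in\Omega_{AB}$ and any measurement on $A$ (effects $\{e_x\}$ with $\sum_x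 e_x=u_A$), $\sum_x(e_x\otimes \mathrm{id}_B)(\omega)$ is a normalized state of $B$ that does not depend on the measurement (equivalently, the deterministic effect $u_A$ of each system is unique). A test from $A$ to $B$ with finite outcome set $\mathcal X$ is a family $\{T_x\}_{x\in\mathcal X}$ of transformations with $u_B\circ\sum_xT_x=u_A$. **The sets $\mathcal G(G)$ and $\mathcal{GPT}(G)$.** Assign to every edge leaving a latent vertex a system type; edges leaving observed vertices carry the trivial system. To each vertex $v$ and each value of its observed parents $x_{\mathrm{pa}(v)\cap V}$ assign a test $\{T(x_v|x_{\mathrm{pa}(v)})\}$ whose input is the composite of the systems on edges into $v$ and whose output is the composite of the systems on edges out of $v$. If $v\in V$ the outcome set is $\mathcal X_v$ (and the output is trivial); if $v\in W$ there is a single trivial outcome. Wiring all tests according to $G$ gives for each $x_V$ a scalar $p(x_V)=\prod_{v\in V\cup W}T(x_v|x_{\mathrm{pa}(v)})$ (circuit composition). $\mathcal G(G)$ is the set of all distributions $p(X_V)$ so obtained, and $\mathcal{GPT}(G)=\bigcup_{\mathcal G}\mathcal G(G)$ over all GPTs. **Ordinary Markov model.** $\mathcal I(G)$ is the set of distributions $p(X_V)$ such that for all disjoint $A,B,C\subseteq V$ with $A,B$ $d$-separated by $C$ in $G$ (standard $d$-separation, paths may pass through latent vertices), $X_A\perp X_B\mid X_C$. If $S$ is a set of parentless observed vertices of a DAG with observed set $V\sqcup S$, a kernel $q(X_V|X_S)$ is said to be in $\mathcal I$ of that DAG if the joint distribution in which the variables $X_s$, $s\in S$, are independent and uniform and $X_V$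 given $X_S$ is distributed as $q$ is in it. **Visible vertex splitting.** Let $V_{\rm split}\subseteq V$ be the observed vertices having both an incoming and an outgoing edge. $\mathsf{VVSplit}(G)$ has observed vertices $V\cup V^\#$ with $V^\#=\{v^\#:v\in V_{\rm split}\}$ new parentless vertices ($X_{v^\#}$ has the alphabet of $X_v$), latent vertices $W$, and edges obtained from $\mathcal E$ by replacing each edge $v\to y$, $v\in V_{\rm split}$, by $v^\#\to y$. The projection of a kernel $q(X_V|X_{V^\#})$ is $\mathsf{Proj}(q)(x_V)=q(x_V\mid X_{v^\#}=x_v\ \forall v\in V_{\rm split})$. $\mathcal{VVS}(G)=\{\mathsf{Proj}(q): q(X_V|X_{V^\#})\in\mathcal I(\mathsf{VVSplit}(G))\}$. *)

theory Defs
  imports "HOL-Analysis.Analysis"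
begin

section \<open>Causal DAGs\<close>

record ('n, 'a) causal_dag =
  obs :: "'n set"
  lat :: "'n set"
  edges :: "('n \<times> 'n) set"
  alph :: "'n \<Rightarrow> 'a set"

definition causal_dag :: "('n, 'a) causal_dag \<Rightarrow> bool" where
  "causal_dag G \<longleftrightarrow>
     finite (obs G) \<and> finite (lat G) \<and> obs G \<inter> lat G = {} \<and>
     edges G \<subseteq> (obs G \<union> lat G) \<times> (obs G \<union> lat G) \<and> acyclic (edges G) \<and>
     (\<forall>v\<in>obs G. finite (alph G v) \<and> alph G v \<noteq> {})"

definition parents :: "('n, 'a) causal_dag \<Rightarrow> 'n \<Rightarrow> 'n set" where
  "parents G v = {u. (u, v) \<in> edges G}"

definition configs :: "('n, 'a) causal_dag \<Rightarrow> 'n set \<Rightarrow> ('n \<Rightarrow> 'a) set" where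
  "configs G S = PiE S (alph G)"

text \<open>Distributions of \<open>X\<^sub>V\<close> are functions on \<open>configs G (obs G)\<close>, made extensional so that
  equality of functions is equality of distributions.\<close>

definition distributions :: "('n, 'a) causal_dag \<Rightarrow> (('n \<Rightarrow> 'a) \<Rightarrow> real) set" where
  "distributions G =
     {p \<in> extensional (configs G (obs G)).
        (\<forall>x\<in>configs G (obs G). 0 \<le> p x) \<and> (\<Sum>x\<in>configs G (obs G). p x) = 1}"


section \<open>The ordinary Markov model\<close>

definition dag_path :: "('n \<times> 'n) set \<Rightarrow> 'n list \<Rightarrow> bool" where
  "dag_path E xs \<longleftrightarrow>
     xs \<noteq> [] \<and> distinct xs \<and>
     (\<forall>i. Suc i < length xs \<longrightarrow> (xs ! i, xs ! Suc i) \<in> E \<or> (xs ! Suc i, xs ! i) \<in> E)"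

definition collider :: "('n \<times> 'n) set \<Rightarrow> 'n list \<Rightarrow> nat \<Rightarrow> bool" where
  "collider E xs i \<longleftrightarrow> (xs ! (i - 1), xs ! i) \<in> E \<and> (xs ! Suc i, xs ! i) \<in> E"

definition blocked :: "('n \<times> 'n) set \<Rightarrow> 'n set \<Rightarrow> 'n list \<Rightarrow> bool" where
  "blocked E C xs \<longleftrightarrow>
     (\<exists>i. 0 < i \<and> Suc i < length xs \<and>
        (if collider E xs i then \<forall>d. (xs ! i, d) \<in> E\<^sup>* \<longrightarrow> d \<notin> C else xs ! i \<in> C))"

definition d_separated :: "('n \<times> 'n) set \<Rightarrow> 'n set \<Rightarrow> 'n set \<Rightarrow> 'n set \<Rightarrow> bool" where
  "d_separated E A B C \<longleftrightarrow>
     (\<forall>xs. dag_path E xs \<and> hd xs \<in> A \<and> last xs \<in> B \<longrightarrow> blocked E C xs)"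

definition marginal ::
  "('n, 'a) causal_dag \<Rightarrow> (('n \<Rightarrow> 'a) \<Rightarrow> real) \<Rightarrow> 'n set \<Rightarrow> ('n \<Rightarrow> 'a) \<Rightarrow> real" where
  "marginal G p S x = (\<Sum>y \<in> {y \<in> configs G (obs G). \<forall>v\<in>S. y v = x v}. p y)"

definition cond_indep ::
  "('n, 'a) causal_dag \<Rightarrow> (('n \<Rightarrow> 'a) \<Rightarrow> real) \<Rightarrow> 'n set \<Rightarrow> 'n set \<Rightarrow> 'n set \<Rightarrow> bool" where
  "cond_indep G p A B C \<longleftrightarrow>
     (\<forall>x\<in>configs G (obs G). marginal G p C x > 0 \<longrightarrow>
        marginal G p (A \<union> B \<union> C) x / marginal G p C x =
        (marginal G p (A \<union> C) x / marginal G p C x) * (marginal G p (B \<union> C) x / marginal G p C x))"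

definition markov :: "('n, 'a) causal_dag \<Rightarrow> (('n \<Rightarrow> 'a) \<Rightarrow> real) set" where
  "markov G =
     {p \<in> distributions G.
        \<forall>A B C. A \<subseteq> obs G \<and> B \<subseteq> obs G \<and> C \<subseteq> obs G \<and>
          A \<inter> B = {} \<and> A \<inter> C = {} \<and> B \<inter> C = {} \<and> d_separated (edges G) A B C
          \<longrightarrow> cond_indep G p A B C}"

text \<open>For a kernel, \<open>q x s\<close> is the probability \<open>q(x|s)\<close>.\<close>

definition kernels ::
  "('n, 'a) causal_dag \<Rightarrow> 'n set \<Rightarrow> 'n set \<Rightarrow> (('n \<Rightarrow> 'a) \<Rightarrow> ('n \<Rightarrow> 'a) \<Rightarrow> real) set" where
  "kernels G A B =
     {q. \<forall>s\<in>configs G B. (\<forall>x\<in>configs G A. 0 \<le> q x s) \<and> (\<Sum>x\<in>configs G A. q x s) = 1}"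

text \<open>Here \<open>S\<close> is a set of parentless observed vertices; the remaining observed vertices are the
  outputs of the kernel. The joint distribution makes the \<open>X\<^sub>s\<close> independent and uniform.\<close>

definition markov_kernels ::
  "('n, 'a) causal_dag \<Rightarrow> 'n set \<Rightarrow> (('n \<Rightarrow> 'a) \<Rightarrow> ('n \<Rightarrow> 'a) \<Rightarrow> real) set" where
  "markov_kernels G S =
     {q \<in> kernels G (obs G - S) S.
        (\<lambda>z\<in>configs G (obs G).
           q (restrict z (obs G - S)) (restrict z S) * (\<Prod>s\<in>S. 1 / real (card (alph G s))))
        \<in> markov G}"


section \<open>Visible vertex splitting\<close>

datatype 'n split_vertex = Base (orig: 'n) | Sharp (orig: 'n)

definition split_vertices :: "('n, 'a) causal_dag \<Rightarrow> 'n set" where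
  "split_vertices G = {v \<in> obs G. (\<exists>u. (u, v) \<in> edges G) \<and> (\<exists>y. (v, y) \<in> edges G)}"

definition vvsplit :: "('n, 'a) causal_dag \<Rightarrow> ('n split_vertex, 'a) causal_dag" where
  "vvsplit G =
     \<lparr> obs = Base ` obs G \<union> Sharp ` split_vertices G,
       lat = Base ` lat G,
       edges = {(if u \<in> split_vertices G then Sharp u else Base u, Base y) | u y. (u, y) \<in> edges G},
       alph = (\<lambda>z. alph G (orig z)) \<rparr>"

definition projection ::
  "('n, 'a) causal_dag \<Rightarrow>
   (('n split_vertex \<Rightarrow> 'a) \<Rightarrow> ('n split_vertex \<Rightarrow> 'a) \<Rightarrow> real) \<Rightarrow> ('n \<Rightarrow> 'a) \<Rightarrow> real" where
  "projection G q =
     (\<lambda>x\<in>configs G (obs G).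
        q (\<lambda>z\<in>Base ` obs G. x (orig z)) (\<lambda>z\<in>Sharp ` split_vertices G. x (orig z)))"

definition VVS :: "('n, 'a) causal_dag \<Rightarrow> (('n \<Rightarrow> 'a) \<Rightarrow> real) set" where
  "VVS G = projection G ` markov_kernels (vvsplit G) (Sharp ` split_vertices G)"

lemma vvsplit_causal_dag:
  assumes G: "causal_dag G"
  shows "causal_dag (vvsplit G)"
    and "Sharp ` split_vertices G \<subseteq> obs (vvsplit G)"
    and "\<And>s. s \<in> Sharp ` split_vertices G \<Longrightarrow> parents (vvsplit G) s = {}"
    and "obs (vvsplit G) - Sharp ` split_vertices G = Base ` obs G"
proof -
  have split: "split_vertices G \<subseteq> obs G"
    by (auto simp: split_vertices_def)
  have orig: "(orig a, orig b) \<in> edges G" if "(a, b) \<in> edges (vvsplit G)" for a b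
    using that by (auto simp: vvsplit_def)
  have "(orig a, orig b) \<in> (edges G)\<^sup>+" if "(a, b) \<in> (edges (vvsplit G))\<^sup>+" for a b
    using that by (induction rule: trancl_induct) (auto dest: orig intro: trancl_into_trancl)
  then have "acyclic (edges (vvsplit G))"
    using G unfolding acyclic_def causal_dag_def by blast
  moreover have "edges (vvsplit G) \<subseteq>
      (obs (vvsplit G) \<union> lat (vvsplit G)) \<times> (obs (vvsplit G) \<union> lat (vvsplit G))"
    using G by (auto simp: vvsplit_def causal_dag_def)
  ultimately show "causal_dag (vvsplit G)"
    using G split unfolding causal_dag_def
    by (auto simp: vvsplit_def intro: finite_subset)
  show "Sharp ` split_vertices G \<subseteq> obs (vvsplit G)"
    by (auto simp: vvsplit_def)
  show "parents (vvsplit G) s = {}" if "s \<in> Sharp ` split_vertices G" for s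
    using that by (auto simp: vvsplit_def parents_def)
  show "obs (vvsplit G) - Sharp ` split_vertices G = Base ` obs G"
    by (auto simp: vvsplit_def)
qed


section \<open>Generalized probabilistic theories\<close>

text \<open>System types are the elements of \<open>'s\<close>, transformations elements of \<open>'t\<close>, and the vector
  spaces \<open>V\<^sub>A\<close> are subspaces of one ambient real vector space \<open>'v\<close> (any family of real vector
  spaces embeds in its direct sum).

  Local tomography is not assumed, so the linear map \<open>V\<^sub>A \<rightarrow> V\<^sub>B\<close> of a transformation need not
  determine the maps \<open>V\<^sub>A\<^sub>C \<rightarrow> V\<^sub>B\<^sub>C\<close> obtained by applying it to part of a composite. Hence
  transformations are the morphisms of a strict symmetric monoidal category, with a functorial
  action by linear maps; \<open>par T (ident C)\<close> is \<open>T\<close> applied to the first part of a composite.\<close>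

record ('s, 't, 'v) gpt =
  triv :: "'s" ("\<I>\<index>")
  compose :: "'s \<Rightarrow> 's \<Rightarrow> 's" (infixr "\<odot>\<index>" 70)
  hom :: "'s \<Rightarrow> 's \<Rightarrow> 't set"
  ident :: "'s \<Rightarrow> 't"
  seq :: "'t \<Rightarrow> 't \<Rightarrow> 't" (infixr "\<cdot>\<index>" 65)
  par :: "'t \<Rightarrow> 't \<Rightarrow> 't" (infixr "\<otimes>\<index>" 70)
  swap :: "'s \<Rightarrow> 's \<Rightarrow> 't"
  space :: "'s \<Rightarrow> 'v set"
  one :: "'v" ("\<one>\<index>")
  nstates :: "'s \<Rightarrow> 'v set" ("\<Omega>\<index>")
  act :: "'t \<Rightarrow> 'v \<Rightarrow> 'v"
  discard :: "'s \<Rightarrow> 't"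

definition states :: "('s, 't, 'v :: real_vector) gpt \<Rightarrow> 's \<Rightarrow> 'v set" where
  "states \<G> A = convex hull (nstates \<G> A \<union> {0})"

definition test ::
  "('s, 't, 'v :: real_vector) gpt \<Rightarrow> 's \<Rightarrow> 's \<Rightarrow> 'x set \<Rightarrow> ('x \<Rightarrow> 't) \<Rightarrow> bool" where
  "test \<G> A B X T \<longleftrightarrow>
     finite X \<and> (\<forall>x\<in>X. T x \<in> hom \<G> A B) \<and>
     (\<forall>\<omega>\<in>space \<G> A. act \<G> (discard \<G> B) (\<Sum>x\<in>X. act \<G> (T x) \<omega>) = act \<G> (discard \<G> A) \<omega>)"

abbreviation measurement ::
  "('s, 't, 'v :: real_vector) gpt \<Rightarrow> 's \<Rightarrow> 'x set \<Rightarrow> ('x \<Rightarrow> 't) \<Rightarrow> bool" where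
  "measurement \<G> A X e \<equiv> test \<G> A (triv \<G>) X e"

text \<open>Since objects are strictly associative and unital, so is \<open>par\<close>. Symmetry of the composition
  is the isomorphism \<open>swap A B\<close> from \<open>AB\<close> to \<open>BA\<close>.\<close>

locale symmetric_monoidal =
  fixes \<G> :: "('s, 't, 'v) gpt" (structure)
  assumes compose_assoc: "(A \<odot> B) \<odot> C = A \<odot> (B \<odot> C)"
    and compose_unit [simp]: "\<I> \<odot> A = A" "A \<odot> \<I> = A"
    and ident_hom: "ident \<G> A \<in> hom \<G> A A"
    and seq_hom: "\<lbrakk>S \<in> hom \<G> B C; T \<in> hom \<G> A B\<rbrakk> \<Longrightarrow> S \<cdot> T \<in> hom \<G> A C"
    and seq_assoc: "\<lbrakk>R \<in> hom \<G> C D; S \<in> hom \<G> B C; T \<in> hom \<G> A B\<rbrakk> \<Longrightarrow> (R \<cdot> S) \<cdot> T = R \<cdot> (S \<cdot> T)"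
    and seq_ident: "T \<in> hom \<G> A B \<Longrightarrow> T \<cdot> ident \<G> A = T" "T \<in> hom \<G> A B \<Longrightarrow> ident \<G> B \<cdot> T = T"
    and par_hom: "\<lbrakk>S \<in> hom \<G> A B; T \<in> hom \<G> C D\<rbrakk> \<Longrightarrow> S \<otimes> T \<in> hom \<G> (A \<odot> C) (B \<odot> D)"
    and par_assoc: "\<lbrakk>R \<in> hom \<G> A A'; S \<in> hom \<G> B B'; T \<in> hom \<G> C C'\<rbrakk> \<Longrightarrow> (R \<otimes> S) \<otimes> T = R \<otimes> (S \<otimes> T)"
    and par_unit: "T \<in> hom \<G> A B \<Longrightarrow> ident \<G> \<I> \<otimes> T = T" "T \<in> hom \<G> A B \<Longrightarrow> T \<otimes> ident \<G> \<I> = T"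
    and par_ident: "ident \<G> A \<otimes> ident \<G> B = ident \<G> (A \<odot> B)"
    and interchange:
      "\<lbrakk>S \<in> hom \<G> B C; T \<in> hom \<G> A B; S' \<in> hom \<G> B' C'; T' \<in> hom \<G> A' B'\<rbrakk> \<Longrightarrow>
         (S \<cdot> T) \<otimes> (S' \<cdot> T') = (S \<otimes> S') \<cdot> (T \<otimes> T')"
    and swap_hom: "swap \<G> A B \<in> hom \<G> (A \<odot> B) (B \<odot> A)"
    and swap_natural:
      "\<lbrakk>S \<in> hom \<G> A B; T \<in> hom \<G> C D\<rbrakk> \<Longrightarrow> swap \<G> B D \<cdot> (S \<otimes> T) = (T \<otimes> S) \<cdot> swap \<G> A C"
    and swap_swap: "swap \<G> B A \<cdot> swap \<G> A B = ident \<G> (A \<odot> B)"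
    and hexagon:
      "swap \<G> A (B \<odot> C) = (ident \<G> B \<otimes> swap \<G> A C) \<cdot> (swap \<G> A B \<otimes> ident \<G> C)"

text \<open>The identification \<open>V\<^sub>I = \<real>\<close> sends \<open>r *\<^sub>R \<one>\<close> to \<open>r\<close>; the functional \<open>u\<^sub>A\<close> is the action of the
  effect \<open>discard A\<close>. \<open>act T\<close> is linear on the whole ambient space without loss of generality;
  only its values on the spaces \<open>V\<^sub>A\<close> with \<open>T\<close> having input \<open>A\<close> are constrained otherwise.

  The rule that the product \<open>\<omega>\<^sub>A \<otimes> \<omega>\<^sub>B\<close> is a state is not listed: it is a consequence of \<open>par_hom\<close> and
  \<open>states_transformations\<close>, see \<open>state_tensor\<close> below.

  In \<open>all_maps\<close>, a linear map together with its applications to parts of composites is a family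
  \<open>F\<close> of maps \<open>F C\<close> from \<open>V\<^sub>A\<^sub>C\<close> to \<open>V\<^sub>B\<^sub>C\<close> that commutes with the transformations of the other
  part.\<close>

locale gpt = symmetric_monoidal \<G>
  for \<G> :: "('s, 't, 'v :: real_vector) gpt" (structure) +
  assumes space_subspace: "subspace (space \<G> A)"
    and one_nonzero: "\<one> \<noteq> 0"
    and space_triv: "space \<G> \<I> = span {\<one>}"
    and nstates_triv: "\<Omega> \<I> = {\<one>}"
    and nstates_space: "\<Omega> A \<subseteq> space \<G> A"
    and nstates_convex: "convex (\<Omega> A)"
    and act_linear: "T \<in> hom \<G> A B \<Longrightarrow> linear (act \<G> T)"
    and act_space: "T \<in> hom \<G> A B \<Longrightarrow> act \<G> T ` space \<G> A \<subseteq> space \<G> B"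
    and act_ident: "\<omega> \<in> space \<G> A \<Longrightarrow> act \<G> (ident \<G> A) \<omega> = \<omega>"
    and act_seq:
      "\<lbrakk>S \<in> hom \<G> B C; T \<in> hom \<G> A B; \<omega> \<in> space \<G> A\<rbrakk> \<Longrightarrow> act \<G> (S \<cdot> T) \<omega> = act \<G> S (act \<G> T \<omega>)"
    and hom_ext:
      "\<lbrakk>S \<in> hom \<G> A B; T \<in> hom \<G> A B;
        \<And>C \<omega>. \<omega> \<in> space \<G> (A \<odot> C) \<Longrightarrow> act \<G> (S \<otimes> ident \<G> C) \<omega> = act \<G> (T \<otimes> ident \<G> C) \<omega>\<rbrakk> \<Longrightarrow> S = T"
    and states_transformations:
      "bij_betw (\<lambda>T. act \<G> T \<one>) (hom \<G> \<I> A) (states \<G> A)"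
    and all_maps:
      "\<lbrakk>\<And>C. linear (F C);
        \<And>C. F C ` space \<G> (A \<odot> C) \<subseteq> space \<G> (B \<odot> C);
        \<And>C. F C ` states \<G> (A \<odot> C) \<subseteq> states \<G> (B \<odot> C);
        \<And>C D S \<omega>. \<lbrakk>S \<in> hom \<G> C D; \<omega> \<in> space \<G> (A \<odot> C)\<rbrakk> \<Longrightarrow>
           F D (act \<G> (ident \<G> A \<otimes> S) \<omega>) = act \<G> (ident \<G> B \<otimes> S) (F C \<omega>)\<rbrakk> \<Longrightarrow>
       \<exists>T\<in>hom \<G> A B. \<forall>C. \<forall>\<omega>\<in>space \<G> (A \<odot> C). act \<G> (T \<otimes> ident \<G> C) \<omega> = F C \<omega>"
    and discard_hom: "discard \<G> A \<in> hom \<G> A \<I>"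
    and discard_nstates: "\<omega> \<in> \<Omega> A \<Longrightarrow> act \<G> (discard \<G> A) \<omega> = \<one>"
    and fiducial:
      "\<exists>M :: (nat set \<times> (nat \<Rightarrow> 't)) set.
         (\<forall>(X, e)\<in>M. measurement \<G> A X e) \<and>
         (\<forall>\<omega>\<in>states \<G> A. \<forall>\<omega>'\<in>states \<G> A.
            (\<forall>(X, e)\<in>M. \<forall>x\<in>X. act \<G> (e x) \<omega> = act \<G> (e x) \<omega>') \<longrightarrow> \<omega> = \<omega>')"
    and no_signalling:
      "\<lbrakk>measurement \<G> A (X :: nat set) e; \<omega> \<in> \<Omega> (A \<odot> B)\<rbrakk> \<Longrightarrow>
         (\<Sum>x\<in>X. act \<G> (e x \<otimes> ident \<G> B) \<omega>) \<in> \<Omega> B"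
      "\<lbrakk>measurement \<G> A (X :: nat set) e; measurement \<G> A (Y :: nat set) f; \<omega> \<in> \<Omega> (A \<odot> B)\<rbrakk> \<Longrightarrow>
         (\<Sum>x\<in>X. act \<G> (e x \<otimes> ident \<G> B) \<omega>) = (\<Sum>y\<in>Y. act \<G> (f y \<otimes> ident \<G> B) \<omega>)"

lemma (in gpt) state_tensor:
  assumes "S \<in> hom \<G> \<I> A" "T \<in> hom \<G> \<I> B"
  shows "act \<G> (S \<otimes> T) \<one> \<in> states \<G> (A \<odot> B)"
  using par_hom[OF assms] bij_betwE[OF states_transformations] by auto

definition scalar :: "('s, 't, 'v :: real_vector) gpt \<Rightarrow> 't \<Rightarrow> real" where
  "scalar \<G> t = (THE r. act \<G> t (one \<G>) = r *\<^sub>R one \<G>)"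


section \<open>Circuits\<close>

text \<open>A list \<open>es\<close> of distinct wires stands for the composite of the systems \<open>sys e\<close>, in the order
  of the list. \<open>rearrange fs es\<close> is the permutation morphism from the composite of \<open>es\<close> to that
  of its reordering \<open>fs\<close>, built from swaps of neighbouring wires.\<close>

definition composite :: "('s, 't, 'v) gpt \<Rightarrow> ('e \<Rightarrow> 's) \<Rightarrow> 'e list \<Rightarrow> 's" where
  "composite \<G> sys es = foldr (\<lambda>e. compose \<G> (sys e)) es (triv \<G>)"

primrec to_front :: "('s, 't, 'v) gpt \<Rightarrow> ('e \<Rightarrow> 's) \<Rightarrow> 'e \<Rightarrow> 'e list \<Rightarrow> 't" where
  "to_front \<G> sys e [] = ident \<G> (triv \<G>)"
| "to_front \<G> sys e (a # es) =
     (if a = e then ident \<G> (composite \<G> sys (a # es))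
      else seq \<G> (par \<G> (swap \<G> (sys a) (sys e)) (ident \<G> (composite \<G> sys (remove1 e es))))
                 (par \<G> (ident \<G> (sys a)) (to_front \<G> sys e es)))"

primrec rearrange :: "('s, 't, 'v) gpt \<Rightarrow> ('e \<Rightarrow> 's) \<Rightarrow> 'e list \<Rightarrow> 'e list \<Rightarrow> 't" where
  "rearrange \<G> sys [] es = ident \<G> (triv \<G>)"
| "rearrange \<G> sys (f # fs) es =
     seq \<G> (par \<G> (ident \<G> (sys f)) (rearrange \<G> sys fs (remove1 f es))) (to_front \<G> sys f es)"

text \<open>The wires are the edges leaving latent vertices: an edge leaving an observed vertex carries
  the trivial system, which is a strict unit of composition. A topological enumeration \<open>vs\<close> of the
  vertices fixes the order of the systems in the input and output of each test.\<close>

definition topological_order :: "('n, 'a) causal_dag \<Rightarrow> 'n list \<Rightarrow> bool" where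
  "topological_order G vs \<longleftrightarrow>
     distinct vs \<and> set vs = obs G \<union> lat G \<and> sorted_wrt (\<lambda>u v. (v, u) \<notin> edges G) vs"

definition in_wires :: "('n, 'a) causal_dag \<Rightarrow> 'n list \<Rightarrow> 'n \<Rightarrow> ('n \<times> 'n) list" where
  "in_wires G vs v = [(u, v). u \<leftarrow> vs, u \<in> lat G \<and> (u, v) \<in> edges G]"

definition out_wires :: "('n, 'a) causal_dag \<Rightarrow> 'n list \<Rightarrow> 'n \<Rightarrow> ('n \<times> 'n) list" where
  "out_wires G vs v = [(v, y). y \<leftarrow> vs, v \<in> lat G \<and> (v, y) \<in> edges G]"

text \<open>The outcome set of \<open>v\<close>; \<open>None\<close> is the trivial outcome of latent vertices.\<close>

definition outcomes :: "('n, 'a) causal_dag \<Rightarrow> 'n \<Rightarrow> 'a option set" where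
  "outcomes G v = (if v \<in> obs G then Some ` alph G v else {None})"

definition outcome :: "('n, 'a) causal_dag \<Rightarrow> ('n \<Rightarrow> 'a) \<Rightarrow> 'n \<Rightarrow> 'a option" where
  "outcome G x v = (if v \<in> obs G then Some (x v) else None)"

definition vertex_transformation ::
  "('n, 'a) causal_dag \<Rightarrow> ('n \<Rightarrow> ('n \<Rightarrow> 'a) \<Rightarrow> 'a option \<Rightarrow> 't) \<Rightarrow> ('n \<Rightarrow> 'a) \<Rightarrow> 'n \<Rightarrow> 't" where
  "vertex_transformation G T x v = T v (restrict x (parents G v \<inter> obs G)) (outcome G x v)"

text \<open>The state of the evaluation is the list of currently open wires and a transformation from
  the trivial system to their composite.\<close>

definition circuit_step ::
  "('s, 't, 'v) gpt \<Rightarrow> ('n, 'a) causal_dag \<Rightarrow> 'n list \<Rightarrow> ('n \<times> 'n \<Rightarrow> 's) \<Rightarrow> ('n \<Rightarrow> 't) \<Rightarrow>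
   ('n \<times> 'n) list \<times> 't \<Rightarrow> 'n \<Rightarrow> ('n \<times> 'n) list \<times> 't" where
  "circuit_step \<G> G vs sys \<tau> = (\<lambda>(es, t) v.
     let rest = filter (\<lambda>e. e \<notin> set (in_wires G vs v)) es in
       (out_wires G vs v @ rest,
        seq \<G> (par \<G> (\<tau> v) (ident \<G> (composite \<G> sys rest)))
              (seq \<G> (rearrange \<G> sys (in_wires G vs v @ rest) es) t)))"

definition circuit ::
  "('s, 't, 'v) gpt \<Rightarrow> ('n, 'a) causal_dag \<Rightarrow> 'n list \<Rightarrow> ('n \<times> 'n \<Rightarrow> 's) \<Rightarrow> ('n \<Rightarrow> 't) \<Rightarrow> 't" where
  "circuit \<G> G vs sys \<tau> =
     snd (foldl (circuit_step \<G> G vs sys \<tau>) ([], ident \<G> (triv \<G>)) vs)"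

definition gpt_distributions ::
  "('s, 't, 'v :: real_vector) gpt \<Rightarrow> ('n, 'a) causal_dag \<Rightarrow> (('n \<Rightarrow> 'a) \<Rightarrow> real) set" where
  "gpt_distributions \<G> G =
     {p. \<exists>vs sys T.
        topological_order G vs \<and>
        (\<forall>v\<in>obs G \<union> lat G. \<forall>y\<in>configs G (parents G v \<inter> obs G).
           test \<G> (composite \<G> sys (in_wires G vs v)) (composite \<G> sys (out_wires G vs v))
             (outcomes G v) (T v y)) \<and>
        p = (\<lambda>x\<in>configs G (obs G). scalar \<G> (circuit \<G> G vs sys (vertex_transformation G T x)))}"

text \<open>The union over all GPTs whose systems, transformations and ambient vector space live in the
  types \<open>'s\<close>, \<open>'t\<close>, \<open>'v\<close>. These types are arbitrary, so a theorem that is polymorphic in them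
  covers all GPTs.\<close>

definition GPT ::
  "('s \<times> 't \<times> 'v :: real_vector) itself \<Rightarrow> ('n, 'a) causal_dag \<Rightarrow> (('n \<Rightarrow> 'a) \<Rightarrow> real) set" where
  "GPT _ G = (\<Union>\<G> \<in> {\<G> :: ('s, 't, 'v) gpt. gpt \<G>}. gpt_distributions \<G> G)"

end

theory Submission
  imports Defs
begin

text \<open>After vertex splitting, every observed vertex is a source or a sink, so conditioning on
  \<open>C\<close> only fixes classical inputs and outcomes of the circuit. Given a \<open>d\<close>-separation of \<open>A\<close> and
  \<open>B\<close> by \<open>C\<close>, the vertices that are not ancestors of \<open>A \<union> B \<union> C\<close> are summed out one by one, each
  test followed by discarding its output being the same as discarding its input. In the remaining
  graph, cut at the sources in \<open>C\<close>, the set \<open>A\<close> is not connected to \<open>B\<close>. The circuit is therefore a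
  tensor product of two scalars, one of which does not involve \<open>X\<^sub>B\<close> and the other not \<open>X\<^sub>A\<close>, and
  this factorization is conditional independence.\<close>


section \<open>Coherence of rearrangements\<close>

text \<open>The obstacle is the order of the wires. A circuit is evaluated along one list
  \<open>vs\<close> with an ordered list of open wires; dropping a vertex, or separating two groups
  of vertices, changes that order at every later stage. All comparisons are therefore made up to
  permutation morphisms, which requires coherence for the concrete morphisms
  \<open>rearrange\<close>. A partial circuit gets a number by discarding every wire left open, one
  by one: this effect is compatible with permutations and tensor products as an equation of
  morphisms, whereas the normalization of a test is only given through the action on vectors of its
  own input system. To remove a vertex, the rest of the circuit is therefore moved past it and
  turned into an effect on the bypassing wires. The graph-theoretic half never sees a circuit; it
  works with weights \<open>w M\<close> attached to vertex sets, subject to summation, locality and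
  product laws. Each cut classical wire contributes the inverse of its alphabet size to the weight,
  which makes its free end an independent uniform source.\<close>

lemma mset_remove1_head:
  assumes "mset (f # fs) = mset es"
  shows "f \<in> set es" "mset fs = mset (remove1 f es)"
proof -
  show "f \<in> set es" using assms by (metis list.set_intros(1) mset_eq_setD)
  show "mset fs = mset (remove1 f es)"
    using assms by (metis add_mset_remove_trivial mset.simps(2) mset_remove1)
qed

context symmetric_monoidal
begin

section \<open>Interchange laws and the symmetry\<close>

lemma par_seq_ident_left:
  assumes "S \<in> hom \<G> B C" "T \<in> hom \<G> A B"
  shows "ident \<G> D \<otimes> (S \<cdot> T) = (ident \<G> D \<otimes> S) \<cdot> (ident \<G> D \<otimes> T)"
  using interchange[OF ident_hom ident_hom assms, of D] seq_ident[OF ident_hom] by simp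

lemma par_seq_ident_right:
  assumes "S \<in> hom \<G> B C" "T \<in> hom \<G> A B"
  shows "(S \<cdot> T) \<otimes> ident \<G> D = (S \<otimes> ident \<G> D) \<cdot> (T \<otimes> ident \<G> D)"
  using interchange[OF assms ident_hom ident_hom, of D] seq_ident[OF ident_hom] by simp

lemma par_slide:
  assumes "S \<in> hom \<G> A B" "T \<in> hom \<G> C D"
  shows "(S \<otimes> ident \<G> D) \<cdot> (ident \<G> A \<otimes> T) = S \<otimes> T"
    and "(ident \<G> B \<otimes> T) \<cdot> (S \<otimes> ident \<G> C) = S \<otimes> T"
  using interchange[OF assms(1) ident_hom ident_hom assms(2)]
    interchange[OF ident_hom assms(1) assms(2) ident_hom]
  by (simp_all add: seq_ident[OF assms(1)] seq_ident[OF assms(2)])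

lemma par_ident_ident:
  assumes "T \<in> hom \<G> A B"
  shows "ident \<G> C \<otimes> (ident \<G> D \<otimes> T) = ident \<G> (C \<odot> D) \<otimes> T"
    and "(T \<otimes> ident \<G> C) \<otimes> ident \<G> D = T \<otimes> ident \<G> (C \<odot> D)"
  using par_assoc[OF ident_hom ident_hom assms, of C D] par_assoc[OF assms ident_hom ident_hom, of
      C D]
  by (simp_all add: par_ident)

text \<open>The hexagon with two trivial systems makes this swap idempotent, and an invertible
  idempotent is the identity.\<close>

lemma swap_triv: "swap \<G> A \<I> = ident \<G> A" "swap \<G> \<I> A = ident \<G> A"
proof -
  have h: "swap \<G> A \<I> \<in> hom \<G> A A" "swap \<G> \<I> A \<in> hom \<G> A A"
    using swap_hom[of A \<I>] swap_hom[of \<I> A] by simp_all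
  have "swap \<G> A \<I> = swap \<G> A \<I> \<cdot> swap \<G> A \<I>"
    using hexagon[of A \<I> \<I>] par_unit[OF h(1)] by simp
  then have "swap \<G> \<I> A \<cdot> swap \<G> A \<I> = (swap \<G> \<I> A \<cdot> swap \<G> A \<I>) \<cdot> swap \<G> A \<I>"
    using seq_assoc[OF h(2,1,1)] by simp
  then show 1: "swap \<G> A \<I> = ident \<G> A"
    using swap_swap[of \<I> A] seq_ident[OF h(1)] by simp
  show "swap \<G> \<I> A = ident \<G> A"
    using swap_swap[of A \<I>] seq_ident[OF h(2)] 1 by simp
qed

lemma inverse_unique:
  assumes "S \<in> hom \<G> A B" "T \<in> hom \<G> B A" "T' \<in> hom \<G> B A"
    and "S \<cdot> T = ident \<G> B" "T' \<cdot> S = ident \<G> A"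
  shows "T = T'"
  using seq_assoc[OF assms(3,1,2)] assms(4,5) seq_ident[OF assms(2)] seq_ident[OF assms(3)] by simp

text \<open>Both sides are inverse to \<open>swap \<G> C (A \<odot> B)\<close>: the left one by the
  symmetry law, the right one because the hexagon axiom writes that swap as the product of the
  inverses of the two factors.\<close>

lemma hexagon':
  "swap \<G> (A \<odot> B) C = (swap \<G> A C \<otimes> ident \<G> B) \<cdot> (ident \<G> A \<otimes> swap \<G> B C)"
proof (rule inverse_unique)
  show "swap \<G> C (A \<odot> B) \<in> hom \<G> (C \<odot> A \<odot> B) ((A \<odot> B) \<odot> C)" by (rule swap_hom)
  show "swap \<G> (A \<odot> B) C \<in> hom \<G> ((A \<odot> B) \<odot> C) (C \<odot> A \<odot> B)" by (rule swap_hom)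
  have 1: "swap \<G> A C \<otimes> ident \<G> B \<in> hom \<G> (A \<odot> C \<odot> B) (C \<odot> A \<odot> B)"
    using par_hom[OF swap_hom ident_hom, of A C B] by (simp add: compose_assoc)
  have 2: "ident \<G> A \<otimes> swap \<G> B C \<in> hom \<G> ((A \<odot> B) \<odot> C) (A \<odot> C \<odot> B)"
    using par_hom[OF ident_hom swap_hom, of A B C] by (simp add: compose_assoc)
  have 3: "swap \<G> C A \<otimes> ident \<G> B \<in> hom \<G> (C \<odot> A \<odot> B) (A \<odot> C \<odot> B)"
    using par_hom[OF swap_hom ident_hom, of C A B] by (simp add: compose_assoc)
  have 4: "ident \<G> A \<otimes> swap \<G> C B \<in> hom \<G> (A \<odot> C \<odot> B) ((A \<odot> B) \<odot> C)"
    using par_hom[OF ident_hom swap_hom, of A C B] by (simp add: compose_assoc)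
  show "(swap \<G> A C \<otimes> ident \<G> B) \<cdot> (ident \<G> A \<otimes> swap \<G> B C) \<in> hom \<G> ((A \<odot> B) \<odot> C) (C \<odot> A \<odot> B)"
    by (rule seq_hom[OF 1 2])
  show "swap \<G> C (A \<odot> B) \<cdot> swap \<G> (A \<odot> B) C = ident \<G> ((A \<odot> B) \<odot> C)" by (rule swap_swap)
  have "(ident \<G> A \<otimes> swap \<G> B C) \<cdot> (ident \<G> A \<otimes> swap \<G> C B) = ident \<G> (A \<odot> C \<odot> B)"
    using par_seq_ident_left[OF swap_hom swap_hom, of A B C] by (simp add: swap_swap par_ident)
  moreover have "(swap \<G> A C \<otimes> ident \<G> B) \<cdot> (swap \<G> C A \<otimes> ident \<G> B) = ident \<G> (C \<odot> A \<odot> B)"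
    using par_seq_ident_right[OF swap_hom swap_hom, of A C B] by (simp add: swap_swap par_ident
        compose_assoc)
  ultimately show "((swap \<G> A C \<otimes> ident \<G> B) \<cdot> (ident \<G> A \<otimes> swap \<G> B C)) \<cdot> swap \<G> C (A \<odot> B) =
      ident \<G> (C \<odot> A \<odot> B)"
    unfolding hexagon
    by (simp add: seq_assoc[OF 1 2 seq_hom[OF 4 3]] seq_assoc[OF 2 4 3, symmetric] seq_ident[OF 3])
qed

text \<open>This is naturality of the swap of \<open>A\<close> with a composite, applied to
  \<open>swap \<G> B C\<close>, with both long swaps expanded by the hexagon.\<close>

lemma yang_baxter:
  "(swap \<G> B C \<otimes> ident \<G> A) \<cdot> (ident \<G> B \<otimes> swap \<G> A C) \<cdot> (swap \<G> A B \<otimes> ident \<G> C) =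
   (ident \<G> C \<otimes> swap \<G> A B) \<cdot> (swap \<G> A C \<otimes> ident \<G> B) \<cdot> (ident \<G> A \<otimes> swap \<G> B C)"
proof -
  have 1: "ident \<G> C \<otimes> swap \<G> A B \<in> hom \<G> (C \<odot> A \<odot> B) (C \<odot> B \<odot> A)"
    by (rule par_hom[OF ident_hom swap_hom])
  have 2: "swap \<G> A C \<otimes> ident \<G> B \<in> hom \<G> (A \<odot> C \<odot> B) (C \<odot> A \<odot> B)"
    using par_hom[OF swap_hom ident_hom, of A C B] by (simp add: compose_assoc)
  have 3: "ident \<G> A \<otimes> swap \<G> B C \<in> hom \<G> (A \<odot> B \<odot> C) (A \<odot> C \<odot> B)"
    by (rule par_hom[OF ident_hom swap_hom])
  have "(swap \<G> B C \<otimes> ident \<G> A) \<cdot> swap \<G> A (B \<odot> C) = swap \<G> A (C \<odot> B) \<cdot> (ident \<G> A \<otimes> swap \<G> B C)"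
    using swap_natural[OF ident_hom swap_hom, of A C B] by simp
  then show ?thesis
    unfolding hexagon by (simp add: seq_assoc[OF 1 2 3])
qed

section \<open>Permutation morphisms on lists of wires\<close>

lemma composite_Nil [simp]: "composite \<G> sys [] = \<I>"
  and composite_Cons [simp]: "composite \<G> sys (e # es) = sys e \<odot> composite \<G> sys es"
  by (simp_all add: composite_def)

lemma composite_append [simp]:
  "composite \<G> sys (es @ fs) = composite \<G> sys es \<odot> composite \<G> sys fs"
  by (induction es) (simp_all add: compose_assoc)

lemma to_front_hom:
  "f \<in> set es \<Longrightarrow>
   to_front \<G> sys f es \<in> hom \<G> (composite \<G> sys es) (sys f \<odot> composite \<G> sys (remove1 f es))"
proof (induction es)
  case (Cons e es)
  show ?case
  proof (cases "e = f")
    case True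
    then show ?thesis using ident_hom by simp
  next
    case False
    have 1: "ident \<G> (sys e) \<otimes> to_front \<G> sys f es
        \<in> hom \<G> (sys e \<odot> composite \<G> sys es) (sys e \<odot> sys f \<odot> composite \<G> sys (remove1 f es))"
      using Cons False by (intro par_hom ident_hom) auto
    have 2: "swap \<G> (sys e) (sys f) \<otimes> ident \<G> (composite \<G> sys (remove1 f es))
        \<in> hom \<G> (sys e \<odot> sys f \<odot> composite \<G> sys (remove1 f es))
               (sys f \<odot> sys e \<odot> composite \<G> sys (remove1 f es))"
      using par_hom[OF swap_hom ident_hom] by (simp add: compose_assoc)
    show ?thesis using seq_hom[OF 2 1] False by simp
  qed
qed simp

lemma rearrange_hom:
  "mset fs = mset es \<Longrightarrow>
   rearrange \<G> sys fs es \<in> hom \<G> (composite \<G> sys es) (composite \<G> sys fs)"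
proof (induction fs arbitrary: es)
  case Nil
  then show ?case using ident_hom by simp
next
  case (Cons f fs)
  note f = mset_remove1_head[OF Cons.prems]
  show ?case
    using seq_hom[OF par_hom[OF ident_hom Cons.IH[OF f(2)]] to_front_hom[OF f(1)]] by simp
qed

text \<open>Both sides bring \<open>g\<close> and \<open>f\<close> to the front in this order, so
  this is the first genuine case of coherence; \<open>to_front_rearrange\<close> rests on it. If the
  head of the list is \<open>f\<close> or \<open>g\<close>, unit laws or the symmetry of the swap
  suffice. A third wire at the head has to be crossed by both, which costs Yang-Baxter.\<close>

lemma to_front_to_front:
  assumes "f \<in> set es" "g \<in> set es" "f \<noteq> g"
  shows "(swap \<G> (sys f) (sys g) \<otimes> ident \<G> (composite \<G> sys (remove1 g (remove1 f es)))) \<cdot>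
           (ident \<G> (sys f) \<otimes> to_front \<G> sys g (remove1 f es)) \<cdot> to_front \<G> sys f es =
         (ident \<G> (sys g) \<otimes> to_front \<G> sys f (remove1 g es)) \<cdot> to_front \<G> sys g es"
  using assms
proof (induction es)
  case (Cons e es)
  let ?c = "composite \<G> sys" and ?i = "ident \<G>" and ?s = "swap \<G>"
  consider "e = f" | "e = g" | "e \<noteq> f" "e \<noteq> g" by blast
  then show ?case
  proof cases
    case 1
    then have g: "g \<in> set es" using Cons.prems by auto
    have 2: "?i (sys f) \<otimes> to_front \<G> sys g es \<in> hom \<G> (sys f \<odot> ?c es) (sys f \<odot> sys g \<odot> ?c (remove1
        g es))"
      by (intro par_hom ident_hom to_front_hom g)
    have 3: "?s (sys f) (sys g) \<otimes> ?i (?c (remove1 g es))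
        \<in> hom \<G> (sys f \<odot> sys g \<odot> ?c (remove1 g es)) (sys g \<odot> sys f \<odot> ?c (remove1 g es))"
      using par_hom[OF swap_hom ident_hom] by (simp add: compose_assoc)
    show ?thesis
      using 1 Cons.prems seq_ident[OF 2] seq_ident[OF seq_hom[OF 3 2]] by (simp add: par_ident)
  next
    case 2
    then have f: "f \<in> set es" using Cons.prems by auto
    have 1: "?i (sys g) \<otimes> to_front \<G> sys f es \<in> hom \<G> (sys g \<odot> ?c es) (sys g \<odot> sys f \<odot> ?c (remove1
        f es))"
      by (intro par_hom ident_hom to_front_hom f)
    have 3: "?s (sys f) (sys g) \<otimes> ?i (?c (remove1 f es))
        \<in> hom \<G> (sys f \<odot> sys g \<odot> ?c (remove1 f es)) (sys g \<odot> sys f \<odot> ?c (remove1 f es))"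
      using par_hom[OF swap_hom ident_hom] by (simp add: compose_assoc)
    have 4: "?s (sys g) (sys f) \<otimes> ?i (?c (remove1 f es))
        \<in> hom \<G> (sys g \<odot> sys f \<odot> ?c (remove1 f es)) (sys f \<odot> sys g \<odot> ?c (remove1 f es))"
      using par_hom[OF swap_hom ident_hom] by (simp add: compose_assoc)
    have 5: "(?s (sys f) (sys g) \<otimes> ?i (?c (remove1 f es))) \<cdot> (?s (sys g) (sys f) \<otimes> ?i (?c (remove1
        f es)))
       = ?i (sys g \<odot> sys f \<odot> ?c (remove1 f es))"
      using par_seq_ident_right[OF swap_hom swap_hom, of "sys f" "sys g"]
      by (simp add: swap_swap par_ident compose_assoc)
    show ?thesis
      using 2 Cons.prems seq_assoc[OF 3 4 1] seq_ident[OF 1] seq_ident[OF seq_hom[OF 4 1]] 5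
      by (simp add: par_ident)
  next
    case 3
    then have fg: "f \<in> set es" "g \<in> set es" "f \<noteq> g" using Cons.prems by auto
    have g': "g \<in> set (remove1 f es)" and f': "f \<in> set (remove1 g es)" using fg by auto
    define r where "r = remove1 g (remove1 f es)"
    have r': "remove1 f (remove1 g es) = r" by (simp add: r_def remove1_commute)
    define F where "F = sys f"
    define G where "G = sys g"
    define A where "A = sys e"
    define X where "X = ?c r"
    define t1 where "t1 = to_front \<G> sys f es"
    define t2 where "t2 = to_front \<G> sys g (remove1 f es)"
    define t3 where "t3 = to_front \<G> sys g es"
    define t4 where "t4 = to_front \<G> sys f (remove1 g es)"
    have t1: "t1 \<in> hom \<G> (?c es) (F \<odot> ?c (remove1 f es))"
      unfolding t1_def F_def by (rule to_front_hom[OF fg(1)])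
    have t3: "t3 \<in> hom \<G> (?c es) (G \<odot> ?c (remove1 g es))"
      unfolding t3_def G_def by (rule to_front_hom[OF fg(2)])
    have t2: "t2 \<in> hom \<G> (?c (remove1 f es)) (G \<odot> X)"
      using to_front_hom[OF g', of sys] unfolding t2_def G_def X_def r_def .
    have t4: "t4 \<in> hom \<G> (?c (remove1 g es)) (F \<odot> X)"
      using to_front_hom[OF f', of sys] unfolding t4_def F_def X_def r' .
    have IH: "(?s F G \<otimes> ?i X) \<cdot> (?i F \<otimes> t2) \<cdot> t1 = (?i G \<otimes> t4) \<cdot> t3"
      using Cons.IH[OF fg] unfolding F_def G_def X_def t1_def t2_def t3_def t4_def r_def .
    have sX: "?s P Q \<otimes> ?i X \<in> hom \<G> (P \<odot> Q \<odot> X) (Q \<odot> P \<odot> X)" for P Q X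
      using par_hom[OF swap_hom ident_hom, of P Q X] by (simp add: compose_assoc)
    have isX: "?i Y \<otimes> ?s P Q \<otimes> ?i X \<in> hom \<G> (Y \<odot> P \<odot> Q \<odot> X) (Y \<odot> Q \<odot> P \<odot> X)" for Y P Q X
      by (intro par_hom[OF ident_hom] sX)
    have At1: "?i A \<otimes> t1 \<in> hom \<G> (A \<odot> ?c es) (A \<odot> F \<odot> ?c (remove1 f es))"
      and At3: "?i A \<otimes> t3 \<in> hom \<G> (A \<odot> ?c es) (A \<odot> G \<odot> ?c (remove1 g es))"
      and At2: "?i A \<otimes> t2 \<in> hom \<G> (A \<odot> ?c (remove1 f es)) (A \<odot> G \<odot> X)"
      and At4: "?i A \<otimes> t4 \<in> hom \<G> (A \<odot> ?c (remove1 g es)) (A \<odot> F \<odot> X)"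
      by (intro par_hom ident_hom t1 t2 t3 t4)+
    have FAt2: "?i F \<otimes> ?i A \<otimes> t2 \<in> hom \<G> (F \<odot> A \<odot> ?c (remove1 f es)) (F \<odot> A \<odot> G \<odot> X)"
      and AFt2: "?i A \<otimes> ?i F \<otimes> t2 \<in> hom \<G> (A \<odot> F \<odot> ?c (remove1 f es)) (A \<odot> F \<odot> G \<odot> X)"
      and GAt4: "?i G \<otimes> ?i A \<otimes> t4 \<in> hom \<G> (G \<odot> A \<odot> ?c (remove1 g es)) (G \<odot> A \<odot> F \<odot> X)"
      and AGt4: "?i A \<otimes> ?i G \<otimes> t4 \<in> hom \<G> (A \<odot> G \<odot> ?c (remove1 g es)) (A \<odot> G \<odot> F \<odot> X)"
      by (intro par_hom ident_hom t1 t2 t3 t4)+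
    \<comment> \<open>The later extraction acts behind the two swapped systems, hence slides past
      their swap.\<close>
    have nat: "(?i F \<otimes> ?i A \<otimes> t2) \<cdot> (?s A F \<otimes> ?i (?c (remove1 f es))) =
        (?s A F \<otimes> ?i (G \<odot> X)) \<cdot> (?i A \<otimes> ?i F \<otimes> t2)"
      using par_slide[OF swap_hom[of A F] t2] by (simp add: par_ident_ident[OF t2])
    have nat': "(?i G \<otimes> ?i A \<otimes> t4) \<cdot> (?s A G \<otimes> ?i (?c (remove1 g es))) =
        (?s A G \<otimes> ?i (F \<odot> X)) \<cdot> (?i A \<otimes> ?i G \<otimes> t4)"
      using par_slide[OF swap_hom[of A G] t4] by (simp add: par_ident_ident[OF t4])
    have sXX: "?s P Q \<otimes> ?i (Y \<odot> X) = (?s P Q \<otimes> ?i Y) \<otimes> ?i X" for P Q Y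
      by (simp add: par_ident_ident(2)[OF swap_hom])
    have sXX': "(?i Y \<otimes> ?s P Q) \<otimes> ?i X = ?i Y \<otimes> ?s P Q \<otimes> ?i X" for P Q Y
      by (rule par_assoc[OF ident_hom swap_hom ident_hom])
    have hi: "?i Y \<otimes> ?s P Q \<in> hom \<G> (Y \<odot> P \<odot> Q) (Y \<odot> Q \<odot> P)" for P Q Y
      by (intro par_hom ident_hom swap_hom)
    \<comment> \<open>Yang-Baxter for the three leading systems, tensored with the identity of all
      remaining wires.\<close>
    have yb: "(?s F G \<otimes> ?i (A \<odot> X)) \<cdot> (?i F \<otimes> ?s A G \<otimes> ?i X) \<cdot> (?s A F \<otimes> ?i (G \<odot> X)) =
        (?i G \<otimes> ?s A F \<otimes> ?i X) \<cdot> (?s A G \<otimes> ?i (F \<odot> X)) \<cdot> (?i A \<otimes> ?s F G \<otimes> ?i X)"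
      using arg_cong[OF yang_baxter[of F G A], of "\<lambda>m. m \<otimes> ?i X"]
      unfolding par_seq_ident_right[OF sX seq_hom[OF hi sX]] par_seq_ident_right[OF hi sX]
        par_seq_ident_right[OF hi seq_hom[OF sX hi]] par_seq_ident_right[OF sX hi]
      by (simp only: sXX sXX')
    have "(?s F G \<otimes> ?i (A \<odot> X)) \<cdot> (?i F \<otimes> ((?s A G \<otimes> ?i X) \<cdot> (?i A \<otimes> t2))) \<cdot>
          (?s A F \<otimes> ?i (?c (remove1 f es))) \<cdot> (?i A \<otimes> t1)
        = (?s F G \<otimes> ?i (A \<odot> X)) \<cdot> (?i F \<otimes> ?s A G \<otimes> ?i X) \<cdot> (?i F \<otimes> ?i A \<otimes> t2) \<cdot>
          (?s A F \<otimes> ?i (?c (remove1 f es))) \<cdot> (?i A \<otimes> t1)"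
      by (simp add: par_seq_ident_left[OF sX At2] seq_assoc[OF isX FAt2 seq_hom[OF sX At1]])
    also have "\<dots> = (?s F G \<otimes> ?i (A \<odot> X)) \<cdot> (?i F \<otimes> ?s A G \<otimes> ?i X) \<cdot>
          (?s A F \<otimes> ?i (G \<odot> X)) \<cdot> (?i A \<otimes> ?i F \<otimes> t2) \<cdot> (?i A \<otimes> t1)"
      using seq_assoc[OF FAt2 sX At1] seq_assoc[OF sX AFt2 At1] nat by simp
    also have "\<dots> = ((?s F G \<otimes> ?i (A \<odot> X)) \<cdot> (?i F \<otimes> ?s A G \<otimes> ?i X) \<cdot>
          (?s A F \<otimes> ?i (G \<odot> X))) \<cdot> (?i A \<otimes> ?i F \<otimes> t2) \<cdot> (?i A \<otimes> t1)"
      using seq_assoc[OF sX seq_hom[OF isX sX] seq_hom[OF AFt2 At1]] 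
        seq_assoc[OF isX sX seq_hom[OF AFt2 At1]] by simp
    also have "\<dots> = ((?i G \<otimes> ?s A F \<otimes> ?i X) \<cdot> (?s A G \<otimes> ?i (F \<odot> X)) \<cdot> (?i A \<otimes> ?s F G \<otimes> ?i X)) \<cdot>
          (?i A \<otimes> ?i F \<otimes> t2) \<cdot> (?i A \<otimes> t1)"
      by (simp only: yb)
    also have "\<dots> = (?i G \<otimes> ?s A F \<otimes> ?i X) \<cdot> (?s A G \<otimes> ?i (F \<odot> X)) \<cdot> (?i A \<otimes> ?s F G \<otimes> ?i X) \<cdot>
          (?i A \<otimes> ?i F \<otimes> t2) \<cdot> (?i A \<otimes> t1)"
      using seq_assoc[OF isX seq_hom[OF sX isX] seq_hom[OF AFt2 At1]]
        seq_assoc[OF sX isX seq_hom[OF AFt2 At1]] by simp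
    \<comment> \<open>With \<open>A\<close> crossed, the last three factors are the left side of the
      induction hypothesis behind an idle \<open>A\<close>.\<close>
    also have "(?i A \<otimes> ?s F G \<otimes> ?i X) \<cdot> (?i A \<otimes> ?i F \<otimes> t2) \<cdot> (?i A \<otimes> t1) = 
          (?i A \<otimes> ((?i G \<otimes> t4) \<cdot> t3))"
      unfolding IH[symmetric]
      by (simp add: par_seq_ident_left[OF sX seq_hom[OF par_hom[OF ident_hom t2] t1]]
          par_seq_ident_left[OF par_hom[OF ident_hom t2] t1])
    also have "\<dots> = (?i A \<otimes> ?i G \<otimes> t4) \<cdot> (?i A \<otimes> t3)"
      by (simp add: par_seq_ident_left[OF par_hom[OF ident_hom t4] t3])
    also have "(?s A G \<otimes> ?i (F \<odot> X)) \<cdot> \<dots> = (?i G \<otimes> ?i A \<otimes> t4) \<cdot> (?s A G \<otimes> ?i (?c (remove1 g es)))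
        \<cdot> (?i A \<otimes> t3)"
      using seq_assoc[OF sX AGt4 At3] seq_assoc[OF GAt4 sX At3] nat' by simp
    also have "(?i G \<otimes> ?s A F \<otimes> ?i X) \<cdot> \<dots> = (?i G \<otimes> ((?s A F \<otimes> ?i X) \<cdot> (?i A \<otimes> t4))) \<cdot> (?s A G \<otimes>
        ?i (?c (remove1 g es))) \<cdot> (?i A \<otimes> t3)"
      by (simp add: par_seq_ident_left[OF sX At4] seq_assoc[OF isX GAt4 seq_hom[OF sX At3]])
    finally show ?thesis
      using 3 fg by (simp add: r' flip: F_def G_def A_def X_def t1_def t2_def t3_def t4_def r_def)
  qed
qed simp


lemma rearrange_refl [simp]: "rearrange \<G> sys es es = ident \<G> (composite \<G> sys es)"
proof (induction es)
  case (Cons e es)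
  then show ?case using seq_ident[OF ident_hom] by (simp add: par_ident)
qed simp

text \<open>Extraction of a wire is natural with respect to permutations of the others. The head
  \<open>f\<close> of \<open>fs\<close> is itself placed by an extraction, so the induction step
  comes down to exchanging two extractions.\<close>

lemma to_front_rearrange:
  assumes "g \<in> set fs" "mset fs = mset es"
  shows "to_front \<G> sys g fs \<cdot> rearrange \<G> sys fs es =
    (ident \<G> (sys g) \<otimes> rearrange \<G> sys (remove1 g fs) (remove1 g es)) \<cdot> to_front \<G> sys g es"
  using assms
proof (induction fs arbitrary: es)
  case (Cons f fs)
  let ?c = "composite \<G> sys" and ?i = "ident \<G>" and ?s = "swap \<G>"
    and ?t = "to_front \<G> sys" and ?r = "rearrange \<G> sys"
  note f = mset_remove1_head[OF Cons.prems(2)]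
  note R = rearrange_hom[OF f(2), of sys]
  have whole: "?r (f # fs) es = (?i (sys f) \<otimes> ?r fs (remove1 f es)) \<cdot> ?t f es" by simp
  show ?case
  proof (cases "f = g")
    case True
    have "?r (f # fs) es \<in> hom \<G> (?c es) (?c (f # fs))"
      by (rule rearrange_hom[OF Cons.prems(2)])
    from seq_ident(2)[OF this] True show ?thesis by simp
  next
    case False
    then have g: "g \<in> set fs" "g \<in> set es" "g \<in> set (remove1 f es)" "f \<in> set (remove1 g es)"
      using Cons.prems f mset_eq_setD[OF Cons.prems(2)] by auto
    note com = remove1_commute[of g f es]
    define X where "X = ?c (remove1 g fs)"
    define Y where "Y = ?c (remove1 g (remove1 f es))"
    define r where "r = ?r (remove1 g fs) (remove1 g (remove1 f es))"
    have r: "r \<in> hom \<G> Y X"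
      unfolding r_def X_def Y_def by (rule rearrange_hom) (simp only: mset_remove1 f(2))
    have sX: "?s P Q \<otimes> ?i X \<in> hom \<G> (P \<odot> Q \<odot> X) (Q \<odot> P \<odot> X)" for P Q X
      using par_hom[OF swap_hom ident_hom, of P Q X] by (simp add: compose_assoc)
    have tf: "?t f es \<in> hom \<G> (?c es) (sys f \<odot> ?c (remove1 f es))" by (rule to_front_hom[OF f(1)])
    have tg: "?t g fs \<in> hom \<G> (?c fs) (sys g \<odot> X)" unfolding X_def by (rule to_front_hom[OF g(1)])
    have tg': "?t g (remove1 f es) \<in> hom \<G> (?c (remove1 f es)) (sys g \<odot> Y)"
      unfolding Y_def by (rule to_front_hom[OF g(3)])
    have tge: "?t g es \<in> hom \<G> (?c es) (sys g \<odot> ?c (remove1 g es))" by (rule to_front_hom[OF g(2)])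
    have tfe: "?t f (remove1 g es) \<in> hom \<G> (?c (remove1 g es)) (sys f \<odot> Y)"
      using to_front_hom[OF g(4), of sys] unfolding Y_def by (simp add: com)
    note p = par_hom[OF ident_hom]
    have IH: "?t g fs \<cdot> ?r fs (remove1 f es) = (?i (sys g) \<otimes> r) \<cdot> ?t g (remove1 f es)"
      unfolding r_def by (rule Cons.IH[OF g(1) f(2)])
    have nat: "(?s (sys f) (sys g) \<otimes> ?i X) \<cdot> (?i (sys f) \<otimes> ?i (sys g) \<otimes> r)
        = (?i (sys g) \<otimes> ?i (sys f) \<otimes> r) \<cdot> (?s (sys f) (sys g) \<otimes> ?i Y)"
      using par_slide[OF swap_hom[of "sys f" "sys g"] r] by (simp add: par_ident_ident[OF r])
    have "?t g (f # fs) \<cdot> ?r (f # fs) es =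
      ((?s (sys f) (sys g) \<otimes> ?i X) \<cdot> (?i (sys f) \<otimes> ?t g fs)) \<cdot>
        (?i (sys f) \<otimes> ?r fs (remove1 f es)) \<cdot> ?t f es"
      using False by (simp add: X_def)
    also have "\<dots> = (?s (sys f) (sys g) \<otimes> ?i X) \<cdot> (?i (sys f) \<otimes> (?t g fs \<cdot> ?r fs (remove1 f es))) \<cdot>
        ?t f es"
      by (simp add: seq_assoc[OF sX p[OF tg] seq_hom[OF p[OF R] tf]] seq_assoc[OF p[OF tg] p[OF R]
          tf]
          par_seq_ident_left[OF tg R])
    also have "\<dots> = ((?s (sys f) (sys g) \<otimes> ?i X) \<cdot> (?i (sys f) \<otimes> ?i (sys g) \<otimes> r)) \<cdot>
        (?i (sys f) \<otimes> ?t g (remove1 f es)) \<cdot> ?t f es"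
      unfolding IH
      by (simp add: seq_assoc[OF sX p[OF p[OF r]] seq_hom[OF p[OF tg'] tf]]
          seq_assoc[OF p[OF p[OF r]] p[OF tg'] tf] par_seq_ident_left[OF p[OF r] tg'])
    also have "\<dots> = (?i (sys g) \<otimes> ?i (sys f) \<otimes> r) \<cdot> (?s (sys f) (sys g) \<otimes> ?i Y) \<cdot>
        (?i (sys f) \<otimes> ?t g (remove1 f es)) \<cdot> ?t f es"
      unfolding nat by (rule seq_assoc[OF p[OF p[OF r]] sX seq_hom[OF p[OF tg'] tf]])
    \<comment> \<open>Here \<open>to_front_to_front\<close> exchanges the extractions of
      \<open>f\<close> and \<open>g\<close>.\<close>
    also have "\<dots> = (?i (sys g) \<otimes> ?i (sys f) \<otimes> r) \<cdot> (?i (sys g) \<otimes> ?t f (remove1 g es)) \<cdot> ?t g es"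
      using to_front_to_front[OF f(1) g(2) False, of sys] by (simp add: Y_def)
    also have "\<dots> = (?i (sys g) \<otimes> ((?i (sys f) \<otimes> r) \<cdot> ?t f (remove1 g es))) \<cdot> ?t g es"
      by (simp add: seq_assoc[OF p[OF p[OF r]] p[OF tfe] tge] par_seq_ident_left[OF p[OF r] tfe])
    finally show ?thesis
      using False by (simp add: r_def com)
  qed
qed simp

text \<open>Coherence as functoriality: intermediate orders of the wires leave no trace. The
  extraction of the leading target wire is carried back through the inner rearrangement by
  \<open>to_front_rearrange\<close>, and the induction hypothesis treats the remaining
  wires.\<close>

lemma rearrange_rearrange:
  assumes "mset gs = mset fs" "mset fs = mset es"
  shows "rearrange \<G> sys gs fs \<cdot> rearrange \<G> sys fs es = rearrange \<G> sys gs es"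
  using assms
proof (induction gs arbitrary: fs es)
  case Nil
  then show ?case using seq_ident[OF ident_hom] by simp
next
  case (Cons g gs)
  note g = mset_remove1_head[OF Cons.prems(1)]
  have ge: "g \<in> set es" and m: "mset (remove1 g fs) = mset (remove1 g es)"
    using g(1) mset_eq_setD[OF Cons.prems(2)] Cons.prems(2) by simp_all
  note p = par_hom[OF ident_hom]
  note h = p[OF rearrange_hom[OF g(2), of sys]] p[OF rearrange_hom[OF m, of sys]]
    rearrange_hom[OF Cons.prems(2), of sys] to_front_hom[OF g(1), of sys] to_front_hom[OF ge, of
        sys]
  show ?case
    by (simp add: seq_assoc[OF h(1,4,3)] to_front_rearrange[OF g(1) Cons.prems(2)]
        seq_assoc[OF h(1,2,5), symmetric] Cons.IH[OF g(2) m, symmetric]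
        par_seq_ident_left[OF rearrange_hom[OF g(2)] rearrange_hom[OF m]])
qed

lemma to_front_append:
  "f \<in> set es \<Longrightarrow>
   to_front \<G> sys f (es @ hs) = to_front \<G> sys f es \<otimes> ident \<G> (composite \<G> sys hs)"
proof (induction es)
  case (Cons e es)
  let ?c = "composite \<G> sys" and ?i = "ident \<G>" and ?s = "swap \<G>"
  show ?case
  proof (cases "e = f")
    case False
    then have f: "f \<in> set es" using Cons.prems by simp
    note t = to_front_hom[OF f, of sys]
    have sX: "?s P Q \<otimes> ?i X \<in> hom \<G> (P \<odot> Q \<odot> X) (Q \<odot> P \<odot> X)" for P Q X
      using par_hom[OF swap_hom ident_hom, of P Q X] by (simp add: compose_assoc)
    show ?thesis
      using False f
      by (simp add: Cons.IH[OF f] remove1_append par_seq_ident_right[OF sX par_hom[OF ident_hom t]]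
          par_ident_ident(2)[OF swap_hom] par_assoc[OF ident_hom t ident_hom])
  qed (simp add: par_ident compose_assoc)
qed simp

lemma rearrange_append:
  "\<lbrakk>mset fs = mset es; mset gs = mset hs\<rbrakk> \<Longrightarrow>
   rearrange \<G> sys (fs @ gs) (es @ hs) = rearrange \<G> sys fs es \<otimes> rearrange \<G> sys gs hs"
proof (induction fs arbitrary: es)
  case Nil
  then show ?case using par_unit[OF rearrange_hom[OF Nil(2)]] by simp
next
  case (Cons f fs)
  note f = mset_remove1_head[OF Cons.prems(1)]
  note h = rearrange_hom[OF f(2), of sys] rearrange_hom[OF Cons.prems(2), of sys] to_front_hom[OF
      f(1), of sys]
  note p = par_hom[OF ident_hom]
  show ?case
    using f(1)
    by (simp add: remove1_append Cons.IH[OF f(2) Cons.prems(2)] to_front_append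
        interchange[OF p[OF h(1)] h(3) h(2) ident_hom, symmetric] seq_ident[OF h(2)]
        par_assoc[OF ident_hom h(1,2), symmetric])
qed

text \<open>The wire passes the block \<open>as\<close> one wire at a time; \<open>hexagon'\<close>
  merges these crossings into a single swap with the block.\<close>

lemma to_front_through:
  "f \<notin> set as \<Longrightarrow>
   to_front \<G> sys f (as @ f # bs) =
     swap \<G> (composite \<G> sys as) (sys f) \<otimes> ident \<G> (composite \<G> sys bs)"
proof (induction as)
  case (Cons a as)
  note p = par_hom[OF ident_hom swap_hom]
  have sX: "swap \<G> P Q \<otimes> ident \<G> X \<in> hom \<G> (P \<odot> Q \<odot> X) (Q \<odot> P \<odot> X)" for P Q X
    using par_hom[OF swap_hom ident_hom, of P Q X] by (simp add: compose_assoc)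
  have "a \<noteq> f" "f \<notin> set as" using Cons.prems by auto
  then show ?case
    using Cons.IH
    by (simp add: remove1_append hexagon' par_seq_ident_right[OF sX p] par_ident_ident(2)[OF
        swap_hom]
        par_assoc[OF ident_hom swap_hom ident_hom])
qed (simp add: swap_triv par_ident)

text \<open>The other hexagon assembles the crossings of the wires of \<open>bs\<close>. Identifying
  a concrete rearrangement with a symmetry morphism is what lets naturality of the swap act on
  transformations of whole blocks.\<close>

lemma rearrange_swap:
  "set as \<inter> set bs = {} \<Longrightarrow>
   rearrange \<G> sys (bs @ as) (as @ bs) = swap \<G> (composite \<G> sys as) (composite \<G> sys bs)"
proof (induction bs)
  case (Cons b bs)
  then show ?case
    by (simp add: to_front_through remove1_append hexagon)
qed (simp add: swap_triv)

end


section \<open>Circuits as morphisms\<close>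

lemma set_in_wires:
  "topological_order G vs \<Longrightarrow> edges G \<subseteq> (obs G \<union> lat G) \<times> (obs G \<union> lat G) \<Longrightarrow>
   set (in_wires G vs v) = {(u, v) | u. u \<in> lat G \<and> (u, v) \<in> edges G}"
  by (auto simp: in_wires_def topological_order_def)

lemma set_out_wires:
  "topological_order G vs \<Longrightarrow> edges G \<subseteq> (obs G \<union> lat G) \<times> (obs G \<union> lat G) \<Longrightarrow>
   set (out_wires G vs v) = {(v, y) | y. v \<in> lat G \<and> (v, y) \<in> edges G}"
  by (auto simp: out_wires_def topological_order_def)

lemma fst_out_wires: "e \<in> set (out_wires G vs v) \<Longrightarrow> fst e = v"
  by (auto simp: out_wires_def)

lemma distinct_wires:
  assumes "distinct vs"
  shows "distinct (in_wires G vs v)" "distinct (out_wires G vs v)"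
proof -
  have "in_wires G vs v = map (\<lambda>u. (u, v)) (filter (\<lambda>u. u \<in> lat G \<and> (u, v) \<in> edges G) us)"
    if "us = vs" for us
    unfolding in_wires_def that[symmetric] by (induction us) auto
  then show "distinct (in_wires G vs v)"
    using assms by (auto simp: distinct_map inj_on_def)
  have "out_wires G vs v = map (\<lambda>y. (v, y)) (filter (\<lambda>y. v \<in> lat G \<and> (v, y) \<in> edges G) us)"
    if "us = vs" for us
    unfolding out_wires_def that[symmetric] by (induction us) auto
  then show "distinct (out_wires G vs v)"
    using assms by (auto simp: distinct_map inj_on_def)
qed

definition rest_wires :: "('n, 'a) causal_dag \<Rightarrow> 'n list \<Rightarrow> 'n \<Rightarrow> ('n \<times> 'n) list \<Rightarrow> ('n \<times> 'n) list"
    where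
  "rest_wires G vs v es = filter (\<lambda>e. e \<notin> set (in_wires G vs v)) es"

definition next_wires :: "('n, 'a) causal_dag \<Rightarrow> 'n list \<Rightarrow> 'n \<Rightarrow> ('n \<times> 'n) list \<Rightarrow> ('n \<times> 'n) list"
    where
  "next_wires G vs v es = out_wires G vs v @ rest_wires G vs v es"

text \<open>The list \<open>ws\<close> may skip vertices of \<open>vs\<close>, so partial circuits
  are covered; \<open>vs\<close> itself only fixes the order of the wires at each vertex. That no
  open wire starts at \<open>w\<close> keeps the open wires distinct once the outputs of
  \<open>w\<close> are added.\<close>

primrec runnable :: "('n, 'a) causal_dag \<Rightarrow> 'n list \<Rightarrow> 'n list \<Rightarrow> ('n \<times> 'n) list \<Rightarrow> bool" where
  "runnable G vs [] es \<longleftrightarrow> True"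
| "runnable G vs (w # ws) es \<longleftrightarrow>
     set (in_wires G vs w) \<subseteq> set es \<and> w \<notin> fst ` set es \<and> runnable G vs ws (next_wires G vs w es)"

locale circuits = symmetric_monoidal \<G>
  for \<G> :: "('s, 't, 'v) gpt" (structure) +
  fixes G :: "('n, 'a) causal_dag" and vs :: "'n list" and sys :: "'n \<times> 'n \<Rightarrow> 's"
  assumes distinct_vs: "distinct vs"
begin

abbreviation "csys \<equiv> composite \<G> sys"
abbreviation "reo \<equiv> rearrange \<G> sys"
abbreviation "ins \<equiv> in_wires G vs"
abbreviation "outs \<equiv> out_wires G vs"
abbreviation "rests \<equiv> rest_wires G vs"
abbreviation "nexts \<equiv> next_wires G vs"
abbreviation "step \<equiv> circuit_step \<G> G vs sys"

section \<open>A run as a morphism on its open wires\<close>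

definition typed :: "('n \<Rightarrow> 't) \<Rightarrow> 'n set \<Rightarrow> bool" where
  "typed \<tau> U \<longleftrightarrow> (\<forall>v\<in>U. \<tau> v \<in> hom \<G> (csys (ins v)) (csys (outs v)))"

text \<open>The factor that \<open>circuit_step\<close> composes with the current state, taken by
  itself so that it can be tensored with idle wires.\<close>

definition step_op :: "('n \<Rightarrow> 't) \<Rightarrow> 'n \<Rightarrow> ('n \<times> 'n) list \<Rightarrow> 't" where
  "step_op \<tau> v es = (\<tau> v \<otimes> ident \<G> (csys (rests v es))) \<cdot> reo (ins v @ rests v es) es"

lemma mset_ins_rests:
  assumes "distinct es" "set (ins v) \<subseteq> set es"
  shows "mset (ins v @ rests v es) = mset es"
proof -
  have "distinct (ins v @ rests v es)" "set (ins v @ rests v es) = set es"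
    using assms distinct_wires(1)[OF distinct_vs, of G v] by (auto simp: rest_wires_def)
  then show ?thesis using assms(1) set_eq_iff_mset_eq_distinct by blast
qed

lemma distinct_nexts:
  assumes "distinct es" "v \<notin> fst ` set es"
  shows "distinct (nexts v es)"
  using assms distinct_wires(2)[OF distinct_vs, of G v] fst_out_wires[of _ G vs v]
  by (auto simp: next_wires_def rest_wires_def)

lemma step_op_hom:
  assumes "distinct es" "set (ins v) \<subseteq> set es" "\<tau> v \<in> hom \<G> (csys (ins v)) (csys (outs v))"
  shows "step_op \<tau> v es \<in> hom \<G> (csys es) (csys (nexts v es))"
proof -
  have "reo (ins v @ rests v es) es \<in> hom \<G> (csys es) (csys (ins v) \<odot> csys (rests v es))"
    using rearrange_hom[OF mset_ins_rests[OF assms(1,2)], of sys] by simp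
  from seq_hom[OF par_hom[OF assms(3) ident_hom] this] show ?thesis
    by (simp add: step_op_def next_wires_def)
qed

lemma step_eq:
  assumes "distinct es" "set (ins v) \<subseteq> set es" "\<tau> v \<in> hom \<G> (csys (ins v)) (csys (outs v))"
    and "t \<in> hom \<G> A (csys es)"
  shows "step \<tau> (es, t) v = (nexts v es, step_op \<tau> v es \<cdot> t)"
proof -
  have "reo (ins v @ rests v es) es \<in> hom \<G> (csys es) (csys (ins v) \<odot> csys (rests v es))"
    using rearrange_hom[OF mset_ins_rests[OF assms(1,2)], of sys] by simp
  from seq_assoc[OF par_hom[OF assms(3) ident_hom] this assms(4)] show ?thesis
    by (simp add: circuit_step_def step_op_def next_wires_def rest_wires_def Let_def)
qed

primrec run_wires :: "'n list \<Rightarrow> ('n \<times> 'n) list \<Rightarrow> ('n \<times> 'n) list" where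
  "run_wires [] es = es"
| "run_wires (w # ws) es = run_wires ws (nexts w es)"

text \<open>A run as a morphism out of its initial wires. In \<open>sum_val\<close> the vertices
  after the removed one act in this form on a part of the open wires.\<close>

primrec run_op :: "('n \<Rightarrow> 't) \<Rightarrow> 'n list \<Rightarrow> ('n \<times> 'n) list \<Rightarrow> 't" where
  "run_op \<tau> [] es = ident \<G> (csys es)"
| "run_op \<tau> (w # ws) es = run_op \<tau> ws (nexts w es) \<cdot> step_op \<tau> w es"

lemma run_op_hom:
  "\<lbrakk>runnable G vs ws es; distinct es; typed \<tau> (set ws)\<rbrakk> \<Longrightarrow>
   run_op \<tau> ws es \<in> hom \<G> (csys es) (csys (run_wires ws es))"
proof (induction ws arbitrary: es)
  case Nil
  then show ?case using ident_hom by simp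
next
  case (Cons w ws)
  then have "run_op \<tau> ws (nexts w es) \<in> hom \<G> (csys (nexts w es)) (csys (run_wires ws (nexts w
      es)))"
    by (intro Cons.IH) (auto simp: typed_def distinct_nexts)
  moreover have "step_op \<tau> w es \<in> hom \<G> (csys es) (csys (nexts w es))"
    using Cons.prems by (intro step_op_hom[where \<tau>=\<tau> and v=w]) (auto simp: typed_def)
  ultimately show ?case by (auto intro: seq_hom)
qed

lemma step_op_append:
  assumes "distinct (cs @ as)" "set (ins v) \<subseteq> set cs" "\<tau> v \<in> hom \<G> (csys (ins v)) (csys (outs v))"
  shows "nexts v (cs @ as) = nexts v cs @ as"
    and "step_op \<tau> v (cs @ as) = step_op \<tau> v cs \<otimes> ident \<G> (csys as)"
proof -
  have "filter (\<lambda>e. e \<notin> set (ins v)) as = as"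
    using assms(1,2) by (auto simp: filter_id_conv)
  then have r: "rests v (cs @ as) = rests v cs @ as"
    by (simp add: rest_wires_def)
  then show "nexts v (cs @ as) = nexts v cs @ as" by (simp add: next_wires_def)
  have m: "mset (ins v @ rests v cs) = mset cs"
    using assms by (intro mset_ins_rests) auto
  have "reo ((ins v @ rests v cs) @ as) (cs @ as) = reo (ins v @ rests v cs) cs \<otimes> reo as as"
    by (rule rearrange_append[OF m]) simp
  moreover have h: "reo (ins v @ rests v cs) cs \<in> hom \<G> (csys cs) (csys (ins v) \<odot> csys (rests v
      cs))"
    using rearrange_hom[OF m, of sys] by simp
  ultimately show "step_op \<tau> v (cs @ as) = step_op \<tau> v cs \<otimes> ident \<G> (csys as)"
    by (simp add: step_op_def r par_seq_ident_right[OF par_hom[OF assms(3) ident_hom] h]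
        par_ident_ident(2)[OF assms(3)])
qed

text \<open>Runnability on \<open>cs\<close> alone means that the wires \<open>as\<close> are never
  consumed. The condition on the starting points of \<open>as\<close> prevents a later output from
  colliding with one of these idle wires.\<close>

lemma foldl_step_append:
  "\<lbrakk>runnable G vs ws cs; distinct (cs @ as); typed \<tau> (set ws); \<forall>w\<in>set ws. w \<notin> fst ` set as;
    t \<in> hom \<G> A (csys (cs @ as))\<rbrakk> \<Longrightarrow>
   foldl (step \<tau>) (cs @ as, t) ws = (run_wires ws cs @ as, (run_op \<tau> ws cs \<otimes> ident \<G> (csys as)) \<cdot>
       t)"
proof (induction ws arbitrary: cs t)
  case Nil
  then show ?case using seq_ident by (simp add: par_ident)
next
  case (Cons w ws)
  then have w: "\<tau> w \<in> hom \<G> (csys (ins w)) (csys (outs w))" "set (ins w) \<subseteq> set cs"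
      "w \<notin> fst ` set (cs @ as)"
    "typed \<tau> (set ws)" "runnable G vs ws (nexts w cs)"
    by (auto simp: typed_def)
  note a = step_op_append[where v=w, where \<tau>=\<tau>, OF Cons.prems(2) w(2,1)]
  have s: "step_op \<tau> w cs \<in> hom \<G> (csys cs) (csys (nexts w cs))"
    using Cons.prems w by (intro step_op_hom[where \<tau>=\<tau> and v=w]) auto
  have s': "step_op \<tau> w cs \<otimes> ident \<G> (csys as) \<in> hom \<G> (csys (cs @ as)) (csys (nexts w cs @ as))"
    using par_hom[OF s ident_hom] by simp
  have d: "distinct (nexts w cs @ as)"
    using distinct_nexts[OF Cons.prems(2) w(3)] a(1) by simp
  have r: "run_op \<tau> ws (nexts w cs) \<in> hom \<G> (csys (nexts w cs)) (csys (run_wires ws (nexts w cs)))"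
    using d by (intro run_op_hom w) simp
  have "foldl (step \<tau>) (cs @ as, t) (w # ws) =
      foldl (step \<tau>) (nexts w cs @ as, (step_op \<tau> w cs \<otimes> ident \<G> (csys as)) \<cdot> t) ws"
    using step_eq[where v=w and \<tau>=\<tau>, OF Cons.prems(2) _ w(1) Cons.prems(5)] w(2) by (simp add: a
        subset_iff)
  also have "\<dots> = (run_wires ws (nexts w cs) @ as,
      (run_op \<tau> ws (nexts w cs) \<otimes> ident \<G> (csys as)) \<cdot> (step_op \<tau> w cs \<otimes> ident \<G> (csys as)) \<cdot> t)"
    using Cons.prems by (intro Cons.IH w d seq_hom[OF s']) auto
  finally show ?case
    using seq_assoc[OF par_hom[OF r ident_hom] _ Cons.prems(5)] s'
    by (simp add: par_seq_ident_right[OF r s])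
qed

section \<open>Evaluation states up to the order of the open wires\<close>

definition same_state :: "('n \<times> 'n) list \<times> 't \<Rightarrow> ('n \<times> 'n) list \<times> 't \<Rightarrow> bool" where
  "same_state s s' \<longleftrightarrow> distinct (fst s) \<and> mset (fst s') = mset (fst s) \<and>
     snd s \<in> hom \<G> \<I> (csys (fst s)) \<and> snd s' = reo (fst s') (fst s) \<cdot> snd s"

lemma same_state_hom:
  "same_state s s' \<Longrightarrow> snd s' \<in> hom \<G> \<I> (csys (fst s'))"
  using rearrange_hom by (auto simp: same_state_def intro: seq_hom)

lemma same_state_distinct: "same_state s s' \<Longrightarrow> distinct (fst s')"
  unfolding same_state_def by (metis mset_eq_imp_distinct_iff)

lemma same_state_refl: "\<lbrakk>distinct es; t \<in> hom \<G> \<I> (csys es)\<rbrakk> \<Longrightarrow> same_state (es, t) (es, t)"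
  by (simp add: same_state_def seq_ident)

lemma same_state_trans:
  assumes "same_state s s'" "same_state s' s''"
  shows "same_state s s''"
proof -
  have m: "mset (fst s'') = mset (fst s')" "mset (fst s') = mset (fst s)"
    using assms by (simp_all add: same_state_def)
  have "snd s'' = reo (fst s'') (fst s') \<cdot> reo (fst s') (fst s) \<cdot> snd s"
    using assms by (simp add: same_state_def)
  also have "\<dots> = reo (fst s'') (fst s) \<cdot> snd s"
    using seq_assoc[OF rearrange_hom[OF m(1), of sys] rearrange_hom[OF m(2), of sys], of "snd s" \<I>]
      assms(1) rearrange_rearrange[OF m, of sys]
    by (simp add: same_state_def)
  finally show ?thesis using assms by (simp add: same_state_def)
qed

text \<open>Once the inputs of \<open>v\<close> are in front, the two lists differ only by a
  permutation of the remaining wires, and this permutation slides past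
  \<open>\<tau> v\<close>.\<close>

lemma same_state_step:
  assumes "same_state s s'" "set (ins v) \<subseteq> set (fst s)" "v \<notin> fst ` set (fst s)"
    "\<tau> v \<in> hom \<G> (csys (ins v)) (csys (outs v))"
  shows "same_state (step \<tau> s v) (step \<tau> s' v)"
proof -
  obtain es t es' t' where s: "s = (es, t)" "s' = (es', t')" by fastforce
  have m: "mset es' = mset es" and d: "distinct es" and t: "t \<in> hom \<G> \<I> (csys es)"
    and t': "t' = reo es' es \<cdot> t"
    using assms(1) by (simp_all add: same_state_def s)
  have d': "distinct es'" using m d by (metis mset_eq_imp_distinct_iff)
  have se: "set es' = set es" using m by (metis mset_eq_setD)
  have t'h: "t' \<in> hom \<G> \<I> (csys es')" using same_state_hom[OF assms(1)] by (simp add: s)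
  have i: "set (ins v) \<subseteq> set es" using assms(2) s by simp
  have i': "set (ins v) \<subseteq> set es'" using i se by simp
  define r where "r = rests v es"
  define r' where "r' = rests v es'"
  have mi: "mset (ins v @ r) = mset es" unfolding r_def by (rule mset_ins_rests[OF d i])
  have mi': "mset (ins v @ r') = mset es'" unfolding r'_def by (rule mset_ins_rests[OF d' i'])
  have mr: "mset r' = mset r" using mi mi' m by (metis add_left_imp_eq mset_append)
  note R = rearrange_hom[OF mr, of sys]
  have h: "reo (ins v @ r) es \<in> hom \<G> (csys es) (csys (ins v) \<odot> csys r)"
    using rearrange_hom[OF mi, of sys] by simp
  have h': "reo (ins v @ r') es' \<in> hom \<G> (csys es') (csys (ins v) \<odot> csys r')"
    using rearrange_hom[OF mi', of sys] by simp
  \<comment> \<open>By functoriality, both ways of bringing the inputs forward agree up to a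
    permutation of the rest.\<close>
  have 1: "reo (ins v @ r') es' \<cdot> reo es' es = (ident \<G> (csys (ins v)) \<otimes> reo r' r) \<cdot> reo (ins v @
      r) es"
    using rearrange_rearrange[OF mi' m, of sys] rearrange_rearrange[of "ins v @ r'" "ins v @ r" es
        sys] mi mr
      rearrange_append[of "ins v" "ins v" r' r sys]
    by simp
  have 2: "reo (outs v @ r') (outs v @ r) = ident \<G> (csys (outs v)) \<otimes> reo r' r"
    using rearrange_append[OF refl mr, of sys "outs v"] by simp
  note sl = par_slide[OF assms(4) R]
  have ti: "\<tau> v \<otimes> ident \<G> (csys x) \<in> hom \<G> (csys (ins v) \<odot> csys x) (csys (outs v) \<odot> csys x)" for x
    by (rule par_hom[OF assms(4) ident_hom])
  have "step_op \<tau> v es' \<cdot> reo es' es = (\<tau> v \<otimes> ident \<G> (csys r')) \<cdot> (reo (ins v @ r') es' \<cdot> reo es'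
      es)"
    unfolding step_op_def r'_def[symmetric] by (rule seq_assoc[OF ti h' rearrange_hom[OF m]])
  also have "\<dots> = (ident \<G> (csys (outs v)) \<otimes> reo r' r) \<cdot> (\<tau> v \<otimes> ident \<G> (csys r)) \<cdot> reo (ins v @ r)
      es"
    unfolding 1 
    using seq_assoc[OF ti par_hom[OF ident_hom R] h] seq_assoc[OF par_hom[OF ident_hom R] ti h] sl
        by simp
  also have "\<dots> = reo (nexts v es') (nexts v es) \<cdot> step_op \<tau> v es"
    by (simp add: step_op_def next_wires_def r_def[symmetric] r'_def[symmetric] 2)
  finally have 3: "step_op \<tau> v es' \<cdot> reo es' es = reo (nexts v es') (nexts v es) \<cdot> step_op \<tau> v es" .
  have so: "step_op \<tau> v es \<in> hom \<G> (csys es) (csys (nexts v es))" by (rule step_op_hom[where \<tau>=\<tau>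
      and v=v, OF d i assms(4)])
  have so': "step_op \<tau> v es' \<in> hom \<G> (csys es') (csys (nexts v es'))" by (rule step_op_hom[where
      \<tau>=\<tau> and v=v, OF d' i' assms(4)])
  have mn: "mset (nexts v es') = mset (nexts v es)"
    using mr by (simp add: next_wires_def r_def r'_def)
  have "step_op \<tau> v es' \<cdot> t' = reo (nexts v es') (nexts v es) \<cdot> step_op \<tau> v es \<cdot> t"
    unfolding t' using seq_assoc[OF so' rearrange_hom[OF m] t] seq_assoc[OF rearrange_hom[OF mn]
        so t] 3 by simp
  then show ?thesis
    unfolding s step_eq[where \<tau>=\<tau> and v=v, OF d i assms(4) t] step_eq[where \<tau>=\<tau> and v=v, OF d' i'
        assms(4) t'h] same_state_def
    using distinct_nexts[OF d] assms(3) s mn seq_hom[OF so t] by simp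
qed

lemma step_hom:
  assumes "distinct (fst s)" "snd s \<in> hom \<G> \<I> (csys (fst s))"
    "set (ins v) \<subseteq> set (fst s)" "v \<notin> fst ` set (fst s)"
    "\<tau> v \<in> hom \<G> (csys (ins v)) (csys (outs v))"
  shows "fst (step \<tau> s v) = nexts v (fst s)" "distinct (fst (step \<tau> s v))"
    "snd (step \<tau> s v) \<in> hom \<G> \<I> (csys (fst (step \<tau> s v)))"
  using step_eq[where \<tau>=\<tau> and v=v and es="fst s" and t="snd s", OF assms(1,3,5,2)]
      distinct_nexts[OF assms(1,4)]
    seq_hom[OF step_op_hom[where \<tau>=\<tau> and v=v, OF assms(1,3,5)] assms(2)]
  by simp_all

lemma same_state_foldl:
  "\<lbrakk>same_state s s'; runnable G vs ws (fst s); typed \<tau> (set ws)\<rbrakk> \<Longrightarrow>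
   same_state (foldl (step \<tau>) s ws) (foldl (step \<tau>) s' ws)"
proof (induction ws arbitrary: s s')
  case (Cons w ws)
  have w: "\<tau> w \<in> hom \<G> (csys (ins w)) (csys (outs w))" "set (ins w) \<subseteq> set (fst s)"
      "w \<notin> fst ` set (fst s)"
    using Cons.prems by (auto simp: typed_def)
  have "same_state (step \<tau> s w) (step \<tau> s' w)"
    by (rule same_state_step[where \<tau>=\<tau> and v=w, OF Cons.prems(1) w(2,3,1)])
  moreover have "fst (step \<tau> s w) = nexts w (fst s)"
    using Cons.prems(1) w by (intro step_hom(1)[where \<tau>=\<tau> and v=w]) (auto simp: same_state_def)
  ultimately show ?case using Cons.IH Cons.prems by (auto simp: typed_def)
qed simp

text \<open>Naturality of the swap at states: the swap on the input side is that of two trivial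
  systems, an identity.\<close>

lemma same_state_swap:
  assumes "distinct (es1 @ es2)" "t1 \<in> hom \<G> \<I> (csys es1)" "t2 \<in> hom \<G> \<I> (csys es2)"
  shows "same_state (es1 @ es2, t1 \<otimes> t2) (es2 @ es1, t2 \<otimes> t1)"
  using assms rearrange_swap[of es1 es2 sys] swap_natural[OF assms(2,3)] swap_triv[of \<I>]
    par_hom[OF assms(2,3)] par_hom[OF assms(3,2)] seq_ident(1)[of "t2 \<otimes> t1" \<I>]
  by (auto simp: same_state_def)

lemma step_product_left:
  assumes "same_state s (es1 @ es2, t1 \<otimes> t2)" "t1 \<in> hom \<G> \<I> (csys es1)" "t2 \<in> hom \<G> \<I> (csys es2)"
    and "set (ins v) \<subseteq> set es1" "v \<notin> fst ` set (es1 @ es2)"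
    "\<tau> v \<in> hom \<G> (csys (ins v)) (csys (outs v))"
  shows "same_state (step \<tau> s v) (nexts v es1 @ es2, (step_op \<tau> v es1 \<cdot> t1) \<otimes> t2)"
proof -
  have d: "distinct (es1 @ es2)" and m: "mset (es1 @ es2) = mset (fst s)"
    using same_state_distinct[OF assms(1)] assms(1) by (simp_all add: same_state_def)
  have se: "set (es1 @ es2) = set (fst s)" using m by (metis mset_eq_setD)
  have i: "set (ins v) \<subseteq> set (es1 @ es2)" using assms(4) by auto
  have tt: "t1 \<otimes> t2 \<in> hom \<G> \<I> (csys (es1 @ es2))" using par_hom[OF assms(2,3)] by simp
  have d1: "distinct es1" using d by simp
  note so = step_op_hom[where \<tau>=\<tau> and v=v, OF d1 assms(4,6)]
  have "same_state (step \<tau> s v) (step \<tau> (es1 @ es2, t1 \<otimes> t2) v)"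
    using assms i se by (intro same_state_step[where \<tau>=\<tau> and v=v]) auto
  also have "step \<tau> (es1 @ es2, t1 \<otimes> t2) v = (nexts v es1 @ es2, (step_op \<tau> v es1 \<otimes> ident \<G> (csys
      es2)) \<cdot> (t1 \<otimes> t2))"
    using step_eq[where \<tau>=\<tau> and v=v, OF d i assms(6) tt] step_op_append[where \<tau>=\<tau> and v=v, OF d
        assms(4,6)] by simp
  also have "(step_op \<tau> v es1 \<otimes> ident \<G> (csys es2)) \<cdot> (t1 \<otimes> t2) = (step_op \<tau> v es1 \<cdot> t1) \<otimes> t2"
    using interchange[OF so assms(2) ident_hom assms(3)] by (simp add: seq_ident(2)[OF assms(3)])
  finally show ?thesis .
qed

text \<open>The invariant is a product state, one factor on wires that start in \<open>U\<close>,
  the other on wires that start outside. Runnability of the two sublists makes every vertex draw its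
  inputs from its own factor, so the interleaved run is two separate runs side by side.\<close>

lemma foldl_step_product:
  assumes "same_state s (es1 @ es2, t1 \<otimes> t2)" "t1 \<in> hom \<G> \<I> (csys es1)" "t2 \<in> hom \<G> \<I> (csys es2)"
    and "runnable G vs (filter (\<lambda>v. v \<in> U) ws) es1" "runnable G vs (filter (\<lambda>v. v \<notin> U) ws) es2"
    and "fst ` set es1 \<subseteq> U" "fst ` set es2 \<inter> U = {}" "typed \<tau> (set ws)"
  shows "\<exists>fs1 u1 fs2 u2. foldl (step \<tau>) (es1, t1) (filter (\<lambda>v. v \<in> U) ws) = (fs1, u1) \<and>
     foldl (step \<tau>) (es2, t2) (filter (\<lambda>v. v \<notin> U) ws) = (fs2, u2) \<and>
     u1 \<in> hom \<G> \<I> (csys fs1) \<and> u2 \<in> hom \<G> \<I> (csys fs2) \<and>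
     same_state (foldl (step \<tau>) s ws) (fs1 @ fs2, u1 \<otimes> u2)"
  using assms
proof (induction ws arbitrary: s es1 t1 es2 t2)
  case (Cons w ws)
  have ty: "\<tau> w \<in> hom \<G> (csys (ins w)) (csys (outs w))" "typed \<tau> (set ws)"
    using Cons.prems by (auto simp: typed_def)
  have d: "distinct (es1 @ es2)"
    using same_state_distinct[OF Cons.prems(1)] by simp
  have fn: "fst ` set (nexts w es) \<subseteq> insert w (fst ` set es)" for es
    using fst_out_wires[of _ G vs w] by (auto simp: next_wires_def rest_wires_def)
  show ?case
  proof (cases "w \<in> U")
    case True
    have i: "set (ins w) \<subseteq> set es1" "w \<notin> fst ` set (es1 @ es2)" "distinct es1"
      using True Cons.prems d by auto
    note so = step_op_hom[where \<tau>=\<tau> and v=w, OF i(3,1) ty(1)]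
    have "same_state (step \<tau> s w) (nexts w es1 @ es2, (step_op \<tau> w es1 \<cdot> t1) \<otimes> t2)"
      by (rule step_product_left[where \<tau>=\<tau> and v=w, OF Cons.prems(1-3) i(1,2) ty(1)])
    moreover have "runnable G vs (filter (\<lambda>v. v \<in> U) ws) (nexts w es1)"
      "runnable G vs (filter (\<lambda>v. v \<notin> U) ws) es2"
      using True Cons.prems(4,5) by simp_all
    moreover have "fst ` set (nexts w es1) \<subseteq> U"
      using fn[of es1] True Cons.prems(6) by blast
    ultimately show ?thesis
      using Cons.IH[OF _ seq_hom[OF so Cons.prems(2)] Cons.prems(3) _ _ _ Cons.prems(7) ty(2)] True
        step_eq[where v=w and \<tau>=\<tau>, OF i(3,1) ty(1) Cons.prems(2)]
      by simp
  next
    case False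
    have i: "set (ins w) \<subseteq> set es2" "w \<notin> fst ` set (es2 @ es1)" "distinct es2"
      using False Cons.prems d by auto
    note so = step_op_hom[where \<tau>=\<tau> and v=w, OF i(3,1) ty(1)]
    \<comment> \<open>The factors change places, the step acts on the one now at the left, and they
      change back.\<close>
    have "same_state s (es2 @ es1, t2 \<otimes> t1)"
      by (rule same_state_trans[OF Cons.prems(1) same_state_swap[OF d Cons.prems(2,3)]])
    from step_product_left[where \<tau>=\<tau> and v=w, OF this Cons.prems(3,2) i(1,2) ty(1)]
    have 1: "same_state (step \<tau> s w) (nexts w es2 @ es1, (step_op \<tau> w es2 \<cdot> t2) \<otimes> t1)" .
    have "distinct (nexts w es2 @ es1)"
      using same_state_distinct[OF 1] by simp
    from same_state_trans[OF 1 same_state_swap[OF this seq_hom[OF so Cons.prems(3)] Cons.prems(2)]]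
    have "same_state (step \<tau> s w) (es1 @ nexts w es2, t1 \<otimes> (step_op \<tau> w es2 \<cdot> t2))" .
    moreover have "runnable G vs (filter (\<lambda>v. v \<in> U) ws) es1"
      "runnable G vs (filter (\<lambda>v. v \<notin> U) ws) (nexts w es2)"
      using False Cons.prems(4,5) by simp_all
    moreover have "fst ` set (nexts w es2) \<inter> U = {}"
      using fn[of es2] False Cons.prems(7) by blast
    ultimately show ?thesis
      using Cons.IH[OF _ Cons.prems(2) seq_hom[OF so Cons.prems(3)] _ _ Cons.prems(6) _ ty(2)] False
        step_eq[where v=w and \<tau>=\<tau>, OF i(3,1) ty(1) Cons.prems(3)]
      by simp
  qed
qed simp

end


section \<open>Values of circuits with discarded outputs\<close>

context gpt
begin

section \<open>States and scalars\<close>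

lemma one_space: "\<one> \<in> space \<G> \<I>"
  by (simp add: space_triv span_base)

lemma states_space: "states \<G> A \<subseteq> space \<G> A"
  unfolding states_def
  using nstates_space[of A] subspace_0[OF space_subspace] subspace_imp_convex[OF space_subspace]
  by (intro hull_minimal) auto

text \<open>A state is prepared from \<open>\<one>\<close> by a transformation, and composing that
  transformation with \<open>T\<close> prepares its image.\<close>

lemma act_states:
  assumes "T \<in> hom \<G> A B" "\<omega> \<in> states \<G> A"
  shows "act \<G> T \<omega> \<in> states \<G> B"
proof -
  obtain S where S: "S \<in> hom \<G> \<I> A" "\<omega> = act \<G> S \<one>"
    using assms(2) bij_betw_imp_surj_on[OF states_transformations] by blast
  then have "act \<G> T \<omega> = act \<G> (T \<cdot> S) \<one>"
    using act_seq[OF assms(1) S(1) one_space] by simp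
  then show ?thesis
    using bij_betwE[OF states_transformations] seq_hom[OF assms(1) S(1)] by auto
qed

lemma one_states: "\<one> \<in> states \<G> \<I>"
  by (simp add: states_def nstates_triv hull_inc)

lemma linear_eq_on_states:
  assumes "linear f" "linear g" "\<And>\<omega>. \<omega> \<in> \<Omega> A \<Longrightarrow> f \<omega> = g \<omega>" "\<omega> \<in> states \<G> A"
  shows "f \<omega> = g \<omega>"
proof -
  have "states \<G> A \<subseteq> span (\<Omega> A)"
    unfolding states_def by (intro hull_minimal) (auto simp: span_base span_zero
        subspace_imp_convex)
  then show ?thesis using linear_eq_on_span[OF assms(1,2)] assms(3,4) by blast
qed

lemma scalar_eqI: "act \<G> t \<one> = r *\<^sub>R \<one> \<Longrightarrow> scalar \<G> t = r"
  unfolding scalar_def using one_nonzero by (intro the_equality) auto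

text \<open>The states of the trivial system form the segment between 0 and \<open>\<one>\<close>;
  hence the multiple exists and is non-negative.\<close>

lemma scalar:
  assumes "t \<in> hom \<G> \<I> \<I>"
  shows "act \<G> t \<one> = scalar \<G> t *\<^sub>R \<one>" "0 \<le> scalar \<G> t"
proof -
  have "act \<G> t \<one> \<in> closed_segment \<one> 0"
    using act_states[OF assms one_states]
    by (simp add: states_def nstates_triv segment_convex_hull insert_commute)
  \<comment> \<open>The segment is parametrized from \<open>\<one>\<close> towards 0, so the
    coefficient of \<open>\<one>\<close> is \<open>1 - u\<close>.\<close>
  then obtain r where "0 \<le> r" "act \<G> t \<one> = r *\<^sub>R \<one>"
    by (auto simp: closed_segment_def intro!: that[of "1 - u" for u])
  then show "act \<G> t \<one> = scalar \<G> t *\<^sub>R \<one>" "0 \<le> scalar \<G> t"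
    using scalar_eqI by auto
qed

lemma scalar_ident: "scalar \<G> (ident \<G> \<I>) = 1"
  by (intro scalar_eqI) (simp add: act_ident one_space)

text \<open>On the trivial system the tensor product equals sequential composition (the
  Eckmann-Hilton argument), and composition of scalars is multiplication by linearity.\<close>

lemma scalar_par:
  assumes "S \<in> hom \<G> \<I> \<I>" "T \<in> hom \<G> \<I> \<I>"
  shows "scalar \<G> (S \<otimes> T) = scalar \<G> S * scalar \<G> T"
proof (rule scalar_eqI)
  have "S \<otimes> T = S \<cdot> T"
    using par_slide(1)[OF assms] par_unit[OF assms(1)] par_unit[OF assms(2)] by simp
  then show "act \<G> (S \<otimes> T) \<one> = (scalar \<G> S * scalar \<G> T) *\<^sub>R \<one>"
    using act_seq[OF assms one_space] scalar(1)[OF assms(1)] scalar(1)[OF assms(2)]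
      linear_scale[OF act_linear[OF assms(1)]]
    by simp
qed

section \<open>Discarding and causality\<close>

lemma act_discard_triv:
  assumes "\<omega> \<in> space \<G> \<I>"
  shows "act \<G> (discard \<G> \<I>) \<omega> = \<omega>"
proof (rule linear_eq_on_span[OF act_linear[OF discard_hom] linear_ident])
  show "\<omega> \<in> span {\<one>}" using assms by (simp add: space_triv)
  show "act \<G> (discard \<G> \<I>) v = v" if "v \<in> {\<one>}" for v
    using that discard_nstates[of \<one> \<I>] by (simp add: nstates_triv)
qed

text \<open>Presents discarding as a measurement with one outcome, the form in which
  \<open>no_signalling\<close> applies to it.\<close>

lemma measurement_discard: "measurement \<G> A {0 :: nat} (\<lambda>_. discard \<G> A)"
  using act_space[OF discard_hom[of A]] discard_hom act_discard_triv by (auto simp: test_def)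

text \<open>No-signalling says that discarding \<open>A\<close> leaves a normalized state of
  \<open>B\<close>, so both effects are \<open>\<one>\<close> on normalized states, and linearity
  extends the equality to all states. It is claimed on states only, since \<open>space\<close> may
  be larger than their span.\<close>

lemma discard_par:
  assumes "\<omega> \<in> states \<G> (A \<odot> B)"
  shows "act \<G> (discard \<G> A \<otimes> discard \<G> B) \<omega> = act \<G> (discard \<G> (A \<odot> B)) \<omega>"
proof (rule linear_eq_on_states[OF act_linear act_linear _ assms])
  have h: "discard \<G> A \<otimes> ident \<G> B \<in> hom \<G> (A \<odot> B) B"
    using par_hom[OF discard_hom ident_hom, of A B] by simp
  show "discard \<G> A \<otimes> discard \<G> B \<in> hom \<G> (A \<odot> B) \<I>"
    using par_hom[OF discard_hom discard_hom, of A B] by simp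
  show "discard \<G> (A \<odot> B) \<in> hom \<G> (A \<odot> B) \<I>" by (rule discard_hom)
  fix \<omega> assume w: "\<omega> \<in> \<Omega> (A \<odot> B)"
  have "discard \<G> A \<otimes> discard \<G> B = discard \<G> B \<cdot> (discard \<G> A \<otimes> ident \<G> B)"
    using par_slide(2)[OF discard_hom[of A] discard_hom[of B]] par_unit(1)[OF discard_hom, of B]
        by simp
  then have "act \<G> (discard \<G> A \<otimes> discard \<G> B) \<omega> =
      act \<G> (discard \<G> B) (act \<G> (discard \<G> A \<otimes> ident \<G> B) \<omega>)"
    using act_seq[OF discard_hom h subsetD[OF nstates_space w]] by simp
  also have "\<dots> = \<one>"
    using no_signalling(1)[OF measurement_discard w] by (simp add: discard_nstates)
  finally show "act \<G> (discard \<G> A \<otimes> discard \<G> B) \<omega> = act \<G> (discard \<G> (A \<odot> B)) \<omega>"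
    using w by (simp add: discard_nstates)
qed

text \<open>Discarding wire by wire splits over concatenation and is invariant under permutations as
  an equation of morphisms. Its agreement with the single effect \<open>discard\<close> of the
  composite is proved for the action on states.\<close>

definition discard_all :: "('e \<Rightarrow> 's) \<Rightarrow> 'e list \<Rightarrow> 't" where
  "discard_all sys es = foldr (\<lambda>e. par \<G> (discard \<G> (sys e))) es (ident \<G> \<I>)"

lemma discard_all_Nil [simp]: "discard_all sys [] = ident \<G> \<I>"
  and discard_all_Cons [simp]: "discard_all sys (e # es) = discard \<G> (sys e) \<otimes> discard_all sys es"
  by (simp_all add: discard_all_def)

lemma discard_all_hom: "discard_all sys es \<in> hom \<G> (composite \<G> sys es) \<I>"
proof (induction es)
  case (Cons e es)
  then show ?case using par_hom[OF discard_hom Cons.IH] by simp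
qed (simp add: ident_hom)

lemma discard_all_append:
  "discard_all sys (es @ fs) = discard_all sys es \<otimes> discard_all sys fs"
  by (induction es) (simp_all add: par_unit[OF discard_all_hom]
      par_assoc[OF discard_hom discard_all_hom discard_all_hom])

lemma act_discard_all:
  "\<omega> \<in> states \<G> (composite \<G> sys es) \<Longrightarrow>
   act \<G> (discard_all sys es) \<omega> = act \<G> (discard \<G> (composite \<G> sys es)) \<omega>"
proof (induction es arbitrary: \<omega>)
  case Nil
  then show ?case using states_space[of \<I>] by (auto simp: act_ident act_discard_triv)
next
  case (Cons e es)
  let ?A = "sys e" and ?B = "composite \<G> sys es"
  have w: "\<omega> \<in> states \<G> (?A \<odot> ?B)" "\<omega> \<in> space \<G> (?A \<odot> ?B)"
    using Cons.prems states_space[of "?A \<odot> ?B"] by auto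
  have h: "discard \<G> ?A \<otimes> ident \<G> ?B \<in> hom \<G> (?A \<odot> ?B) ?B"
    using par_hom[OF discard_hom ident_hom, of ?A ?B] by simp
  have "discard \<G> ?A \<otimes> t = t \<cdot> (discard \<G> ?A \<otimes> ident \<G> ?B)" if "t \<in> hom \<G> ?B \<I>" for t
    using par_slide(2)[OF discard_hom[of ?A] that] par_unit(1)[OF that] by simp
  from this[OF discard_all_hom] this[OF discard_hom]
  have "act \<G> (discard_all sys (e # es)) \<omega> = act \<G> (discard \<G> ?A \<otimes> discard \<G> ?B) \<omega>"
    using act_seq[OF discard_all_hom h w(2)] act_seq[OF discard_hom h w(2)] Cons.IH[OF
        act_states[OF h w(1)]]
    by simp
  then show ?case using discard_par[OF w(1)] by simp
qed

text \<open>Naturality again: swapping two systems before discarding both amounts to swapping two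
  trivial systems afterwards.\<close>

lemma discard_all_to_front:
  "f \<in> set es \<Longrightarrow>
   (discard \<G> (sys f) \<otimes> discard_all sys (remove1 f es)) \<cdot> to_front \<G> sys f es = discard_all sys es"
proof (induction es)
  case (Cons e es)
  show ?case
  proof (cases "e = f")
    case True
    then show ?thesis using seq_ident(1)[OF par_hom[OF discard_hom discard_all_hom]] by auto
  next
    case False
    then have f: "f \<in> set es" using Cons.prems by simp
    let ?d = "\<lambda>x. discard \<G> (sys x)" and ?r = "remove1 f es"
    have dd: "?d x \<otimes> ?d y \<in> hom \<G> (sys x \<odot> sys y) \<I>" for x y
      using par_hom[OF discard_hom discard_hom, of "sys x" "sys y"] by simp
    have ddd: "?d x \<otimes> ?d y \<otimes> discard_all sys ?r \<in> hom \<G> (sys x \<odot> sys y \<odot> composite \<G> sys ?r) \<I>"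
        for x y
      using par_hom[OF discard_hom par_hom[OF discard_hom discard_all_hom]] by simp
    have as: "(?d x \<otimes> ?d y) \<otimes> discard_all sys ?r = ?d x \<otimes> ?d y \<otimes> discard_all sys ?r" for x y
      by (rule par_assoc[OF discard_hom discard_hom discard_all_hom])
    have sX: "swap \<G> P Q \<otimes> ident \<G> X \<in> hom \<G> (P \<odot> Q \<odot> X) (Q \<odot> P \<odot> X)" for P Q X
      using par_hom[OF swap_hom ident_hom, of P Q X] by (simp add: compose_assoc)
    note tf = to_front_hom[OF f, of sys]
    have "(?d f \<otimes> ?d e) \<cdot> swap \<G> (sys e) (sys f) = ?d e \<otimes> ?d f"
      using swap_natural[OF discard_hom[of "sys e"] discard_hom[of "sys f"]] swap_triv(1)[of \<I>]
          seq_ident(2)[OF dd]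
      by simp
    then have 1: "(?d f \<otimes> ?d e \<otimes> discard_all sys ?r) \<cdot> (swap \<G> (sys e) (sys f) \<otimes> ident \<G>
        (composite \<G> sys ?r))
        = ?d e \<otimes> ?d f \<otimes> discard_all sys ?r"
      using interchange[OF dd[of f e] swap_hom discard_all_hom[of sys ?r] ident_hom]
        seq_ident(1)[OF discard_all_hom[of sys ?r]]
      by (simp add: as)
    have "(?d e \<otimes> ?d f \<otimes> discard_all sys ?r) \<cdot> (ident \<G> (sys e) \<otimes> to_front \<G> sys f es) = ?d e \<otimes>
        discard_all sys es"
      using interchange[OF discard_hom ident_hom par_hom[OF discard_hom discard_all_hom] tf]
        seq_ident(1)[OF discard_hom] Cons.IH[OF f] by simp
    then show ?thesis
      using False seq_assoc[OF ddd[of f e] sX par_hom[OF ident_hom tf]] 1 by simp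
  qed
qed simp

lemma discard_all_rearrange:
  "mset fs = mset es \<Longrightarrow> discard_all sys fs \<cdot> rearrange \<G> sys fs es = discard_all sys es"
proof (induction fs arbitrary: es)
  case Nil
  then show ?case using seq_ident[OF ident_hom] by simp
next
  case (Cons f fs)
  note f = mset_remove1_head[OF Cons.prems]
  note R = rearrange_hom[OF f(2), of sys]
  note h = par_hom[OF discard_hom discard_all_hom] par_hom[OF ident_hom R] to_front_hom[OF f(1),
      of sys]
  have "(discard \<G> (sys f) \<otimes> discard_all sys fs) \<cdot> (ident \<G> (sys f) \<otimes> rearrange \<G> sys fs (remove1
      f es))
      = discard \<G> (sys f) \<otimes> discard_all sys (remove1 f es)"
    using interchange[OF discard_hom ident_hom discard_all_hom R] seq_ident(1)[OF discard_hom]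
    by (simp add: Cons.IH[OF f(2)])
  then show ?case
    using seq_assoc[OF h, symmetric] discard_all_to_front[OF f(1), of sys] by simp
qed

text \<open>The normalization condition of a test at the state prepared by \<open>u\<close>, with
  \<open>discard_all\<close> traded for \<open>discard\<close> at both ends, which is legitimate
  because only states occur.\<close>

lemma sum_scalar_test:
  assumes "test \<G> (composite \<G> sys es) (composite \<G> sys fs) X T" "u \<in> hom \<G> \<I> (composite \<G> sys es)"
  shows "(\<Sum>x\<in>X. scalar \<G> (discard_all sys fs \<cdot> (T x \<cdot> u))) = scalar \<G> (discard_all sys es \<cdot> u)"
proof -
  have T: "T x \<in> hom \<G> (composite \<G> sys es) (composite \<G> sys fs)" if "x \<in> X" for x
    using assms(1) that by (auto simp: test_def)
  define \<omega> where "\<omega> = act \<G> u \<one>"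
  have w: "\<omega> \<in> states \<G> (composite \<G> sys es)"
    unfolding \<omega>_def by (rule act_states[OF assms(2) one_states])
  have 1: "act \<G> (discard_all sys fs \<cdot> (T x \<cdot> u)) \<one> = act \<G> (discard \<G> (composite \<G> sys fs)) (act
      \<G> (T x) \<omega>)"
    if "x \<in> X" for x
    using act_seq[OF discard_all_hom seq_hom[OF T[OF that] assms(2)] one_space]
      act_seq[OF T[OF that] assms(2) one_space] act_discard_all[OF act_states[OF T[OF that] w]]
    by (simp add: \<omega>_def)
  have "(\<Sum>x\<in>X. scalar \<G> (discard_all sys fs \<cdot> (T x \<cdot> u))) *\<^sub>R \<one> =
      (\<Sum>x\<in>X. act \<G> (discard_all sys fs \<cdot> (T x \<cdot> u)) \<one>)"
    unfolding scaleR_sum_left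
    using scalar(1)[OF seq_hom[OF discard_all_hom seq_hom[OF T assms(2)]]] by (intro sum.cong) auto
  also have "\<dots> = act \<G> (discard \<G> (composite \<G> sys fs)) (\<Sum>x\<in>X. act \<G> (T x) \<omega>)"
    by (simp add: 1 linear_sum[OF act_linear[OF discard_hom]])
  also have "\<dots> = act \<G> (discard \<G> (composite \<G> sys es)) \<omega>"
    using assms(1) subsetD[OF states_space w] by (simp add: test_def)
  also have "\<dots> = act \<G> (discard_all sys es \<cdot> u) \<one>"
    using act_seq[OF discard_all_hom assms(2) one_space] act_discard_all[OF w] by (simp add: \<omega>_def)
  finally have "act \<G> (discard_all sys es \<cdot> u) \<one> = (\<Sum>x\<in>X. scalar \<G> (discard_all sys fs \<cdot> (T x \<cdot>
      u))) *\<^sub>R \<one>"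
    by simp
  from scalar_eqI[OF this] show ?thesis by simp
qed

end

section \<open>Partial circuits and the removal of a vertex\<close>

text \<open>Used in \<open>sum_val\<close> to run the vertices after the removed one on the wires
  that bypass it.\<close>

lemma runnable_subset:
  "\<lbrakk>runnable G vs ws es; \<forall>w\<in>set ws. set (in_wires G vs w) \<inter> K = {}; set fs \<subseteq> set es; set es - K \<subseteq>
      set fs\<rbrakk> \<Longrightarrow>
   runnable G vs ws fs"
proof (induction ws arbitrary: es fs)
  case (Cons w ws)
  have sub: "set (next_wires G vs w fs) \<subseteq> set (next_wires G vs w es)"
    "set (next_wires G vs w es) - K \<subseteq> set (next_wires G vs w fs)"
    using Cons.prems(3,4) unfolding next_wires_def rest_wires_def set_append set_filter by blast+
  have "runnable G vs ws (next_wires G vs w es)" "\<forall>w\<in>set ws. set (in_wires G vs w) \<inter> K = {}"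
    using Cons.prems(1,2) by simp_all
  from Cons.IH[OF this sub] have "runnable G vs ws (next_wires G vs w fs)" .
  moreover have "set (in_wires G vs w) \<subseteq> set fs" "w \<notin> fst ` set fs"
    using Cons.prems by auto
  ultimately show ?case by simp
qed simp

text \<open>A wire that nobody consumes stays open, so the check made when \<open>w\<close> is
  reached still sees it.\<close>

lemma runnable_fresh:
  "\<lbrakk>runnable G vs ws es; \<forall>w\<in>set ws. set (in_wires G vs w) \<inter> K = {}; K \<subseteq> set es; w \<in> set ws\<rbrakk> \<Longrightarrow>
   w \<notin> fst ` K"
proof (induction ws arbitrary: es)
  case (Cons v ws)
  have "set (in_wires G vs v) \<inter> K = {}" using Cons.prems(2) by simp
  then have K: "K \<subseteq> set (next_wires G vs v es)"
    using Cons.prems(3) unfolding next_wires_def rest_wires_def set_append set_filter by blast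
  show ?case
  proof (cases "w = v")
    case True
    then show ?thesis using Cons.prems(1,3) by auto
  next
    case False
    then show ?thesis using Cons.IH[OF _ _ K] Cons.prems by simp
  qed
qed simp

locale gpt_circuits = gpt \<G> + circuits \<G> G vs sys
  for \<G> :: "('s, 't, 'v :: real_vector) gpt" (structure)
    and G :: "('n, 'a) causal_dag" and vs sys
begin

definition close :: "('n \<times> 'n) list \<times> 't \<Rightarrow> real" where
  "close s = scalar \<G> (discard_all sys (fst s) \<cdot> snd s)"

text \<open>The value of the partial circuit on \<open>ws\<close> alone: no other vertex is run, and
  every output that remains open is discarded.\<close>

definition val :: "('n \<Rightarrow> 't) \<Rightarrow> 'n list \<Rightarrow> real" where
  "val \<tau> ws = close (foldl (step \<tau>) ([], ident \<G> \<I>) ws)"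

lemma close_same_state:
  assumes "same_state s s'"
  shows "close s' = close s"
proof -
  have m: "mset (fst s') = mset (fst s)" and t: "snd s \<in> hom \<G> \<I> (csys (fst s))"
    and e: "snd s' = reo (fst s') (fst s) \<cdot> snd s"
    using assms by (auto simp: same_state_def)
  show ?thesis
    unfolding close_def e
    using seq_assoc[OF discard_all_hom rearrange_hom[OF m, of sys] t] discard_all_rearrange[OF m,
        of sys] by simp
qed

lemma same_state_init: "same_state ([], ident \<G> \<I>) ([], ident \<G> \<I>)"
  by (rule same_state_refl) (simp_all add: ident_hom)

lemma foldl_step_hom:
  assumes "runnable G vs ws []" "typed \<tau> (set ws)"
  shows "distinct (fst (foldl (step \<tau>) ([], ident \<G> \<I>) ws))"
    "snd (foldl (step \<tau>) ([], ident \<G> \<I>) ws) \<in> hom \<G> \<I> (csys (fst (foldl (step \<tau>) ([], ident \<G> \<I>)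
        ws)))"
  using same_state_foldl[where \<tau>=\<tau>, OF same_state_init _ assms(2)] assms(1) by (auto simp:
      same_state_def)

lemma val_nonneg:
  assumes "runnable G vs ws []" "typed \<tau> (set ws)"
  shows "0 \<le> val \<tau> ws"
  unfolding val_def close_def
  by (intro scalar(2) seq_hom[OF discard_all_hom] foldl_step_hom assms)

lemma val_Nil: "val \<tau> [] = 1"
  using seq_ident[OF ident_hom] by (simp add: val_def close_def scalar_ident)

lemma foldl_step_cong:
  "(\<And>w. w \<in> set ws \<Longrightarrow> \<tau> w = \<tau>' w) \<Longrightarrow> foldl (step \<tau>) s ws = foldl (step \<tau>') s ws"
  by (intro foldl_cong) (auto simp: circuit_step_def)

lemma val_cong: "(\<And>w. w \<in> set ws \<Longrightarrow> \<tau> w = \<tau>' w) \<Longrightarrow> val \<tau> ws = val \<tau>' ws"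
  unfolding val_def by (subst foldl_step_cong[of ws \<tau> \<tau>']) auto

text \<open>Runnability of both sublists from no wires says that neither needs a wire from the
  other, so \<open>foldl_step_product\<close> applies with two trivial factors; discarding and
  scalars respect the resulting product.\<close>

lemma val_product:
  assumes "runnable G vs (filter (\<lambda>v. v \<in> U) ws) []" "runnable G vs (filter (\<lambda>v. v \<notin> U) ws) []"
    and "typed \<tau> (set ws)"
  shows "val \<tau> ws = val \<tau> (filter (\<lambda>v. v \<in> U) ws) * val \<tau> (filter (\<lambda>v. v \<notin> U) ws)"
proof -
  have "same_state ([], ident \<G> \<I>) ([] @ [], ident \<G> \<I> \<otimes> ident \<G> \<I>)"
    using same_state_init par_unit[OF ident_hom] by simp
  from foldl_step_product[where \<tau>=\<tau>, OF this _ _ assms(1,2) _ _ assms(3)] ident_hom[of \<I>]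
  obtain fs1 u1 fs2 u2 where
    1: "foldl (step \<tau>) ([], ident \<G> \<I>) (filter (\<lambda>v. v \<in> U) ws) = (fs1, u1)"
       "foldl (step \<tau>) ([], ident \<G> \<I>) (filter (\<lambda>v. v \<notin> U) ws) = (fs2, u2)"
    and u: "u1 \<in> hom \<G> \<I> (csys fs1)" "u2 \<in> hom \<G> \<I> (csys fs2)"
    and s: "same_state (foldl (step \<tau>) ([], ident \<G> \<I>) ws) (fs1 @ fs2, u1 \<otimes> u2)"
    by auto
  have "discard_all sys (fs1 @ fs2) \<cdot> (u1 \<otimes> u2) = (discard_all sys fs1 \<cdot> u1) \<otimes> (discard_all sys
      fs2 \<cdot> u2)"
    using interchange[OF discard_all_hom u(1) discard_all_hom u(2)] by (simp add:
        discard_all_append)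
  then show ?thesis
    using close_same_state[OF s] scalar_par[OF seq_hom[OF discard_all_hom u(1)] seq_hom[OF
        discard_all_hom u(2)]]
    by (simp add: val_def 1 close_def)
qed

lemma run_op_cong: "(\<And>w. w \<in> set ws \<Longrightarrow> \<tau> w = \<tau>' w) \<Longrightarrow> run_op \<tau> ws es = run_op \<tau>' ws es"
  by (induction ws arbitrary: es) (auto simp: step_op_def)

lemma runnable_append:
  assumes "runnable G vs (us @ ws) []" "typed \<tau> (set us)"
  shows "runnable G vs us []" "runnable G vs ws (fst (foldl (step \<tau>) ([], ident \<G> \<I>) us))"
proof -
  have *: "runnable G vs us (fst s) \<and> runnable G vs ws (fst (foldl (step \<tau>) s us))"
    if "runnable G vs (us @ ws) (fst s)" "typed \<tau> (set us)" for s
    using that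
    by (induction us arbitrary: s) (auto simp: circuit_step_def next_wires_def rest_wires_def
        typed_def Let_def split: prod.splits)
  from *[of "([], ident \<G> \<I>)"] assms
  show "runnable G vs us []" "runnable G vs ws (fst (foldl (step \<tau>) ([], ident \<G> \<I>) us))"
    by auto
qed

text \<open>By \<open>free\<close>, the vertices after \<open>v\<close> touch neither inputs nor
  outputs of \<open>v\<close>. Closed by discarding, they form an effect \<open>K\<close> on the
  wires bypassing \<open>v\<close>. Applied before \<open>v\<close>, it leaves a possibly
  unnormalized state \<open>u\<close> on the inputs of \<open>v\<close>. With \<open>v\<close>
  present, \<open>u\<close> passes through \<open>T x\<close> and is discarded; without
  \<open>v\<close>, it is discarded at once. The claim becomes the normalization of a single
  test.\<close>

lemma sum_val:
  assumes run: "runnable G vs (us @ v # ws) []" "runnable G vs (us @ ws) []"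
    and typed: "typed \<tau> (set (us @ ws))" and v: "v \<notin> set (us @ ws)"
    and free: "\<forall>w\<in>set ws. set (ins w) \<inter> (set (ins v) \<union> set (outs v)) = {}"
    and T: "test \<G> (csys (ins v)) (csys (outs v)) X T"
  shows "(\<Sum>x\<in>X. val (\<tau>(v := T x)) (us @ v # ws)) = val \<tau> (us @ ws)"
proof -
  let ?i = "ident \<G>"
  have tu: "typed \<tau> (set us)" and tw: "typed \<tau> (set ws)" using typed by (auto simp: typed_def)
  define s where "s = foldl (step \<tau>) ([], ?i \<I>) us"
  obtain es t where es: "s = (es, t)" by fastforce
  have d: "distinct es" and t: "t \<in> hom \<G> \<I> (csys es)"
    using foldl_step_hom[where \<tau>=\<tau>, OF runnable_append(1)[where \<tau>=\<tau>, OF run(2) tu] tu]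
    by (simp_all add: es flip: s_def)
  have rv: "runnable G vs (v # ws) es" and rw: "runnable G vs ws es"
    using runnable_append(2)[where \<tau>=\<tau>, OF run(1) tu] runnable_append(2)[where \<tau>=\<tau>, OF run(2) tu]
    by (simp_all add: es flip: s_def)
  then have i: "set (ins v) \<subseteq> set es" and ve: "v \<notin> fst ` set es" and rn:
      "runnable G vs ws (nexts v es)"
    by auto
  define r where "r = rests v es"
  have rr: "runnable G vs ws r"
    using free by (intro runnable_subset[OF rw, of "set (ins v)"]) (auto simp: r_def rest_wires_def)
  have dn: "distinct (nexts v es)" by (rule distinct_nexts[OF d ve])
  have dro: "distinct (r @ outs v)" using dn by (auto simp: next_wires_def r_def)
  have mi: "mset (ins v @ r) = mset es" unfolding r_def by (rule mset_ins_rests[OF d i])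
  then have mi': "mset (r @ ins v) = mset es" by (simp add: add.commute)
  have dri: "distinct (r @ ins v)" using mi' d by (metis mset_eq_imp_distinct_iff)
  \<comment> \<open>The inputs of \<open>v\<close> are placed last, where they are idle wires for
    the run of \<open>ws\<close>.\<close>
  define t' where "t' = reo (r @ ins v) es \<cdot> t"
  have t': "t' \<in> hom \<G> \<I> (csys r \<odot> csys (ins v))"
    unfolding t'_def using seq_hom[OF rearrange_hom[OF mi', of sys] t] by simp
  define K where "K = discard_all sys (run_wires ws r) \<cdot> run_op \<tau> ws r"
  have dr: "distinct r" using dro by simp
  have op: "run_op \<tau> ws r \<in> hom \<G> (csys r) (csys (run_wires ws r))"
    by (rule run_op_hom[OF rr dr tw])
  have K: "K \<in> hom \<G> (csys r) \<I>"
    unfolding K_def by (rule seq_hom[OF discard_all_hom op])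
  have Ki: "K \<otimes> ?i (csys (ins v)) \<in> hom \<G> (csys r \<odot> csys (ins v)) (csys (ins v))"
    using par_hom[OF K ident_hom[of "csys (ins v)"]] by simp
  define u where "u = (K \<otimes> ?i (csys (ins v))) \<cdot> t'"
  have u: "u \<in> hom \<G> \<I> (csys (ins v))"
    unfolding u_def by (rule seq_hom[OF Ki t'])
  have wr: "w \<notin> fst ` set (outs v)" "w \<notin> fst ` set (ins v)" if "w \<in> set ws" for w
  proof -
    show "w \<notin> fst ` set (outs v)" using v that fst_out_wires by fastforce
    show "w \<notin> fst ` set (ins v)"
      using runnable_fresh[OF rw _ i] free that by blast
  qed
  \<comment> \<open>Closing a run with idle wires \<open>fs\<close> means applying \<open>K\<close>
    to the active wires and discarding \<open>fs\<close>; it is used with the inputs of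
    \<open>v\<close> and with its outputs.\<close>
  have close: "close (run_wires ws r @ fs, (run_op \<tau> ws r \<otimes> ?i (csys fs)) \<cdot> x) = 
      scalar \<G> ((K \<otimes> discard_all sys fs) \<cdot> x)" if "x \<in> hom \<G> \<I> (csys r \<odot> csys fs)" for fs x
    using seq_assoc[OF par_hom[OF discard_all_hom discard_all_hom[of sys fs]] par_hom[OF op
        ident_hom] that]
      interchange[OF discard_all_hom op discard_all_hom[of sys fs] ident_hom] seq_ident(1)[OF
          discard_all_hom[of sys fs]]
    by (simp add: close_def discard_all_append K_def)
  have "val \<tau> (us @ ws) = close (foldl (step \<tau>) (es, t) ws)"
    by (simp add: val_def s_def[symmetric] es)
  also have "\<dots> = close (foldl (step \<tau>) (r @ ins v, t') ws)"
  proof -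
    have "same_state (es, t) (r @ ins v, t')"
      using d mi' t by (simp add: same_state_def t'_def)
    from same_state_foldl[where \<tau>=\<tau>, OF this _ tw] rw show ?thesis
      by (simp add: close_same_state)
  qed
  also have "\<dots> = close (run_wires ws r @ ins v, (run_op \<tau> ws r \<otimes> ?i (csys (ins v))) \<cdot> t')"
    using foldl_step_append[OF rr dri tw] t' wr by simp
  also have "\<dots> = scalar \<G> (discard_all sys (ins v) \<cdot> u)"
    unfolding close[OF t'] u_def seq_assoc[OF discard_all_hom Ki t', symmetric]
    using par_slide(2)[OF K discard_all_hom[of sys "ins v"]] by (simp add: par_unit(1)[OF
        discard_all_hom])
  finally have 1: "val \<tau> (us @ ws) = scalar \<G> (discard_all sys (ins v) \<cdot> u)" .
  have 2: "val (\<tau>(v := T x)) (us @ v # ws) = scalar \<G> (discard_all sys (outs v) \<cdot> (T x \<cdot> u))" if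
      x: "x \<in> X" for x
  proof -
    have Tx: "T x \<in> hom \<G> (csys (ins v)) (csys (outs v))" using T x by (auto simp: test_def)
    define \<tau>' where "\<tau>' = \<tau>(v := T x)"
    have \<tau>': "\<tau>' v = T x" "\<And>w. w \<in> set (us @ ws) \<Longrightarrow> \<tau>' w = \<tau> w" using v by (auto simp: \<tau>'_def)
    have tw': "typed \<tau>' (set ws)" using tw \<tau>'(2) by (simp add: typed_def)
    have \<tau>'h: "\<tau>' v \<in> hom \<G> (csys (ins v)) (csys (outs v))" using Tx \<tau>'(1) by simp
    have Tr: "T x \<otimes> ?i (csys r) \<in> hom \<G> (csys (ins v) \<odot> csys r) (csys (outs v) \<odot> csys r)"
      and rT: "?i (csys r) \<otimes> T x \<in> hom \<G> (csys r \<odot> csys (ins v)) (csys r \<odot> csys (outs v))"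
      by (intro par_hom Tx ident_hom)+
    have ro: "reo (ins v @ r) es \<in> hom \<G> (csys es) (csys (ins v) \<odot> csys r)"
      using rearrange_hom[OF mi, of sys] by simp
    have so: "step_op \<tau>' v es \<in> hom \<G> (csys es) (csys (nexts v es))" by (rule step_op_hom[where
        \<tau>=\<tau>' and v=v, OF d i \<tau>'h])
    \<comment> \<open>The transformation stands in front of the bypassing wires, while
      \<open>t'\<close> has them first; a block swap relates the two orders.\<close>
    have sw: "swap \<G> (csys (ins v)) (csys r) \<cdot> reo (ins v @ r) es = reo (r @ ins v) es"
      using rearrange_swap[of "ins v" r sys] dri rearrange_rearrange[of "r @ ins v" "ins v @ r" es
          sys] mi
      by (auto simp: inf_commute)
    have "reo (r @ outs v) (nexts v es) \<cdot> step_op \<tau>' v es =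
        swap \<G> (csys (outs v)) (csys r) \<cdot> (T x \<otimes> ?i (csys r)) \<cdot> reo (ins v @ r) es"
      using rearrange_swap[of "outs v" r sys] dro
      by (auto simp: next_wires_def r_def step_op_def \<tau>'(1) inf_commute)
    also have "\<dots> = (?i (csys r) \<otimes> T x) \<cdot> reo (r @ ins v) es"
      using seq_assoc[OF swap_hom Tr ro] seq_assoc[OF rT swap_hom ro] swap_natural[OF Tx
          ident_hom, of "csys r"] sw
      by simp
    finally have "reo (r @ outs v) (nexts v es) \<cdot> step_op \<tau>' v es \<cdot> t = (?i (csys r) \<otimes> T x) \<cdot> t'"
      using seq_assoc[OF rearrange_hom[of "r @ outs v" "nexts v es" sys] so t]
        seq_assoc[OF rT _ t] rearrange_hom[OF mi', of sys]
      by (simp add: t'_def next_wires_def r_def)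
    then have ss: "same_state (step \<tau>' (es, t) v) (r @ outs v, (?i (csys r) \<otimes> T x) \<cdot> t')"
      unfolding step_eq[where \<tau>=\<tau>' and v=v, OF d i \<tau>'h t] same_state_def
      using dn seq_hom[OF so t] by (simp add: next_wires_def r_def)
    have xt: "(?i (csys r) \<otimes> T x) \<cdot> t' \<in> hom \<G> \<I> (csys r \<odot> csys (outs v))" by (rule seq_hom[OF rT
        t'])
    have "foldl (step \<tau>') ([], ?i \<I>) us = s"
      unfolding s_def using \<tau>'(2) by (intro foldl_step_cong) auto
    then have "val \<tau>' (us @ v # ws) = close (foldl (step \<tau>') (step \<tau>' (es, t) v) ws)"
      by (simp add: val_def es)
    also have "\<dots> = close (foldl (step \<tau>') (r @ outs v, (?i (csys r) \<otimes> T x) \<cdot> t') ws)"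
      using same_state_foldl[where \<tau>=\<tau>', OF ss _ tw'] rn step_eq[where \<tau>=\<tau>' and v=v, OF d i \<tau>'h t]
      by (simp add: close_same_state)
    also have "\<dots> = close (run_wires ws r @ outs v, (run_op \<tau> ws r \<otimes> ?i (csys (outs v))) \<cdot> (?i
        (csys r) \<otimes> T x) \<cdot> t')"
      using foldl_step_append[where \<tau>=\<tau>', OF rr dro tw'] xt wr run_op_cong[of ws \<tau>' \<tau> r] \<tau>'(2) by
          simp
    also have "\<dots> = scalar \<G> ((K \<otimes> discard_all sys (outs v)) \<cdot> (?i (csys r) \<otimes> T x) \<cdot> t')"
      by (rule close[OF xt])
    also have "(K \<otimes> discard_all sys (outs v)) \<cdot> (?i (csys r) \<otimes> T x) \<cdot> t' = (K \<otimes> (discard_all sys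
        (outs v) \<cdot> T x)) \<cdot> t'"
      using seq_assoc[OF par_hom[OF K discard_all_hom] rT t'] interchange[OF K ident_hom
          discard_all_hom Tx] seq_ident(1)[OF K]
      by simp
    \<comment> \<open>\<open>K\<close> and the test act on disjoint wires, so \<open>K\<close> may
      come before the test, which produces \<open>u\<close>.\<close>
    also have "\<dots> = (discard_all sys (outs v) \<cdot> T x) \<cdot> u"
      unfolding u_def seq_assoc[OF seq_hom[OF discard_all_hom Tx] Ki t', symmetric]
      using par_slide(2)[OF K seq_hom[OF discard_all_hom Tx]]
      by (simp add: par_unit(1)[OF seq_hom[OF discard_all_hom Tx]])
    also have "\<dots> = discard_all sys (outs v) \<cdot> (T x \<cdot> u)"
      by (rule seq_assoc[OF discard_all_hom Tx u])
    finally show ?thesis unfolding \<tau>'_def .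
  qed
  show ?thesis
    using sum_scalar_test[OF T u] by (simp add: 1 2)
qed

end


section \<open>Active paths\<close>

text \<open>The end vertex may lie in \<open>C\<close>, because only inner vertices can block a
  path.\<close>

definition active_to :: "('n \<times> 'n) set \<Rightarrow> 'n set \<Rightarrow> 'n set \<Rightarrow> 'n \<Rightarrow> bool" where
  "active_to E A C v \<longleftrightarrow> (\<exists>xs. dag_path E xs \<and> hd xs \<in> A \<and> last xs = v \<and> \<not> blocked E C xs)"

lemma dag_path_take:
  assumes "dag_path E xs" "0 < n"
  shows "dag_path E (take n xs)"
  using assms by (auto simp: dag_path_def)

lemma blocked_take:
  assumes "blocked E C (take n xs)"
  shows "blocked E C xs"
proof -
  obtain i where i: "0 < i" "Suc i < length (take n xs)"
    "if collider E (take n xs) i then \<forall>d. (take n xs ! i, d) \<in> E\<^sup>* \<longrightarrow> d \<notin> C else take n xs ! i \<in> C"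
    using assms unfolding blocked_def by blast
  then have "collider E (take n xs) i = collider E xs i" by (auto simp: collider_def)
  then show ?thesis unfolding blocked_def using i by (intro exI[of _ i]) auto
qed

lemma active_to_on_path:
  assumes "dag_path E xs" "hd xs \<in> A" "\<not> blocked E C xs" "v \<in> set xs"
  shows "active_to E A C v"
proof -
  obtain k where k: "k < length xs" "xs ! k = v" using assms(4) by (metis in_set_conv_nth)
  have "last (take (Suc k) xs) = v" using k by (simp add: take_Suc_conv_app_nth)
  moreover have "hd (take (Suc k) xs) \<in> A" using assms(2) by simp
  ultimately show ?thesis
    unfolding active_to_def using dag_path_take[OF assms(1)] blocked_take assms(3) by blast
qed

lemma dag_path_snoc:
  assumes "dag_path E xs" "v \<notin> set xs" "(last xs, v) \<in> E \<or> (v, last xs) \<in> E"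
  shows "dag_path E (xs @ [v])"
  unfolding dag_path_def
proof (intro conjI allI impI)
  fix i assume i: "Suc i < length (xs @ [v])"
  show "((xs @ [v]) ! i, (xs @ [v]) ! Suc i) \<in> E \<or> ((xs @ [v]) ! Suc i, (xs @ [v]) ! i) \<in> E"
  proof (cases "Suc i < length xs")
    case True
    then show ?thesis using assms(1) by (auto simp: dag_path_def nth_append)
  next
    case False
    then have "i = length xs - 1" "i < length xs" "xs \<noteq> []" "Suc i = length xs"
      using i assms(1) by (auto simp: dag_path_def)
    then show ?thesis using assms(3) by (auto simp: nth_append last_conv_nth)
  qed
qed (use assms in \<open>auto simp: dag_path_def\<close>)

text \<open>The old end vertex is the only possible new inner vertex. Its predecessor is not
  determined by the statement, hence the quantification over \<open>u\<close> in
  \<open>step\<close>.\<close>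

lemma not_blocked_snoc:
  assumes path: "dag_path E xs" and nb: "\<not> blocked E C xs"
    and step: "\<And>u. \<lbrakk>(u, last xs) \<in> E \<or> (last xs, u) \<in> E; u \<in> set xs\<rbrakk> \<Longrightarrow>
      if (u, last xs) \<in> E \<and> (v, last xs) \<in> E then \<exists>d\<in>C. (last xs, d) \<in> E\<^sup>* else last xs \<notin> C"
  shows "\<not> blocked E C (xs @ [v])"
proof
  assume "blocked E C (xs @ [v])"
  then obtain i where i: "0 < i" "Suc i < length (xs @ [v])"
    "if collider E (xs @ [v]) i then \<forall>d. ((xs @ [v]) ! i, d) \<in> E\<^sup>* \<longrightarrow> d \<notin> C else (xs @ [v]) ! i \<in> C"
    unfolding blocked_def by blast
  show False
  proof (cases "Suc i < length xs")
    case True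
    then have "collider E (xs @ [v]) i = collider E xs i" by (auto simp: collider_def nth_append)
    then have "blocked E C xs"
      unfolding blocked_def using i True by (intro exI[of _ i]) (auto simp: nth_append)
    then show False using nb by simp
  next
    case False
    then have l: "i = length xs - 1" "i < length xs" "xs \<noteq> []" "Suc i = length xs" using i by auto
    then have n: "(xs @ [v]) ! i = last xs" "(xs @ [v]) ! Suc i = v"
        "(xs @ [v]) ! (i - 1) = xs ! (i - 1)"
      by (auto simp: nth_append last_conv_nth)
    have "(xs ! (i - 1), xs ! i) \<in> E \<or> (xs ! i, xs ! (i - 1)) \<in> E"
      using path i(1) l(2) unfolding dag_path_def by (metis Suc_diff_1)
    moreover have "xs ! i = last xs" using l by (simp add: last_conv_nth)
    moreover have "xs ! (i - 1) \<in> set xs" using l by simp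
    ultimately show False
      using step[of "xs ! (i - 1)"] i(3) n by (auto simp: collider_def split: if_splits)
  qed
qed

text \<open>Paths have distinct vertices. If \<open>v\<close> already occurs, the prefix ending
  there is taken instead of the extension.\<close>

lemma active_to_snoc:
  assumes path: "dag_path E xs" "hd xs \<in> A" "\<not> blocked E C xs" and e:
      "(last xs, v) \<in> E \<or> (v, last xs) \<in> E"
    and step: "\<And>u. \<lbrakk>(u, last xs) \<in> E \<or> (last xs, u) \<in> E; u \<in> set xs\<rbrakk> \<Longrightarrow>
      if (u, last xs) \<in> E \<and> (v, last xs) \<in> E then \<exists>d\<in>C. (last xs, d) \<in> E\<^sup>* else last xs \<notin> C"
  shows "active_to E A C v"
proof (cases "v \<in> set xs")
  case True
  then show ?thesis using active_to_on_path[OF path] by blast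
next
  case False
  have "hd (xs @ [v]) \<in> A" using path by (auto simp: dag_path_def)
  then show ?thesis
    unfolding active_to_def
    using dag_path_snoc[OF path(1) False e] not_blocked_snoc[OF path(1,3) step] by (intro exI[of _
        "xs @ [v]"]) auto
qed

text \<open>Leaving \<open>u\<close> along an outgoing edge keeps \<open>u\<close> from being a
  collider, and \<open>u\<close> is outside \<open>C\<close>.\<close>

lemma active_to_child:
  assumes "acyclic E" "active_to E A C u" "u \<notin> C" "(u, v) \<in> E"
  shows "active_to E A C v"
proof -
  have "(v, u) \<notin> E" using assms(1,4) unfolding acyclic_def by (meson r_into_trancl trancl_trans)
  then show ?thesis
    using assms unfolding active_to_def[of E A C u] by (auto intro!: active_to_snoc)
qed

lemma active_to_descendant:
  assumes "acyclic E" "(u, v) \<in> E\<^sup>*" "active_to E A C u" "\<And>d. (u, d) \<in> E\<^sup>* \<Longrightarrow> d \<notin> C"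
  shows "active_to E A C v"
  using assms(2,3,4)
proof (induction rule: converse_rtrancl_induct)
  case (step u w)
  then have "active_to E A C w" using active_to_child[OF assms(1), of A C u w] by blast
  then show ?case using step by (meson converse_rtrancl_into_rtrancl)
qed

text \<open>Treats the extension at which an old path into \<open>u\<close> could become blocked,
  with \<open>u\<close> a collider that has no descendant in \<open>C\<close>. The old path is given
  up: a directed path from \<open>u\<close> to \<open>a\<close>, read backwards and continued to
  \<open>v\<close>, has no collider and avoids \<open>C\<close> at its inner vertices.\<close>

lemma active_to_ancestor:
  assumes "acyclic E" "(u, a) \<in> E\<^sup>*" "a \<in> A" "\<And>d. (u, d) \<in> E\<^sup>* \<Longrightarrow> d \<notin> C" "(v, u) \<in> E"
  shows "active_to E A C v"
proof -
  have snoc: "dag_path E (xs @ [v]) \<and> \<not> blocked E C (xs @ [v])"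
    if xs: "dag_path E xs" "last xs = w" "\<not> blocked E C xs" "\<forall>y\<in>set xs. (w, y) \<in> E\<^sup>*"
      and vw: "(v, w) \<in> E" "w \<notin> C" for xs v w
  proof
    \<comment> \<open>All vertices of the path descend from \<open>w\<close>, so by acyclicity
      \<open>v\<close> is new and no vertex of the path points to \<open>w\<close>.\<close>
    have "(v, y) \<in> E\<^sup>+" if "y \<in> set xs" for y
      using xs(4) that vw(1) by (meson rtrancl_into_trancl2)
    then have "v \<notin> set xs" using assms(1) unfolding acyclic_def by blast
    then show "dag_path E (xs @ [v])" using dag_path_snoc[OF xs(1)] vw(1) xs(2) by blast
    have "(y, w) \<notin> E" if "y \<in> set xs" for y
      using xs(4) that assms(1) unfolding acyclic_def by (meson rtrancl_into_trancl1)
    then show "\<not> blocked E C (xs @ [v])"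
      using xs(2) vw by (intro not_blocked_snoc[OF xs(1,3)]) auto
  qed
  have "\<exists>xs. dag_path E xs \<and> hd xs \<in> A \<and> last xs = u \<and> \<not> blocked E C xs \<and> (\<forall>y\<in>set xs. (u, y) \<in> E\<^sup>*)"
    using assms(2,4)
  proof (induction rule: converse_rtrancl_induct)
    case base
    show ?case
      using assms(3) by (intro exI[of _ "[a]"]) (auto simp: dag_path_def blocked_def)
  next
    case (step v w)
    have C: "d \<notin> C" if "(w, d) \<in> E\<^sup>*" for d using that step.hyps(1) step.prems by (meson
        converse_rtrancl_into_rtrancl)
    from step.IH[OF C] obtain xs where xs: "dag_path E xs" "hd xs \<in> A" "last xs = w"
        "\<not> blocked E C xs"
      "\<forall>y\<in>set xs. (w, y) \<in> E\<^sup>*" by blast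
    have "\<forall>y\<in>set (xs @ [v]). (v, y) \<in> E\<^sup>*"
      using xs(5) step.hyps(1) by (auto intro: converse_rtrancl_into_rtrancl)
    moreover have "hd (xs @ [v]) \<in> A" using xs(1,2) by (auto simp: dag_path_def)
    ultimately show ?case
      using snoc[OF xs(1,3,4,5) step.hyps(1) C] by (intro exI[of _ "xs @ [v]"]) auto
  qed
  then obtain xs where xs: "dag_path E xs" "hd xs \<in> A" "last xs = u" "\<not> blocked E C xs"
    "\<forall>y\<in>set xs. (u, y) \<in> E\<^sup>*" by blast
  have "hd (xs @ [v]) \<in> A" using xs(1,2) by (auto simp: dag_path_def)
  then show ?thesis
    unfolding active_to_def using snoc[OF xs(1,3,4,5) assms(5) assms(4)] by (intro exI[of _
        "xs @ [v]"]) auto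
qed

text \<open>Moralization is trivial here: every vertex of \<open>C\<close> is a source, where paths are cut, or a sink,
  which can only be an inner vertex of a path as a collider.\<close>

lemma d_separated_component:
  assumes "acyclic E" "d_separated E A B C" "A \<inter> C = {}"
    and C: "\<And>c. c \<in> C \<Longrightarrow> (\<forall>u. (u, c) \<notin> E) \<or> (\<forall>y. (c, y) \<notin> E)"
    and N: "N = {v. \<exists>d\<in>A \<union> B \<union> C. (v, d) \<in> E\<^sup>*}"
    and M: "M = N - {c \<in> C. \<forall>u. (u, c) \<notin> E}"
    and reach: "(a, v) \<in> ((E \<union> E\<inverse>) \<inter> M \<times> M)\<^sup>*" "a \<in> A"
  shows "v \<notin> B"
proof -
  have noB: "\<not> active_to E A C b" if "b \<in> B" for b
    using assms(2) that by (auto simp: d_separated_def active_to_def)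
  from reach have "active_to E A C v"
  proof (induction rule: rtrancl_induct)
    case base
    then show ?case unfolding active_to_def by (intro exI[of _ "[a]"]) (auto simp: dag_path_def
        blocked_def)
  next
    case (step u v)
    then obtain xs where xs: "dag_path E xs" "hd xs \<in> A" "last xs = u" "\<not> blocked E C xs"
      unfolding active_to_def by blast
    have u: "u \<in> M" "v \<in> M" and e: "(u, v) \<in> E \<or> (v, u) \<in> E" using step.hyps by auto
    \<comment> \<open>Sources in \<open>C\<close> were removed from \<open>M\<close>, so a vertex of
      \<open>C\<close> still met on the way is a sink.\<close>
    have sink: "(u, y) \<notin> E" if "u \<in> C" for y using C[OF that] u(1) that M by blast
    show ?case
    proof (cases "(u, v) \<in> E \<or> (\<exists>d\<in>C. (u, d) \<in> E\<^sup>*)")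
      case True
      then have "if (w, u) \<in> E \<and> (v, u) \<in> E then \<exists>d\<in>C. (u, d) \<in> E\<^sup>* else u \<notin> C"
        if "(w, u) \<in> E \<or> (u, w) \<in> E" for w
      proof -
        have "(v, u) \<notin> E" if "(u, v) \<in> E"
          using assms(1) that unfolding acyclic_def by (meson r_into_trancl trancl_trans)
        then show ?thesis using True that sink e by auto
      qed
      then show ?thesis using e xs by (intro active_to_snoc[OF xs(1,2,4)]) auto
    next
      case False
      then have vu: "(v, u) \<in> E" and noC: "\<And>d. (u, d) \<in> E\<^sup>* \<Longrightarrow> d \<notin> C" using e by auto
      \<comment> \<open>As a member of \<open>N\<close> without descendants in \<open>C\<close>, the
        vertex \<open>u\<close> is an ancestor of \<open>A\<close> or of \<open>B\<close>.\<close>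
      obtain d where d: "d \<in> A \<union> B" "(u, d) \<in> E\<^sup>*" using u(1) noC M N by blast
      show ?thesis
      proof (cases "d \<in> B")
        case True
        \<comment> \<open>A directed continuation from \<open>u\<close> to \<open>B\<close> would
          give an active path from \<open>A\<close> to \<open>B\<close>, contrary to
          separation.\<close>
        then show ?thesis using active_to_descendant[OF assms(1) d(2) _ noC] step noB by blast
      next
        case False
        then have "d \<in> A" using d by simp
        then show ?thesis using active_to_ancestor[OF assms(1) d(2) _ noC vu] by blast
      qed
    qed
  qed
  then show ?thesis using noB by blast
qed


section \<open>Markov property from factorizing weights\<close>

definition ancestral :: "('n, 'a) causal_dag \<Rightarrow> 'n set \<Rightarrow> bool" where
  "ancestral H M \<longleftrightarrow> M \<subseteq> obs H \<union> lat H \<and> (\<forall>u v. (u, v) \<in> edges H \<and> v \<in> M \<longrightarrow> u \<in> M)"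

text \<open>These are the sets that can be run as a circuit of their own: systems come from latent
  parents, while observed parents enter only as classical values.\<close>

definition latent_closed :: "('n, 'a) causal_dag \<Rightarrow> 'n set \<Rightarrow> bool" where
  "latent_closed H M \<longleftrightarrow>
     M \<subseteq> obs H \<union> lat H \<and> (\<forall>u v. (u, v) \<in> edges H \<and> v \<in> M \<and> u \<in> lat H \<longrightarrow> u \<in> M)"

text \<open>The coordinates that a circuit on \<open>M\<close> reads: outcomes in \<open>M\<close>
  and classical inputs to vertices in \<open>M\<close>.\<close>

definition relevant :: "('n, 'a) causal_dag \<Rightarrow> 'n set \<Rightarrow> 'n set" where
  "relevant H M = {v \<in> obs H. v \<in> M \<or> (\<exists>y\<in>M. (v, y) \<in> edges H)}"

lemma relevant_ancestral: "ancestral H M \<Longrightarrow> relevant H M = M \<inter> obs H"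
  by (auto simp: ancestral_def relevant_def)

lemma sum_PiE_insert:
  fixes F :: "'n \<Rightarrow> 'a set" and f :: "('n \<Rightarrow> 'a) \<Rightarrow> real"
  assumes "n \<notin> D" "n \<notin> T"
  shows "(\<Sum>y\<in>{y \<in> PiE (insert n D) F. \<forall>v\<in>T. y v = x v}. f y) =
    (\<Sum>y\<in>{y \<in> PiE D F. \<forall>v\<in>T. y v = x v}. \<Sum>a\<in>F n. f (y(n := a)))"
proof -
  let ?h = "\<lambda>(a, y). y(n := a)" and ?S = "{y \<in> PiE D F. \<forall>v\<in>T. y v = x v}"
  have *: "{y \<in> PiE (insert n D) F. \<forall>v\<in>T. y v = x v} = ?h ` (F n \<times> ?S)"
    unfolding PiE_insert_eq using assms(2) by (auto simp: image_iff) (metis fun_upd_apply)+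
  have inj: "inj_on ?h (F n \<times> ?S)"
    by (rule inj_on_subset[OF inj_combinator[OF assms(1), of F]]) auto
  show ?thesis
    unfolding * sum.reindex[OF inj]
    by (subst sum.swap) (simp add: sum.cartesian_product case_prod_unfold)
qed

text \<open>Here \<open>w M x\<close> stands for the probability of the outcomes in \<open>M\<close>
  when observed inputs from outside \<open>M\<close> are held at their values in \<open>x\<close>.
  On ancestral sets it becomes a marginal by \<open>marginal_joint\<close>; on a
  \<open>latent_closed\<close> set it is in general only a conditional weight. The product law
  tolerates edges from observed vertices between the two sets.\<close>

locale weighted_dag =
  fixes H :: "('n, 'a) causal_dag" and w :: "'n set \<Rightarrow> ('n \<Rightarrow> 'a) \<Rightarrow> real"
  assumes dag: "causal_dag H"
    and source_or_sink: "c \<in> obs H \<Longrightarrow> (\<forall>u. (u, c) \<notin> edges H) \<or> (\<forall>y. (c, y) \<notin> edges H)"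
    and weight_nonneg: "x \<in> configs H (obs H) \<Longrightarrow> 0 \<le> w (obs H \<union> lat H) x"
    and weight_empty: "w {} x = 1"
    and weight_local: "\<lbrakk>latent_closed H M; \<And>v. v \<in> relevant H M \<Longrightarrow> x v = y v\<rbrakk> \<Longrightarrow> w M x = w M y"
    and weight_obs: "\<lbrakk>ancestral H M; n \<in> M; n \<in> obs H; \<And>y. y \<in> M \<Longrightarrow> (n, y) \<notin> edges H;
        \<And>v. \<lbrakk>v \<in> M; v \<in> obs H; v \<noteq> n\<rbrakk> \<Longrightarrow> x v \<in> alph H v\<rbrakk> \<Longrightarrow>
      (\<Sum>a\<in>alph H n. w M (x(n := a))) = w (M - {n}) x"
    and weight_lat: "\<lbrakk>ancestral H M; n \<in> M; n \<in> lat H; \<And>y. y \<in> M \<Longrightarrow> (n, y) \<notin> edges H;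
        \<And>v. \<lbrakk>v \<in> M; v \<in> obs H\<rbrakk> \<Longrightarrow> x v \<in> alph H v\<rbrakk> \<Longrightarrow> w M x = w (M - {n}) x"
    and weight_product: "\<lbrakk>latent_closed H M; latent_closed H L; M \<inter> L = {};
        \<And>v. v \<in> relevant H (M \<union> L) \<Longrightarrow> x v \<in> alph H v\<rbrakk> \<Longrightarrow> w (M \<union> L) x = w M x * w L x"
begin

definition joint :: "('n \<Rightarrow> 'a) \<Rightarrow> real" where
  "joint = (\<lambda>x\<in>configs H (obs H). w (obs H \<union> lat H) x)"

text \<open>Vertices outside an ancestral set can be summed out from the bottom up, each being
  childless when its turn comes. The induction runs the other way, from \<open>N\<close> to a set
  with one more vertex.\<close>

lemma marginal_joint:
  "\<lbrakk>ancestral H N; T \<subseteq> N \<inter> obs H\<rbrakk> \<Longrightarrow>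
   marginal H joint T x = (\<Sum>y\<in>{y \<in> configs H (N \<inter> obs H). \<forall>v\<in>T. y v = x v}. w N y)"
proof (induction "card (obs H \<union> lat H - N)" arbitrary: N rule: less_induct)
  case less
  let ?V = "obs H \<union> lat H"
  have fin: "finite ?V" and ac: "acyclic (edges H)" and E: "edges H \<subseteq> ?V \<times> ?V" and dis:
      "obs H \<inter> lat H = {}"
    using dag by (auto simp: causal_dag_def)
  show ?case
  proof (cases "N = ?V")
    case True
    then have "N \<inter> obs H = obs H" by auto
    then show ?thesis unfolding marginal_def joint_def True by (intro sum.cong) auto
  next
    case False
    have "finite (edges H)" using E fin by (meson finite_SigmaI finite_subset)
    \<comment> \<open>A minimal vertex outside \<open>N\<close> has all parents in \<open>N\<close>,
      so adding it keeps the set ancestral; it has no child there because \<open>N\<close> is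
      ancestral.\<close>
    then have "wf (edges H)" using ac by (simp add: finite_acyclic_wf)
    moreover obtain n0 where "n0 \<in> ?V - N" using False less.prems(1) by (auto simp: ancestral_def)
    ultimately obtain n where n: "n \<in> ?V - N" "\<And>u. (u, n) \<in> edges H \<Longrightarrow> u \<notin> ?V - N"
      using wfE_min by metis
    have anc: "ancestral H (insert n N)"
      using less.prems(1) n E unfolding ancestral_def by blast
    have "card (?V - insert n N) < card (?V - N)"
      using n(1) fin by (intro psubset_card_mono) auto
    then have IH: "marginal H joint T x =
        (\<Sum>y\<in>{y \<in> configs H (insert n N \<inter> obs H). \<forall>v\<in>T. y v = x v}. w (insert n N) y)"
      using less.hyps[OF _ anc] less.prems(2) by auto
    have nc: "(n, y) \<notin> edges H" if "y \<in> insert n N" for y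
    proof
      assume "(n, y) \<in> edges H"
      moreover then have "y \<noteq> n" using ac unfolding acyclic_def by blast
      ultimately show False using that less.prems(1) n(1) unfolding ancestral_def by blast
    qed
    have rm: "insert n N - {n} = N" using n(1) by auto
    show ?thesis
    proof (cases "n \<in> obs H")
      case True
      have D: "insert n N \<inter> obs H = insert n (N \<inter> obs H)" "n \<notin> N \<inter> obs H" "n \<notin> T"
        using True n(1) less.prems(2) by auto
      have "(\<Sum>a\<in>alph H n. w (insert n N) (y(n := a))) = w N y" if "y \<in> configs H (N \<inter> obs H)" for y
        using weight_obs[OF anc _ True nc, of y] that by (auto simp: rm configs_def PiE_iff)
      then show ?thesis
        unfolding IH D(1) configs_def sum_PiE_insert[OF D(2,3)] by (intro sum.cong) auto
    next
      case False
      then have D: "insert n N \<inter> obs H = N \<inter> obs H" and l: "n \<in> lat H" using n(1) by auto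
      have "w (insert n N) y = w N y" if "y \<in> configs H (N \<inter> obs H)" for y
        using weight_lat[OF anc _ l nc, of y] that D by (auto simp: rm configs_def PiE_iff)
      then show ?thesis unfolding IH D(1) by (intro sum.cong) auto
    qed
  qed
qed

text \<open>Normalization is the marginal over no variables, computed with the empty ancestral
  set.\<close>

lemma joint_distribution: "joint \<in> distributions H"
proof -
  have "(\<Sum>x\<in>configs H (obs H). joint x) = 1"
    using marginal_joint[of "{}" "{}"] by (simp add: ancestral_def marginal_def configs_def
        weight_empty)
  then show ?thesis
    using weight_nonneg by (auto simp: distributions_def joint_def)
qed

theorem joint_markov: "joint \<in> markov H"
  unfolding markov_def
proof (intro CollectI conjI allI impI joint_distribution)
  fix A B C
  assume asm: "A \<subseteq> obs H \<and> B \<subseteq> obs H \<and> C \<subseteq> obs H \<and>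
    A \<inter> B = {} \<and> A \<inter> C = {} \<and> B \<inter> C = {} \<and> d_separated (edges H) A B C"
  let ?E = "edges H"
  have ac: "acyclic ?E" and E: "?E \<subseteq> (obs H \<union> lat H) \<times> (obs H \<union> lat H)" and dis:
      "obs H \<inter> lat H = {}"
    using dag by (auto simp: causal_dag_def)
  define N where "N = {v. \<exists>d\<in>A \<union> B \<union> C. (v, d) \<in> ?E\<^sup>*}"
  \<comment> \<open>Removing the sources in \<open>C\<close> cuts the graph. \<open>K\<close> is the
    part connected to \<open>A\<close>; the cut sources themselves fall into \<open>L\<close>,
    together with \<open>B\<close>.\<close>
  define R where "R = {c \<in> C. \<forall>u. (u, c) \<notin> ?E}"
  define K where "K = {v. \<exists>a\<in>A. (a, v) \<in> ((?E \<union> ?E\<inverse>) \<inter> (N - R) \<times> (N - R))\<^sup>*}"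
  define L where "L = N - K"
  have ABC: "A \<union> B \<union> C \<subseteq> N" by (auto simp: N_def)
  have anc: "ancestral H N"
    unfolding ancestral_def
  proof (intro conjI allI impI)
    show "N \<subseteq> obs H \<union> lat H"
      using asm E by (auto simp: N_def elim: converse_rtranclE)
    show "u \<in> N" if "(u, v) \<in> ?E \<and> v \<in> N" for u v
      using that by (auto simp: N_def intro: converse_rtrancl_into_rtrancl)
  qed
  have AK: "A \<subseteq> K" by (auto simp: K_def)
  have KM: "K \<subseteq> N - R"
  proof
    fix v assume "v \<in> K"
    then obtain a where a: "a \<in> A" "(a, v) \<in> ((?E \<union> ?E\<inverse>) \<inter> (N - R) \<times> (N - R))\<^sup>*"
      unfolding K_def by blast
    have "a \<in> N - R" using a(1) asm ABC by (auto simp: R_def)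
    with a(2) show "v \<in> N - R" by (auto elim: rtranclE)
  qed
  have src: "(\<forall>u. (u, c) \<notin> ?E) \<or> (\<forall>y. (c, y) \<notin> ?E)" if "c \<in> C" for c
    using that asm source_or_sink by blast
  have "v \<notin> B" if vK: "v \<in> K" for v
  proof -
    obtain a where a: "a \<in> A" "(a, v) \<in> ((?E \<union> ?E\<inverse>) \<inter> (N - R) \<times> (N - R))\<^sup>*"
      using vK unfolding K_def by blast
    show ?thesis
      using asm by (intro d_separated_component[OF ac _ _ src N_def _ a(2,1)]) (auto simp: R_def)
  qed
  then have KB: "K \<inter> B = {}" by blast
  have adj: "v \<in> K \<longleftrightarrow> u \<in> K" if "(u, v) \<in> ?E" "u \<in> N - R" "v \<in> N - R" for u v
    unfolding K_def using that by (auto intro: rtrancl_into_rtrancl)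
  \<comment> \<open>Edges into \<open>K\<close> from outside start in \<open>C\<close>, so the
    outside values that \<open>w K\<close> reads are conditioned on.\<close>
  have up: "u \<in> K \<or> u \<in> C" if "(u, v) \<in> ?E" "v \<in> K" for u v
    using that adj[of u v] anc KM by (auto simp: ancestral_def R_def)
  \<comment> \<open>An edge from \<open>K\<close> into \<open>L\<close> is impossible: its target
    has a parent, hence is not a cut source, and would belong to \<open>K\<close>. So
    \<open>w L\<close> reads no value on \<open>K\<close>.\<close>
  have down: "u \<notin> K" if "(u, v) \<in> ?E" "v \<in> L" for u v
    using that adj[of u v] KM by (auto simp: L_def R_def)
  have NKL: "N = K \<union> L" "K \<inter> L = {}" using KM by (auto simp: L_def)
  have lcK: "latent_closed H K"
    unfolding latent_closed_def using up asm dis KM anc unfolding ancestral_def by blast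
  have lcL: "latent_closed H L"
    unfolding latent_closed_def using down anc unfolding L_def ancestral_def by blast
  have wN: "w N y = w K y * w L y" if "y \<in> configs H (N \<inter> obs H)" for y
    using weight_product[OF lcK lcL NKL(2), of y] that relevant_ancestral[OF anc]
    by (auto simp: NKL(1)[symmetric] configs_def PiE_iff)
  show "cond_indep H joint A B C"
    unfolding cond_indep_def
  proof (intro ballI impI)
    fix x assume pos: "0 < marginal H joint C x"
    define S where "S T = {y \<in> configs H (N \<inter> obs H). \<forall>v\<in>T. y v = x v}" for T
    have m: "marginal H joint T x = (\<Sum>y\<in>S T. w K y * w L y)" if "T \<subseteq> A \<union> B \<union> C" for T
    proof -
      have "T \<subseteq> N \<inter> obs H" using that asm ABC by blast
      from marginal_joint[OF anc this] show ?thesis by (simp add: S_def wN)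
    qed
    define mix where "mix y y' = (\<lambda>v. if v \<in> K then y v else y' v)" for y y' :: "'n \<Rightarrow> 'a"
    have mixS: "mix y y' \<in> S T" if "y \<in> S T1" "y' \<in> S T2" "T \<inter> K \<subseteq> T1" "T - K \<subseteq> T2" for y y' T T1 T2
      using that by (auto simp: S_def mix_def configs_def PiE_iff extensional_def)
    \<comment> \<open>Both configurations agree with \<open>x\<close> on \<open>C\<close>, the only
      place outside \<open>K\<close> that \<open>w K\<close> looks at.\<close>
    have mixK: "w K (mix y y') = w K y" if "y \<in> S T1" "y' \<in> S T2" "C \<subseteq> T1" "C \<subseteq> T2" for y y' T1 T2
    proof (rule weight_local[OF lcK])
      fix v assume "v \<in> relevant H K"
      then have "v \<in> K \<or> v \<in> C" using up by (auto simp: relevant_def)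
      then show "mix y y' v = y v" using that by (auto simp: mix_def S_def subset_iff)
    qed
    have mixL: "w L (mix y y') = w L y'" for y y'
    proof (rule weight_local[OF lcL])
      fix v assume "v \<in> relevant H L"
      then have "v \<notin> K" using down by (auto simp: relevant_def L_def)
      then show "mix y y' v = y' v" by (simp add: mix_def)
    qed
    \<comment> \<open>The exchange is an involution, so it serves as its own inverse in the
      reindexing.\<close>
    have mix2: "mix (mix y y') (mix y' y) = y" for y y' by (auto simp: mix_def)
    let ?f = "\<lambda>(y, y'). (w K y * w L y) * (w K y' * w L y')"
    have "marginal H joint (A \<union> B \<union> C) x * marginal H joint C x = (\<Sum>z\<in>S (A \<union> B \<union> C) \<times> S C. ?f z)"
      by (simp add: m sum_product sum.cartesian_product)
    \<comment> \<open>exchange the coordinates outside \<open>K\<close> between the two configurations\<close>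
    also have "\<dots> = (\<Sum>z\<in>S (A \<union> C) \<times> S (B \<union> C). ?f z)"
    proof (rule sum.reindex_bij_witness[where i = "\<lambda>(y, y'). (mix y y', mix y' y)" and j =
        "\<lambda>(y, y'). (mix y y', mix y' y)"])
      fix z assume "z \<in> S (A \<union> B \<union> C) \<times> S C"
      then obtain y y' where z: "z = (y, y')" "y \<in> S (A \<union> B \<union> C)" "y' \<in> S C" by auto
      have "mix y y' \<in> S (A \<union> C)" by (rule mixS[OF z(2,3)]) (use AK in auto)
      moreover have "mix y' y \<in> S (B \<union> C)" by (rule mixS[OF z(3,2)]) (use KB in auto)
      ultimately show "(case z of (y, y') \<Rightarrow> (mix y y', mix y' y)) \<in> S (A \<union> C) \<times> S (B \<union> C)" by
          (simp add: z)
      show "?f (case z of (y, y') \<Rightarrow> (mix y y', mix y' y)) = ?f z"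
        using mixK[OF z(2,3)] mixK[OF z(3,2)] by (simp add: z mixL Un_upper2)
    next
      fix z assume "z \<in> S (A \<union> C) \<times> S (B \<union> C)"
      then obtain y y' where z: "z = (y, y')" "y \<in> S (A \<union> C)" "y' \<in> S (B \<union> C)" by auto
      have "mix y y' \<in> S (A \<union> B \<union> C)" by (rule mixS[OF z(2,3)]) (use AK KB in auto)
      moreover have "mix y' y \<in> S C" by (rule mixS[OF z(3,2)]) auto
      ultimately show "(case z of (y, y') \<Rightarrow> (mix y y', mix y' y)) \<in> S (A \<union> B \<union> C) \<times> S C" by (simp
          add: z)
    qed (auto simp: mix2)
    also have "\<dots> = marginal H joint (A \<union> C) x * marginal H joint (B \<union> C) x"
      by (subst (1 2) m) (auto simp: sum_product sum.cartesian_product)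
    finally show "marginal H joint (A \<union> B \<union> C) x / marginal H joint C x =
        marginal H joint (A \<union> C) x / marginal H joint C x * (marginal H joint (B \<union> C) x / marginal
            H joint C x)"
      using pos by (simp add: field_simps)
  qed
qed

end


section \<open>The split circuit\<close>

lemma ancestral_latent_closed: "ancestral H M \<Longrightarrow> latent_closed H M"
  by (auto simp: ancestral_def latent_closed_def)

locale gpt_dag = gpt_circuits \<G> G vs sys
  for \<G> :: "('s, 't, 'v :: real_vector) gpt" (structure)
    and G :: "('n, 'a) causal_dag" and vs sys +
  fixes T :: "'n \<Rightarrow> ('n \<Rightarrow> 'a) \<Rightarrow> 'a option \<Rightarrow> 't"
  assumes dag: "causal_dag G" and topological: "topological_order G vs"
    and tests: "\<lbrakk>v \<in> obs G \<union> lat G; y \<in> configs G (parents G v \<inter> obs G)\<rbrakk> \<Longrightarrow>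
      test \<G> (csys (ins v)) (csys (outs v)) (outcomes G v) (T v y)"
begin

lemma edges_subset: "edges G \<subseteq> (obs G \<union> lat G) \<times> (obs G \<union> lat G)"
  and set_vs: "set vs = obs G \<union> lat G"
  and obs_lat: "obs G \<inter> lat G = {}"
  and no_loop: "(v, v) \<notin> edges G"
  using dag topological by (auto simp: causal_dag_def topological_order_def acyclic_def)

lemmas set_ins = set_in_wires[OF topological edges_subset]
lemmas set_outs = set_out_wires[OF topological edges_subset]

text \<open>The condition on \<open>es\<close> is the loop invariant: the open wires lead from
  latent vertices already run to vertices not run so far. The topological order ensures that parents
  precede, and \<open>closed\<close> that the latent ones among them lie in
  \<open>U\<close>.\<close>

lemma runnable_filter:
  assumes closed: "\<And>u v. \<lbrakk>(u, v) \<in> edges G; v \<in> U; u \<in> lat G\<rbrakk> \<Longrightarrow> u \<in> U"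
    and "vs = us @ ws"
    and "set es = {(u, y) \<in> edges G. u \<in> lat G \<and> u \<in> U \<inter> set us \<and> y \<notin> U \<inter> set us}"
  shows "runnable G vs (filter (\<lambda>v. v \<in> U) ws) es \<and>
    set (run_wires (filter (\<lambda>v. v \<in> U) ws) es) =
      {(u, y) \<in> edges G. u \<in> lat G \<and> u \<in> U \<inter> set vs \<and> y \<notin> U \<inter> set vs}"
  using assms(2,3)
proof (induction ws arbitrary: us es)
  case Nil
  then have "us = vs" by simp
  then show ?case using Nil(2) by simp
next
  case (Cons w ws)
  show ?case
  proof (cases "w \<in> U")
    case False
    then have "U \<inter> set (us @ [w]) = U \<inter> set us" by auto
    then have n: "set es = {(u, y) \<in> edges G. u \<in> lat G \<and> u \<in> U \<inter> set (us @ [w]) \<and> y \<notin> U \<inter> set (us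
        @ [w])}"
      using Cons.prems(2) by simp
    have "vs = (us @ [w]) @ ws" using Cons.prems(1) by simp
    from Cons.IH[OF this n] show ?thesis using False by simp
  next
    case True
    have w: "w \<notin> set us"
      using distinct_vs Cons.prems(1) by auto
    have no_back_edge: "(w, y) \<notin> edges G" if "y \<in> set (us @ [w])" for y
      using topological that no_loop unfolding topological_order_def Cons.prems(1)
      by (auto simp: sorted_wrt_append)
    have earlier: "u \<in> set us" if "(u, w) \<in> edges G" for u
    proof -
      have "u \<in> set vs" using that edges_subset set_vs by auto
      moreover have "u \<notin> set ws" "u \<noteq> w"
        using topological that no_loop unfolding topological_order_def Cons.prems(1)
        by (auto simp: sorted_wrt_append)
      ultimately show ?thesis using Cons.prems(1) by auto
    qed
    have i: "set (ins w) \<subseteq> set es"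
      using closed[OF _ True] earlier w unfolding Cons.prems(2) set_ins by auto
    have f: "w \<notin> fst ` set es"
      using w unfolding Cons.prems(2) by auto
    have n: "set (nexts w es) = {(u, y) \<in> edges G. u \<in> lat G \<and> u \<in> U \<inter> set (us @ [w]) \<and> y \<notin> U \<inter>
        set (us @ [w])}"
      using True no_back_edge unfolding next_wires_def rest_wires_def set_append set_filter
          Cons.prems(2) set_ins set_outs
      by auto
    have "vs = (us @ [w]) @ ws" using Cons.prems(1) by simp
    from Cons.IH[OF this n] show ?thesis using True i f by simp
  qed
qed

section \<open>The circuit with its classical wires cut\<close>

abbreviation "H \<equiv> vvsplit G"

definition source :: "'n \<Rightarrow> 'n split_vertex" where
  "source u = (if u \<in> split_vertices G then Sharp u else Base u)"

definition parent_values :: "('n split_vertex \<Rightarrow> 'a) \<Rightarrow> 'n \<Rightarrow> 'n \<Rightarrow> 'a" where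
  "parent_values z v = (\<lambda>u\<in>parents G v \<inter> obs G. z (source u))"

text \<open>The tests are those of the given circuit. Only the classical data are decoupled: an
  outcome is read at the \<open>Base\<close> copy, while children of a split vertex receive the
  value at its \<open>Sharp\<close> copy.\<close>

definition split_transformation :: "('n split_vertex \<Rightarrow> 'a) \<Rightarrow> 'n \<Rightarrow> 't" where
  "split_transformation z v = T v (parent_values z v) (if v \<in> obs G then Some (z (Base v)) else
      None)"

definition base_list :: "'n split_vertex set \<Rightarrow> 'n list" where
  "base_list M = filter (\<lambda>v. Base v \<in> M) vs"

text \<open>The product is the uniform law that \<open>markov_kernels\<close> prescribes for the
  inputs. \<open>Sharp\<close> vertices carry no test, so they enter \<open>val\<close> only as
  classical inputs.\<close>

definition weight :: "'n split_vertex set \<Rightarrow> ('n split_vertex \<Rightarrow> 'a) \<Rightarrow> real" where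
  "weight M z = (\<Prod>s\<in>Sharp ` split_vertices G \<inter> M. 1 / real (card (alph H s))) *
     val (split_transformation z) (base_list M)"

lemma split_simps:
  "obs H = Base ` obs G \<union> Sharp ` split_vertices G" "lat H = Base ` lat G"
  "edges H = {(source u, Base y) | u y. (u, y) \<in> edges G}" "alph H z = alph G (orig z)"
  by (simp_all add: vvsplit_def source_def)

lemma split_subset: "split_vertices G \<subseteq> obs G" by (auto simp: split_vertices_def)

lemma source_lat: "u \<in> lat G \<Longrightarrow> source u = Base u"
  using split_subset obs_lat by (auto simp: source_def)

lemma source_obs: "u \<in> obs G \<Longrightarrow> source u \<in> obs H"
  by (auto simp: source_def split_simps)

lemma base_list_subset: "set (base_list M) \<subseteq> obs G \<union> lat G" "v \<in> set (base_list M) \<Longrightarrow> Base v \<in> M"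
  by (auto simp: base_list_def set_vs)

lemma runnable_base_list:
  assumes "latent_closed H M"
  shows "runnable G vs (base_list M) []"
proof -
  have "runnable G vs (filter (\<lambda>v. v \<in> {v. Base v \<in> M}) vs) []"
  proof (rule conjunct1[OF runnable_filter[where us = "[]"]])
    fix u v assume a: "(u, v) \<in> edges G" "v \<in> {v. Base v \<in> M}" "u \<in> lat G"
    then have "(Base u, Base v) \<in> edges H" "Base u \<in> lat H"
      using source_lat by (auto simp: split_simps) metis
    then show "u \<in> {v. Base v \<in> M}" using a assms by (auto simp: latent_closed_def)
  qed auto
  then show ?thesis by (simp add: base_list_def)
qed

lemma parent_values_configs:
  assumes "\<And>u. \<lbrakk>(u, v) \<in> edges G; u \<in> obs G\<rbrakk> \<Longrightarrow> z (source u) \<in> alph G u"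
  shows "parent_values z v \<in> configs G (parents G v \<inter> obs G)"
  using assms by (auto simp: parent_values_def configs_def parents_def)

lemma source_relevant: "\<lbrakk>(u, v) \<in> edges G; u \<in> obs G; Base v \<in> M\<rbrakk> \<Longrightarrow> source u \<in> relevant H M"
  using source_obs by (auto simp: relevant_def split_simps)

lemma base_relevant: "\<lbrakk>v \<in> obs G; Base v \<in> M\<rbrakk> \<Longrightarrow> Base v \<in> relevant H M"
  by (auto simp: relevant_def split_simps)

lemma orig_source [simp]: "orig (source u) = u" by (simp add: source_def)

lemma typed_split_transformation:
  assumes "\<And>n. n \<in> relevant H M \<Longrightarrow> z n \<in> alph H n"
  shows "typed (split_transformation z) (set (base_list M))"
  unfolding typed_def
proof
  fix v assume v: "v \<in> set (base_list M)"
  note v = subsetD[OF base_list_subset(1) v] base_list_subset(2)[OF v]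
  have "parent_values z v \<in> configs G (parents G v \<inter> obs G)"
    using assms source_relevant[OF _ _ v(2)] by (intro parent_values_configs) (metis orig_source
        split_simps(4))
  from tests[OF v(1) this]
  have "\<forall>o'\<in>outcomes G v. T v (parent_values z v) o' \<in> hom \<G> (csys (ins v)) (csys (outs v))"
    by (simp add: test_def)
  moreover have "(if v \<in> obs G then Some (z (Base v)) else None) \<in> outcomes G v"
    using assms[OF base_relevant[OF _ v(2)]] by (auto simp: outcomes_def split_simps)
  ultimately show "split_transformation z v \<in> hom \<G> (csys (ins v)) (csys (outs v))"
    unfolding split_transformation_def by blast
qed

lemma split_transformation_cong:
  assumes "\<And>n. n \<in> relevant H M \<Longrightarrow> x n = y n" "v \<in> set (base_list M)"
  shows "split_transformation x v = split_transformation y v"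
proof -
  note v = base_list_subset(2)[OF assms(2)]
  have "parent_values x v = parent_values y v"
    unfolding parent_values_def using assms(1)[OF source_relevant[OF _ _ v]]
    by (intro restrict_ext) (auto simp: parents_def)
  then show ?thesis
    using assms(1)[OF base_relevant[OF _ v]] by (simp add: split_transformation_def)
qed

text \<open>Serves observed and latent vertices alike, as a latent vertex has the single outcome
  \<open>None\<close>. A vertex without children in \<open>M\<close> sends no wire to a later vertex
  of the list, which is the freeness that \<open>sum_val\<close> asks for.\<close>

lemma sum_val_outcomes:
  assumes M: "ancestral H M" and n: "Base v \<in> M" and sink: "\<And>y. y \<in> M \<Longrightarrow> (Base v, y) \<notin> edges H"
    and z: "\<And>n. \<lbrakk>n \<in> M; n \<in> obs H; n \<noteq> Base v\<rbrakk> \<Longrightarrow> z n \<in> alph H n"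
  shows "(\<Sum>x\<in>outcomes G v. val ((split_transformation z)(v := T v (parent_values z v) x))
      (base_list M)) =
    val (split_transformation z) (base_list (M - {Base v}))"
proof -
  have v: "v \<in> obs G \<union> lat G" using M n by (auto simp: ancestral_def split_simps)
  then obtain us ws where vs: "vs = us @ v # ws" using set_vs by (metis split_list)
  have d: "v \<notin> set us" "v \<notin> set ws" using distinct_vs unfolding vs by auto
  define us' where "us' = filter (\<lambda>v. Base v \<in> M) us"
  define ws' where "ws' = filter (\<lambda>v. Base v \<in> M) ws"
  have b: "base_list M = us' @ v # ws'"
    using n unfolding base_list_def us'_def ws'_def unfolding vs by simp
  have b': "base_list (M - {Base v}) = us' @ ws'"
    using d unfolding base_list_def us'_def ws'_def unfolding vs
    by (auto intro!: arg_cong2[where f = append] filter_cong)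
  have lc: "latent_closed H (M - {Base v})"
    using M sink unfolding ancestral_def latent_closed_def by blast
  have "relevant H (M - {Base v}) \<subseteq> M \<inter> obs H - {Base v}"
    using M sink by (auto simp: relevant_def ancestral_def)
  then have ty: "typed (split_transformation z) (set (us' @ ws'))"
    unfolding b'[symmetric] using z by (intro typed_split_transformation) blast
  have pv: "parent_values z v \<in> configs G (parents G v \<inter> obs G)"
  proof (rule parent_values_configs)
    fix u assume u: "(u, v) \<in> edges G" "u \<in> obs G"
    then have e: "(source u, Base v) \<in> edges H" by (auto simp: split_simps)
    then have "source u \<in> M" "source u \<noteq> Base v" using M n sink by (auto simp: ancestral_def)
    then show "z (source u) \<in> alph G u" using z[of "source u"] source_obs[OF u(2)] by (simp add:
        split_simps)
  qed
  show ?thesis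
    unfolding b b'
  proof (rule sum_val[OF _ _ ty _ _ tests[OF v pv]])
    show "runnable G vs (us' @ v # ws') []"
      using runnable_base_list[OF ancestral_latent_closed[OF M]] by (simp add: b)
    show "runnable G vs (us' @ ws') []"
      using runnable_base_list[OF lc] by (simp add: b')
    show "v \<notin> set (us' @ ws')" using d by (auto simp: us'_def ws'_def)
    show "\<forall>w\<in>set ws'. set (ins w) \<inter> (set (ins v) \<union> set (outs v)) = {}"
    proof
      fix w assume w: "w \<in> set ws'"
      then have "w \<noteq> v" "Base w \<in> M" using d by (auto simp: ws'_def)
      moreover have "(v, w) \<notin> edges G" if "v \<in> lat G"
        using sink[OF \<open>Base w \<in> M\<close>] source_lat[OF that] by (auto simp: split_simps)
      ultimately show "set (ins w) \<inter> (set (ins v) \<union> set (outs v)) = {}"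
        by (auto simp: set_ins set_outs)
    qed
  qed
qed

sublocale weighted_dag H weight
proof
  show "causal_dag H" by (rule vvsplit_causal_dag(1)[OF dag])
  show "(\<forall>u. (u, c) \<notin> edges H) \<or> (\<forall>y. (c, y) \<notin> edges H)" if "c \<in> obs H" for c
    using that by (auto simp: split_simps source_def split_vertices_def split: if_splits)
  show "weight {} x = 1" for x by (simp add: weight_def base_list_def val_Nil)
  show "0 \<le> weight (obs H \<union> lat H) x" if "x \<in> configs H (obs H)" for x
  proof -
    have "latent_closed H (obs H \<union> lat H)" by (auto simp: latent_closed_def)
    moreover have "typed (split_transformation x) (set (base_list (obs H \<union> lat H)))"
      using that by (intro typed_split_transformation) (auto simp: relevant_def configs_def PiE_iff)
    ultimately show ?thesis
      unfolding weight_def by (intro mult_nonneg_nonneg prod_nonneg val_nonneg runnable_base_list)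
          auto
  qed
  show "weight M x = weight M y" if "latent_closed H M" "\<And>v. v \<in> relevant H M \<Longrightarrow> x v = y v" for M x y
    unfolding weight_def using split_transformation_cong[of M x y] that
    by (simp cong: val_cong)
  show "(\<Sum>a\<in>alph H n. weight M (x(n := a))) = weight (M - {n}) x"
    if M: "ancestral H M" and n: "n \<in> M" "n \<in> obs H" and sink: "\<And>y. y \<in> M \<Longrightarrow> (n, y) \<notin> edges H"
      and x: "\<And>v. \<lbrakk>v \<in> M; v \<in> obs H; v \<noteq> n\<rbrakk> \<Longrightarrow> x v \<in> alph H v" for M n x
  proof (cases n)
    case (Base v)
    then have v: "v \<in> obs G" using n(2) by (auto simp: split_simps)
    have S: "Sharp ` split_vertices G \<inter> (M - {n}) = Sharp ` split_vertices G \<inter> M" using Base by auto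
    \<comment> \<open>Since \<open>n\<close> has no child in \<open>M\<close>, changing its value
      alters no classical input, only the outcome at \<open>v\<close>.\<close>
    have src: "source u \<noteq> n" if "(u, w) \<in> edges G" "Base w \<in> M" for u w
      using sink[OF that(2)] that(1) by (auto simp: split_simps)
    have "val (split_transformation (x(n := a))) (base_list M) =
        val ((split_transformation x)(v := T v (parent_values x v) (Some a))) (base_list M)" for a
    proof (rule val_cong)
      fix w assume "w \<in> set (base_list M)"
      then have "Base w \<in> M" by (rule base_list_subset)
      then have "parent_values (x(n := a)) w = parent_values x w"
        using src unfolding parent_values_def by (intro restrict_ext) (auto simp: parents_def)
      then show "split_transformation (x(n := a)) w = ((split_transformation x)(v := T v
          (parent_values x v) (Some a))) w"
        using v Base by (simp add: split_transformation_def)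
    qed
    then have "(\<Sum>a\<in>alph H n. val (split_transformation (x(n := a))) (base_list M)) =
        (\<Sum>o'\<in>outcomes G v. val ((split_transformation x)(v := T v (parent_values x v) o'))
            (base_list M))"
      using v Base by (simp add: outcomes_def sum.reindex split_simps)
    also have "\<dots> = val (split_transformation x) (base_list (M - {n}))"
      using sum_val_outcomes[OF M, of v x] n sink x Base by simp
    finally show ?thesis
      unfolding weight_def S by (simp flip: sum_distrib_left)
  next
    case (Sharp u)
    have u: "u \<in> obs G" "u \<in> split_vertices G" using n(2) Sharp split_subset by (auto simp:
        split_simps)
    have b: "base_list (M - {n}) = base_list M" using Sharp by (simp add: base_list_def)
    \<comment> \<open>A \<open>Sharp\<close> vertex without children in \<open>M\<close> influences
      nothing; the sum is the alphabet size times a constant and cancels the factor of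
      \<open>n\<close>.\<close>
    have "relevant H (M - {n}) \<inter> {n} = {}" using sink by (auto simp: relevant_def)
    then have v: "val (split_transformation (x(n := a))) (base_list M) = val (split_transformation
        x) (base_list M)" for a
      unfolding b[symmetric] by (intro val_cong split_transformation_cong) auto
    have "finite (split_vertices G)" using dag split_subset by (auto simp: causal_dag_def intro:
        finite_subset)
    then have p: "(\<Prod>s\<in>Sharp ` split_vertices G \<inter> M. 1 / real (card (alph H s))) =
        1 / real (card (alph H n)) * (\<Prod>s\<in>Sharp ` split_vertices G \<inter> (M - {n}). 1 / real (card
            (alph H s)))"
      using u(2) n(1) Sharp by (subst prod.remove[where x = n]) (auto intro!: arg_cong2[where f =
          "(*)"] prod.cong)
    have "card (alph H n) \<noteq> 0" using dag u(1) Sharp by (auto simp: causal_dag_def split_simps)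
    then show ?thesis unfolding weight_def v b p by simp
  qed
  show "weight M x = weight (M - {n}) x"
    if M: "ancestral H M" and n: "n \<in> M" "n \<in> lat H" and sink: "\<And>y. y \<in> M \<Longrightarrow> (n, y) \<notin> edges H"
      and x: "\<And>v. \<lbrakk>v \<in> M; v \<in> obs H\<rbrakk> \<Longrightarrow> x v \<in> alph H v" for M n x
  proof -
    obtain v where v: "n = Base v" "v \<in> lat G" using n(2) by (auto simp: split_simps)
    have S: "Sharp ` split_vertices G \<inter> (M - {n}) = Sharp ` split_vertices G \<inter> M" using v by auto
    have o: "v \<notin> obs G" using v obs_lat by auto
    \<comment> \<open>The trivial outcome is the one already used at a latent vertex, so the
      one-term sum changes nothing.\<close>
    then have "(split_transformation x)(v := T v (parent_values x v) None) = split_transformation x"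
      by (auto simp: split_transformation_def)
    then have "val (split_transformation x) (base_list M) = val (split_transformation x)
        (base_list (M - {n}))"
      using sum_val_outcomes[OF M, of v x] n sink x v o by (simp add: outcomes_def)
    then show ?thesis unfolding weight_def S by simp
  qed
  show "weight (M \<union> L) x = weight M x * weight L x"
    if "latent_closed H M" "latent_closed H L" "M \<inter> L = {}"
      "\<And>v. v \<in> relevant H (M \<union> L) \<Longrightarrow> x v \<in> alph H v" for M L x
  proof -
    have "finite (split_vertices G)" using dag split_subset by (auto simp: causal_dag_def intro:
        finite_subset)
    then have p: "(\<Prod>s\<in>Sharp ` split_vertices G \<inter> (M \<union> L). 1 / real (card (alph H s))) =
        (\<Prod>s\<in>Sharp ` split_vertices G \<inter> M. 1 / real (card (alph H s))) *
        (\<Prod>s\<in>Sharp ` split_vertices G \<inter> L. 1 / real (card (alph H s)))"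
      unfolding Int_Un_distrib using that(3) by (intro prod.union_disjoint) auto
    have f: "filter (\<lambda>v. v \<in> {v. Base v \<in> M}) (base_list (M \<union> L)) = base_list M"
      "filter (\<lambda>v. v \<notin> {v. Base v \<in> M}) (base_list (M \<union> L)) = base_list L"
      using that(3) by (auto simp: base_list_def intro!: filter_cong)
    have "val (split_transformation x) (base_list (M \<union> L)) =
        val (split_transformation x) (base_list M) * val (split_transformation x) (base_list L)"
      using val_product[of "{v. Base v \<in> M}" "base_list (M \<union> L)", unfolded f]
        runnable_base_list that typed_split_transformation by blast
    then show ?thesis unfolding weight_def p by simp
  qed
qed

section \<open>The kernel and its projection\<close>

definition merge :: "('n split_vertex \<Rightarrow> 'a) \<Rightarrow> ('n split_vertex \<Rightarrow> 'a) \<Rightarrow> 'n split_vertex \<Rightarrow> 'a" where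
  "merge x s n = (case n of Base _ \<Rightarrow> x n | Sharp _ \<Rightarrow> s n)"

text \<open>Defined as the value of the cut circuit, not as a quotient of probabilities; by
  \<open>joint_eq\<close> it is the joint distribution without the uniform factor.\<close>

definition kernel :: "('n split_vertex \<Rightarrow> 'a) \<Rightarrow> ('n split_vertex \<Rightarrow> 'a) \<Rightarrow> real" where
  "kernel x s = val (split_transformation (merge x s)) vs"

abbreviation "S \<equiv> Sharp ` split_vertices G"

lemma base_list_all: "base_list (obs H \<union> lat H) = vs"
  using set_vs by (auto simp: base_list_def split_simps intro!: filter_True)

lemma weight_all: "weight (obs H \<union> lat H) z = (\<Prod>s\<in>S. 1 / real (card (alph H s))) * val
    (split_transformation z) vs"
proof -
  have "S \<inter> (obs H \<union> lat H) = S" by (auto simp: split_simps)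
  then show ?thesis by (simp add: weight_def base_list_all)
qed

lemma merge_configs:
  assumes "x \<in> configs H (Base ` obs G)" "s \<in> configs H S"
  shows "merge x s \<in> configs H (obs H)"
  using assms by (auto simp: configs_def PiE_iff merge_def split_simps extensional_def image_iff
      split: split_vertex.splits)

lemma joint_eq:
  "joint = (\<lambda>z\<in>configs H (obs H). kernel (restrict z (Base ` obs G)) (restrict z S) * (\<Prod>s\<in>S. 1 /
      real (card (alph H s))))"
  unfolding joint_def
proof (intro restrict_ext)
  fix z
  have "latent_closed H (obs H \<union> lat H)" by (auto simp: latent_closed_def)
  then have "weight (obs H \<union> lat H) z = weight (obs H \<union> lat H) (merge (restrict z (Base ` obs G))
      (restrict z S))"
    by (rule weight_local) (auto simp: relevant_def merge_def split_simps split: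
        split_vertex.splits)
  then show "weight (obs H \<union> lat H) z = kernel (restrict z (Base ` obs G)) (restrict z S) * (\<Prod>s\<in>S.
      1 / real (card (alph H s)))"
    by (simp add: weight_all kernel_def)
qed

lemma card_prod_pos: "(\<Prod>s\<in>S. 1 / real (card (alph H s))) > 0"
  using dag split_subset by (intro prod_pos) (auto simp: causal_dag_def split_simps card_gt_0_iff)

text \<open>Normalization for each \<open>s\<close> comes from computing the marginal on the inputs
  twice: as a sum of kernel values times the uniform factor, and as the weight of the inputs alone.
  The positive factor cancels.\<close>

lemma kernel_markov: "kernel \<in> markov_kernels H S"
proof -
  have B: "obs H - S = Base ` obs G" by (auto simp: split_simps)
  let ?c = "\<Prod>s\<in>S. 1 / real (card (alph H s))"
  have "0 \<le> kernel x s" if "x \<in> configs H (Base ` obs G)" "s \<in> configs H S" for x s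
    using weight_nonneg[OF merge_configs[OF that]] card_prod_pos
    by (auto simp: weight_all kernel_def zero_le_mult_iff)
  moreover have "(\<Sum>x\<in>configs H (Base ` obs G). kernel x s) = 1" if s: "s \<in> configs H S" for s
  proof -
    \<comment> \<open>The inputs are parentless, and no test belongs to them, so their weight is the
      bare uniform factor.\<close>
    have anc: "ancestral H S" by (auto simp: ancestral_def split_simps)
    have SS: "S \<inter> obs H = S" by (auto simp: split_simps)
    have "{y \<in> configs H S. \<forall>v\<in>S. y v = s v} = {s}"
      using s by (auto simp: configs_def intro: PiE_ext)
    then have "marginal H joint S s = weight S s"
      using marginal_joint[OF anc, of S s] by (simp add: SS)
    also have "base_list S = []" by (auto simp: base_list_def filter_empty_conv)
    then have "weight S s = ?c" by (simp add: weight_def val_Nil)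
    finally have "?c = marginal H joint S s" ..
    also have "\<dots> = (\<Sum>x\<in>configs H (Base ` obs G). kernel x s * ?c)"
      unfolding marginal_def
    proof (rule sum.reindex_bij_witness[where i = "\<lambda>x. merge x s" and j =
        "\<lambda>z. restrict z (Base ` obs G)"])
      fix z assume z: "z \<in> {z \<in> configs H (obs H). \<forall>v\<in>S. z v = s v}"
      then have zs: "restrict z S = s"
        using s by (auto simp: configs_def PiE_iff extensional_def fun_eq_iff)
      show "merge (restrict z (Base ` obs G)) s = z"
      proof
        fix n show "merge (restrict z (Base ` obs G)) s n = z n"
          using z by (cases n) (auto simp: zs[symmetric] merge_def configs_def PiE_iff split_simps
              extensional_def image_iff)
      qed
      show "restrict z (Base ` obs G) \<in> configs H (Base ` obs G)"
        using z by (auto simp: configs_def PiE_iff split_simps)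
      show "kernel (restrict z (Base ` obs G)) s * ?c = joint z"
        using z zs by (simp add: joint_eq)
    next
      fix x assume x: "x \<in> configs H (Base ` obs G)"
      show "restrict (merge x s) (Base ` obs G) = x"
        using x by (auto simp: configs_def PiE_iff extensional_def fun_eq_iff merge_def)
      show "merge x s \<in> {z \<in> configs H (obs H). \<forall>v\<in>S. z v = s v}"
        using merge_configs[OF x s] by (auto simp: merge_def)
    qed
    finally show ?thesis using card_prod_pos by (simp flip: sum_distrib_right)
  qed
  ultimately show ?thesis
    unfolding markov_kernels_def kernels_def B using joint_markov by (auto simp: joint_eq)
qed

text \<open>When all vertices are run, every wire is consumed and discarding concerns the empty
  list.\<close>

lemma val_circuit:
  assumes "typed \<tau> (set vs)"
  shows "val \<tau> vs = scalar \<G> (circuit \<G> G vs sys \<tau>)"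
proof -
  have 1: "runnable G vs (filter (\<lambda>v. v \<in> UNIV) vs) [] \<and>
    set (run_wires (filter (\<lambda>v. v \<in> UNIV) vs) []) =
      {(u, y) \<in> edges G. u \<in> lat G \<and> u \<in> UNIV \<inter> set vs \<and> y \<notin> UNIV \<inter> set vs}"
    by (rule runnable_filter[where us = "[]"]) auto
  have "y \<in> set vs" if "(u, y) \<in> edges G" for u y
    using that edges_subset set_vs by auto
  then have "set (run_wires vs []) = {}" using 1 by auto
  then have r: "runnable G vs vs []" "run_wires vs [] = []" using 1 by simp_all
  have "fst (foldl (step \<tau>) ([], ident \<G> \<I>) vs) = []"
    using foldl_step_append[where cs = "[]" and as = "[]" and ws = vs and A = \<I> and t =
        "ident \<G> \<I>" and \<tau> = \<tau>] r assms ident_hom by simp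
  then show ?thesis
    using foldl_step_hom(2)[OF r(1) assms] seq_ident(2)
    by (simp add: val_def close_def circuit_def)
qed

text \<open>Setting both copies of each split vertex to the same value reconnects the cut classical
  wires.\<close>

lemma projection_kernel:
  "projection G kernel =
    (\<lambda>x\<in>configs G (obs G). scalar \<G> (circuit \<G> G vs sys (vertex_transformation G T x)))"
  unfolding projection_def
proof (intro restrict_ext)
  fix x assume x: "x \<in> configs G (obs G)"
  define z where "z = merge (\<lambda>z\<in>Base ` obs G. x (orig z)) (\<lambda>z\<in>S. x (orig z))"
  have z: "z (source u) = x u" "z (Base u) = x u" if "u \<in> obs G" for u
    using that by (auto simp: z_def merge_def source_def)
  have eq: "split_transformation z v = vertex_transformation G T x v" for v
  proof -
    have "parent_values z v = restrict x (parents G v \<inter> obs G)"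
      unfolding parent_values_def using z by (intro restrict_ext) auto
    then show ?thesis using z by (simp add: split_transformation_def vertex_transformation_def
        outcome_def)
  qed
  have "z \<in> configs H (obs H)"
    unfolding z_def using x split_subset by (intro merge_configs) (auto simp: configs_def PiE_iff
        split_simps)
  then have "typed (split_transformation z) (set (base_list (obs H \<union> lat H)))"
    by (intro typed_split_transformation) (auto simp: relevant_def configs_def PiE_iff)
  then have "val (split_transformation z) vs = scalar \<G> (circuit \<G> G vs sys (split_transformation
      z))"
    by (intro val_circuit) (simp add: base_list_all)
  moreover have "split_transformation z = vertex_transformation G T x" using eq by auto
  ultimately show "kernel (\<lambda>z\<in>Base ` obs G. x (orig z)) (\<lambda>z\<in>S. x (orig z)) =
      scalar \<G> (circuit \<G> G vs sys (vertex_transformation G T x))"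
    by (simp add: kernel_def z_def)
qed

end

theorem lemma1:
  fixes G :: "('n, 'a) causal_dag"
  assumes "causal_dag G"
  shows "GPT TYPE('s \<times> 't \<times> 'v :: real_vector) G \<subseteq> VVS G"
proof
  fix p assume "p \<in> GPT TYPE('s \<times> 't \<times> 'v) G"
  then obtain \<G> :: "('s, 't, 'v) gpt" and vs sys T where
    gpt: "gpt \<G>" and top: "topological_order G vs" and
    tests: "\<forall>v\<in>obs G \<union> lat G. \<forall>y\<in>configs G (parents G v \<inter> obs G).
           test \<G> (composite \<G> sys (in_wires G vs v)) (composite \<G> sys (out_wires G vs v))
             (outcomes G v) (T v y)" and
    p: "p = (\<lambda>x\<in>configs G (obs G). scalar \<G> (circuit \<G> G vs sys (vertex_transformation G T x)))"
    by (auto simp: GPT_def gpt_distributions_def)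
  interpret gpt \<G> by (rule gpt)
  interpret gpt_dag \<G> G vs sys T
    using assms top tests by unfold_locales (auto simp: topological_order_def)
  show "p \<in> VVS G"
    unfolding VVS_def p projection_kernel[symmetric] using kernel_markov by blast
qed

end
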